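(* Let $1\le d\le n-1$, let $w\in W^P$ and let $X_w$ be the corresponding Schubert variety in the Grassmannian $\mathrm{Gr}(d,n)$. The following statements are equivalent. (1) $X_w$ is a toric variety with respect to the action of the maximal torus $T$. (2) Either $w=e$ or a reduced decomposition of $w$ is $$w=s_{d+x-1}s_{d+x-2}\cdots s_{d+1}\, s_{d-y}s_{d-y+1}\cdots s_d$$ for some $1\le x\le n-d$ and $0\le y\le d-1$, where for $x=1$ the factor $s_{d+x-1}s_{d+x-2}\cdots s_{d+1}$ is set to be $e$. (3) The partition $\lambda_w$ is the empty partition or a hook-shaped partition $(x,1^y)$ in the $d\times(n-d)$ rectangle.
   Context: $G=\mathrm{SL}_n(\mathbb{C})$, $B$ is the Borel subgroup of upper triangular matrices, $T\subset B$ is the maximal torus of diagonal matrices, $P=P_d\supset B$ is the maximal parabolic subgroup with $G/P\cong \mathrm{Gr}(d,n)$. The Weyl group is $\mathfrak{S}_n$ with simple reflections $s_i=(i\ i+1)$, $1\le i\le n-1$, and $W^P=\{w\in\mathfrak{S}_n \mid w(1)<\cdots<w(d),\ w(d+1)<\cdots<w(n)\}$. Products of permutations are composed from right to left. For $w\in W^P$, $X_w=\overline{BwP/P}\subset G/P$, which is stable under left multiplication by $T$; it is toric if it is a toric variety with respect to this $T$-action (i.e. it is normal and contains a dense $T$-orbit; the action need not be effective). The partition of $w$ is $\lambda_w=(\lambda_1,\dots,\lambda_d)$ with $\lambda_i=w(d-i+1)-(d-i+1)$ (trailing zeros are omitted); it sits inside the rectangle with $d$ rows and $n-d$ columns. A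 partition is hook-shaped if it has the form $(x,1^y)=(x,1,\dots,1)$ ($y$ ones) with $x\ge1$, $y\ge0$. *)

theory Defs
  imports
    "Jordan_Normal_Form.Determinant"
    "HOL-Algebra.Left_Coset"
    "HOL-Analysis.Abstract_Topology"
    "HOL-Combinatorics.Permutations"
    "HOL-Library.More_List"
begin

section \<open>The groups\<close>

text \<open>Matrices are indexed from 0, whereas permutations act on \<open>{1..n}\<close>: the basis vector
  \<open>e\<^sub>i\<close> corresponds to the index \<open>i - 1\<close>.\<close>

definition SL :: "nat \<Rightarrow> complex mat monoid" where
  "SL n = \<lparr>carrier = {g \<in> carrier_mat n n. det g = 1}, mult = (*), one = 1\<^sub>m n\<rparr>"

definition Borel :: "nat \<Rightarrow> complex mat set" where
  "Borel n = {b \<in> carrier (SL n). upper_triangular b}"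

definition Torus :: "nat \<Rightarrow> complex mat set" where
  "Torus n = {t \<in> carrier (SL n). diagonal_mat t}"

text \<open>The stabilizer of the span of the first \<open>d\<close> basis vectors.\<close>

definition Parabolic :: "nat \<Rightarrow> nat \<Rightarrow> complex mat set" where
  "Parabolic n d = {p \<in> carrier (SL n). \<forall>i j. d \<le> i \<and> i < n \<and> j < d \<longrightarrow> p $$ (i, j) = 0}"

text \<open>The Weyl group is the normalizer of the torus modulo the torus; this is the coset of
  the torus that corresponds to \<open>w\<close>, i.e. the matrices that send each line \<open>\<complex>e\<^sub>j\<close> to
  \<open>\<complex>e\<^bsub>w(j)\<^esub>\<close>.\<close>

definition weyl_coset :: "nat \<Rightarrow> (nat \<Rightarrow> nat) \<Rightarrow> complex mat set" where
  "weyl_coset n w =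
     {m \<in> carrier (SL n). \<forall>i<n. \<forall>j<n. m $$ (i, j) \<noteq> 0 \<longleftrightarrow> Suc i = w (Suc j)}"


section \<open>The variety \<open>G/P\<close>\<close>

text \<open>Polynomial functions in the matrix entries.\<close>

inductive_set poly_funs :: "nat \<Rightarrow> (complex mat \<Rightarrow> complex) set" for n where
  const: "(\<lambda>_. c) \<in> poly_funs n"
| entry: "i < n \<Longrightarrow> j < n \<Longrightarrow> (\<lambda>g. g $$ (i, j)) \<in> poly_funs n"
| add: "p \<in> poly_funs n \<Longrightarrow> q \<in> poly_funs n \<Longrightarrow> (\<lambda>g. p g + q g) \<in> poly_funs n"
| mult: "p \<in> poly_funs n \<Longrightarrow> q \<in> poly_funs n \<Longrightarrow> (\<lambda>g. p g * q g) \<in> poly_funs n"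

definition SL_open :: "nat \<Rightarrow> complex mat set \<Rightarrow> bool" where
  "SL_open n U \<longleftrightarrow> (\<exists>S \<subseteq> poly_funs n. U = carrier (SL n) - {g. \<forall>f\<in>S. f g = 0})"

definition SL_zariski :: "nat \<Rightarrow> complex mat topology" where
  "SL_zariski n = topology (SL_open n)"

definition GP :: "nat \<Rightarrow> nat \<Rightarrow> complex mat set set" where
  "GP n d = lcosets\<^bsub>SL n\<^esub> (Parabolic n d)"

definition proj :: "nat \<Rightarrow> nat \<Rightarrow> complex mat \<Rightarrow> complex mat set" where
  "proj n d g = g <#\<^bsub>SL n\<^esub> Parabolic n d"

text \<open>\<open>G/P\<close> is the quotient variety: it carries the quotient of the Zariski topology, and a
  function on an open subset of it is regular iff its pullback to \<open>G\<close> is.\<close>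

definition GP_open :: "nat \<Rightarrow> nat \<Rightarrow> complex mat set set \<Rightarrow> bool" where
  "GP_open n d U \<longleftrightarrow>
     U \<subseteq> GP n d \<and> openin (SL_zariski n) {g \<in> carrier (SL n). proj n d g \<in> U}"

definition GP_zariski :: "nat \<Rightarrow> nat \<Rightarrow> complex mat set topology" where
  "GP_zariski n d = topology (GP_open n d)"

definition GP_regular ::
    "nat \<Rightarrow> nat \<Rightarrow> complex mat set set \<Rightarrow> (complex mat set \<Rightarrow> complex) \<Rightarrow> bool" where
  "GP_regular n d U f \<longleftrightarrow>
     (\<forall>g\<in>carrier (SL n). proj n d g \<in> U \<longrightarrow>
        (\<exists>p\<in>poly_funs n. \<exists>q\<in>poly_funs n. q g \<noteq> 0 \<and>
           (\<forall>h\<in>carrier (SL n). proj n d h \<in> U \<and> q h \<noteq> 0 \<longrightarrow> f (proj n d h) = p h / q h)))"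

lemma istopology_SL_open: "istopology (SL_open n)"
  unfolding istopology_def
proof (intro conjI allI impI)
  fix U V assume "SL_open n U" "SL_open n V"
  then obtain S S' where S: "S \<subseteq> poly_funs n" "U = carrier (SL n) - {g. \<forall>f\<in>S. f g = 0}"
    and S': "S' \<subseteq> poly_funs n" "V = carrier (SL n) - {g. \<forall>f\<in>S'. f g = 0}"
    unfolding SL_open_def by (elim exE conjE)
  let ?S = "(\<lambda>(f, h). \<lambda>g. f g * h g) ` (S \<times> S')"
  have "?S \<subseteq> poly_funs n"
    using S(1) S'(1) by (auto intro!: poly_funs.mult)
  moreover have "U \<inter> V = carrier (SL n) - {g. \<forall>f\<in>?S. f g = 0}"
    unfolding S(2) S'(2) by auto
  ultimately show "SL_open n (U \<inter> V)"
    unfolding SL_open_def by (intro exI conjI)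
next
  fix K assume K: "\<forall>U\<in>K. SL_open n U"
  define S where "S = {f \<in> poly_funs n. \<forall>g\<in>carrier (SL n). f g \<noteq> 0 \<longrightarrow> g \<in> \<Union>K}"
  have "g \<in> carrier (SL n) \<and> (\<exists>f\<in>S. f g \<noteq> 0)" if g: "g \<in> U" and U: "U \<in> K" for g U
  proof -
    from K U obtain S' where S': "S' \<subseteq> poly_funs n"
        and "U = carrier (SL n) - {g. \<forall>f\<in>S'. f g = 0}"
      unfolding SL_open_def by auto
    then have mem: "h \<in> U \<longleftrightarrow> h \<in> carrier (SL n) \<and> (\<exists>f\<in>S'. f h \<noteq> 0)" for h by simp
    with g obtain f where f: "f \<in> S'" "f g \<noteq> 0" by auto
    have "f \<in> S" using f(1) S' U mem unfolding S_def by blast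
    with f(2) g mem show ?thesis by auto
  qed
  then have "\<Union>K \<subseteq> carrier (SL n) - {g. \<forall>f\<in>S. f g = 0}"
    by blast
  moreover have "carrier (SL n) - {g. \<forall>f\<in>S. f g = 0} \<subseteq> \<Union>K"
    by (auto simp: S_def)
  ultimately have "\<Union>K = carrier (SL n) - {g. \<forall>f\<in>S. f g = 0}"
    by (rule equalityI)
  moreover have "S \<subseteq> poly_funs n"
    unfolding S_def by simp
  ultimately show "SL_open n (\<Union>K)"
    unfolding SL_open_def by (intro exI conjI)
qed

lemma openin_SL_zariski: "openin (SL_zariski n) = SL_open n"
  unfolding SL_zariski_def using istopology_SL_open by (rule topology_inverse')

lemma istopology_GP_open: "istopology (GP_open n d)"
  unfolding istopology_def
proof (intro conjI allI impI)
  fix U V assume *: "GP_open n d U" "GP_open n d V"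
  have "{g \<in> carrier (SL n). proj n d g \<in> U \<inter> V} =
      {g \<in> carrier (SL n). proj n d g \<in> U} \<inter> {g \<in> carrier (SL n). proj n d g \<in> V}"
    by blast
  with * show "GP_open n d (U \<inter> V)"
    unfolding GP_open_def by (auto intro: openin_Int)
next
  fix K assume *: "\<forall>U\<in>K. GP_open n d U"
  have "{g \<in> carrier (SL n). proj n d g \<in> \<Union>K} =
      \<Union>((\<lambda>U. {g \<in> carrier (SL n). proj n d g \<in> U}) ` K)"
    by blast
  moreover have "openin (SL_zariski n) \<dots>"
    using * unfolding GP_open_def by (intro openin_Union) blast
  ultimately show "GP_open n d (\<Union>K)"
    using * unfolding GP_open_def by auto
qed

lemma openin_GP_zariski: "openin (GP_zariski n d) = GP_open n d"
  unfolding GP_zariski_def using istopology_GP_open by (rule topology_inverse')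


section \<open>Toric subvarieties of \<open>G/P\<close>\<close>

text \<open>For \<open>V\<close> open in a closed subvariety of \<open>G/P\<close>: \<open>f\<close> is locally the restriction of a
  regular function on an open subset of \<open>G/P\<close>.\<close>

definition regular_on ::
    "nat \<Rightarrow> nat \<Rightarrow> complex mat set set \<Rightarrow> (complex mat set \<Rightarrow> complex) \<Rightarrow> bool" where
  "regular_on n d V f \<longleftrightarrow>
     (\<forall>x\<in>V. \<exists>U h. openin (GP_zariski n d) U \<and> x \<in> U \<and> GP_regular n d U h \<and>
        (\<forall>y\<in>U \<inter> V. f y = h y))"

definition irreducible_space :: "'a topology \<Rightarrow> bool" where
  "irreducible_space Z \<longleftrightarrow> topspace Z \<noteq> {} \<and>
     (\<forall>C D. closedin Z C \<and> closedin Z D \<and> topspace Z = C \<union> D \<longrightarrow>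
        C = topspace Z \<or> D = topspace Z)"

text \<open>All local rings of \<open>X\<close> are integrally closed.  The fraction field of the local ring
  at a point \<open>x\<close> of the irreducible variety \<open>X\<close> is the field of rational functions on \<open>X\<close>,
  whose elements are represented by regular functions \<open>\<phi>\<close> on nonempty open subsets \<open>V\<close>; two
  such represent the same element iff they agree where both are defined.  If \<open>\<phi>\<close> is a root
  of a monic polynomial whose coefficients \<open>c\<^sub>i\<close> are regular near \<open>x\<close>, then \<open>\<phi>\<close> belongs to
  the local ring at \<open>x\<close>.\<close>

definition normal_variety :: "nat \<Rightarrow> nat \<Rightarrow> complex mat set set \<Rightarrow> bool" where
  "normal_variety n d X \<longleftrightarrow>
     (let Z = subtopology (GP_zariski n d) X in
      irreducible_space Z \<and>
      (\<forall>x\<in>X. \<forall>V \<phi>. openin Z V \<and> V \<noteq> {} \<and> regular_on n d V \<phi> \<and>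
         (\<exists>W m c. openin Z W \<and> x \<in> W \<and> 0 < m \<and> (\<forall>i<m. regular_on n d W (c i)) \<and>
            (\<forall>y\<in>V \<inter> W. \<phi> y ^ m + (\<Sum>i<m. c i y * \<phi> y ^ i) = 0)) \<longrightarrow>
         (\<exists>W f. openin Z W \<and> x \<in> W \<and> regular_on n d W f \<and> (\<forall>y\<in>V \<inter> W. f y = \<phi> y))))"

definition torus_orbit :: "nat \<Rightarrow> complex mat set \<Rightarrow> complex mat set set" where
  "torus_orbit n x = (\<lambda>t. t <#\<^bsub>SL n\<^esub> x) ` Torus n"

definition toric_variety :: "nat \<Rightarrow> nat \<Rightarrow> complex mat set set \<Rightarrow> bool" where
  "toric_variety n d X \<longleftrightarrow> normal_variety n d X \<and>
     (\<exists>x\<in>X. torus_orbit n x \<subseteq> X \<and> X \<subseteq> GP_zariski n d closure_of torus_orbit n x)"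

definition Schubert :: "nat \<Rightarrow> nat \<Rightarrow> (nat \<Rightarrow> nat) \<Rightarrow> complex mat set set" where
  "Schubert n d w =
     GP_zariski n d closure_of {proj n d (b * m) | b m. b \<in> Borel n \<and> m \<in> weyl_coset n w}"


section \<open>Permutations and partitions\<close>

definition min_coset_reps :: "nat \<Rightarrow> nat \<Rightarrow> (nat \<Rightarrow> nat) set" where
  "min_coset_reps n d =
     {w. w permutes {1..n} \<and> strict_mono_on {1..d} w \<and> strict_mono_on {d+1..n} w}"

text \<open>The word \<open>[i\<^sub>1, \<dots>, i\<^sub>k]\<close> stands for \<open>s\<^bsub>i\<^sub>1\<^esub> \<circ> \<cdots> \<circ> s\<^bsub>i\<^sub>k\<^esub>\<close>.\<close>

definition word_perm :: "nat list \<Rightarrow> nat \<Rightarrow> nat" where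
  "word_perm is = foldr (\<lambda>i p. Transposition.transpose i (i + 1) \<circ> p) is id"

definition reduced_decomposition :: "nat \<Rightarrow> (nat \<Rightarrow> nat) \<Rightarrow> nat list \<Rightarrow> bool" where
  "reduced_decomposition n w is \<longleftrightarrow> set is \<subseteq> {1..n-1} \<and> word_perm is = w \<and>
     (\<forall>js. set js \<subseteq> {1..n-1} \<and> word_perm js = w \<longrightarrow> length is \<le> length js)"

text \<open>The subtraction does not truncate for \<open>w\<close> in \<open>min_coset_reps n d\<close>, since then
  \<open>i \<le> w(i)\<close> for \<open>i \<le> d\<close>.\<close>

definition partition_of :: "nat \<Rightarrow> (nat \<Rightarrow> nat) \<Rightarrow> nat list" where
  "partition_of d w =
     strip_while (\<lambda>k. k = 0) (map (\<lambda>i. w (d - i + 1) - (d - i + 1)) [1..<d+1])"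

definition in_rectangle :: "nat \<Rightarrow> nat \<Rightarrow> nat list \<Rightarrow> bool" where
  "in_rectangle r c ks \<longleftrightarrow> length ks \<le> r \<and> (\<forall>k\<in>set ks. k \<le> c)"

definition hook_shaped :: "nat list \<Rightarrow> bool" where
  "hook_shaped ks \<longleftrightarrow> (\<exists>x y. 1 \<le> x \<and> ks = x # replicate y 1)"

end

(* The Schubert variety of a hook is the closure of the set of points whose matrix coordinates
   around the base point form a matrix u v^T of rank at most one with u and v of lengths x and
   y + 1. The torus scales the entries of u and v independently, so that it has a dense orbit, and
   the coordinate ring is spanned by the monomials in u and v whose degrees in u and in v agree.
   These exponents form a saturated monoid: if f / g is integral over its algebra, then the powers
   of f / g have a common denominator, so that the leading monomial of f / g has an exponent in the
   monoid and can be subtracted; iterating this shows that f / g lies in the algebra. Every point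
   of G/P is moved into the chart around the base point by an element of B, so that this settles
   normality everywhere.

   If the partition is neither empty nor a hook, then it contains (2,2), and the cross ratio of the
   four corresponding coordinates of the Schubert cell, a ratio of products of two Plucker
   coordinates, is a nonconstant T-invariant rational function, so that no T-orbit is dense. *)

theory Submission
  imports Defs "HOL-Library.Poly_Mapping"
begin

section \<open>Monomial algebras of saturated semigroups are normal\<close>

text \<open>The fraction field of the monomial algebra is smaller than the field of all quotients of
  polynomials in z. A rational function on the variety is therefore kept as f / g with both f and g
  in the algebra, and normality is phrased as divisibility inside it. The coefficients of an
  integral equation are only local fractions. Near the given point they have a common denominator s;
  then s \<phi> is integral over the algebra itself, hence equal to some r of the algebra, and
  \<phi> = r / s there. A polynomial function on G is in general not invariant under P, so closures
  in G/P are tested at a fixed representative and the factor from P is carried along. Irreducibility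
  of affine space is replaced by polynomial curves, along which a polynomial function has finitely
  many zeros unless it vanishes identically. That X has no further points in the chart comes from
  equations: vanishing entries and 2 by 2 minors pass from the cell to its closure.\<close>

abbreviation lookup where "lookup \<equiv> Poly_Mapping.lookup"
abbreviation keys where "keys \<equiv> Poly_Mapping.keys"

definition mono_eval :: "(nat \<Rightarrow>\<^sub>0 nat) \<Rightarrow> (nat \<Rightarrow> 'a::comm_semiring_1) \<Rightarrow> 'a" where
  "mono_eval \<alpha> z = (\<Prod>i\<in>keys \<alpha>. z i ^ lookup \<alpha> i)"

lemma mono_eval_superset:
  assumes "finite A" "keys \<alpha> \<subseteq> A"
  shows "mono_eval \<alpha> z = (\<Prod>i\<in>A. z i ^ lookup \<alpha> i)"
  unfolding mono_eval_def using assms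
  by (intro prod.mono_neutral_left) (auto simp: in_keys_iff)

lemma mono_eval_0 [simp]: "mono_eval 0 z = 1"
  by (simp add: mono_eval_def)

lemma mono_eval_single [simp]: "mono_eval (Poly_Mapping.single i k) z = z i ^ k"
  by (simp add: mono_eval_def)

lemma mono_eval_add: "mono_eval (\<alpha> + \<beta>) z = mono_eval \<alpha> z * mono_eval \<beta> z"
proof -
  let ?A = "keys \<alpha> \<union> keys \<beta>"
  have "keys (\<alpha> + \<beta>) \<subseteq> ?A" by (rule keys_add)
  then show ?thesis
    by (simp add: mono_eval_superset [of ?A] lookup_add power_add prod.distrib)
qed

lemma mono_eval_mult: "mono_eval \<alpha> (\<lambda>i. z i * z' i) = mono_eval \<alpha> z * mono_eval \<alpha> z'"
  by (simp add: mono_eval_def power_mult_distrib prod.distrib)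

lemma mono_eval_one [simp]: "mono_eval \<alpha> (\<lambda>i. 1) = 1"
  by (simp add: mono_eval_def)

text \<open>Powers of 2 are distinct in characteristic zero, so the point with 2 at an index where
  the exponents differ and 1 elsewhere separates.\<close>

lemma mono_eval_separates:
  assumes "\<alpha> \<noteq> \<beta>"
  obtains z :: "nat \<Rightarrow> 'a::field_char_0" where "mono_eval \<alpha> z \<noteq> mono_eval \<beta> z"
proof -
  obtain i where i: "lookup \<alpha> i \<noteq> lookup \<beta> i"
    using assms poly_mapping_eqI by metis
  let ?z = "(\<lambda>j. if j = i then 2 else 1) :: nat \<Rightarrow> 'a"
  have "mono_eval \<gamma> ?z = 2 ^ lookup \<gamma> i" for \<gamma>
  proof -
    have "mono_eval \<gamma> ?z = (\<Prod>j\<in>insert i (keys \<gamma>). ?z j ^ lookup \<gamma> j)"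
      by (intro mono_eval_superset) auto
    also have "\<dots> = (\<Prod>j\<in>insert i (keys \<gamma>). if j = i then 2 ^ lookup \<gamma> i else 1)"
      by (intro prod.cong) auto
    also have "\<dots> = 2 ^ lookup \<gamma> i"
      by simp
    finally show ?thesis .
  qed
  moreover have "(2::'a) ^ a = 2 ^ b \<longleftrightarrow> a = b" for a b :: nat
  proof -
    have "(2::'a) ^ a = 2 ^ b \<longleftrightarrow> (of_nat (2 ^ a) :: 'a) = of_nat (2 ^ b)" by simp
    then show ?thesis unfolding of_nat_eq_iff by simp
  qed
  ultimately show ?thesis using i that by metis
qed

text \<open>Artin's argument for the linear independence of characters.\<close>

lemma mono_eval_independent:
  fixes c :: "(nat \<Rightarrow>\<^sub>0 nat) \<Rightarrow> 'a::field_char_0"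
  assumes "finite F" "\<And>z. (\<Sum>\<alpha>\<in>F. c \<alpha> * mono_eval \<alpha> z) = 0" "\<alpha> \<in> F"
  shows "c \<alpha> = 0"
  using assms
proof (induction F arbitrary: c \<alpha> rule: finite_induct)
  case empty
  then show ?case by simp
next
  case (insert \<beta> F)
  have other: "c \<gamma> = 0" if \<gamma>: "\<gamma> \<in> F" for \<gamma>
  proof -
    have "\<gamma> \<noteq> \<beta>" using insert.hyps \<gamma> by auto
    then obtain z0 :: "nat \<Rightarrow> 'a" where z0: "mono_eval \<gamma> z0 \<noteq> mono_eval \<beta> z0"
      by (rule mono_eval_separates)
    \<comment> \<open>The relation at the product of \<open>z0\<close> and \<open>z\<close> minus
      \<open>mono_eval \<beta> z0\<close> times the relation at \<open>z\<close>: the term of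
      \<beta> cancels, that of \<gamma> keeps a nonzero factor.\<close>
    let ?c = "\<lambda>\<alpha>. c \<alpha> * (mono_eval \<alpha> z0 - mono_eval \<beta> z0)"
    have "(\<Sum>\<alpha>\<in>F. ?c \<alpha> * mono_eval \<alpha> z) = 0" for z
    proof -
      have "(\<Sum>\<alpha>\<in>F. ?c \<alpha> * mono_eval \<alpha> z) = (\<Sum>\<alpha>\<in>insert \<beta> F. ?c \<alpha> * mono_eval \<alpha> z)"
        using insert.hyps by simp
      also have "\<dots> = (\<Sum>\<alpha>\<in>insert \<beta> F. c \<alpha> * mono_eval \<alpha> (\<lambda>i. z0 i * z i)) -
          mono_eval \<beta> z0 * (\<Sum>\<alpha>\<in>insert \<beta> F. c \<alpha> * mono_eval \<alpha> z)"
        unfolding sum_distrib_left sum_subtractf [symmetric]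
        by (intro sum.cong) (simp_all add: mono_eval_mult algebra_simps)
      also have "\<dots> = 0" using insert.prems(1) by simp
      finally show ?thesis .
    qed
    from insert.IH [of ?c, OF this \<gamma>] z0 show ?thesis by simp
  qed
  \<comment> \<open>At the all-ones point each monomial is 1, so only \<open>c \<beta>\<close> is
    left of the sum.\<close>
  have "c \<beta> = 0"
    using insert.prems(1) [of "\<lambda>i. 1"] insert.hyps other by simp
  with other insert.prems(2) show ?case by auto
qed

section \<open>Polynomials as finitely supported functions of exponents\<close>

definition peval :: "((nat \<Rightarrow>\<^sub>0 nat) \<Rightarrow>\<^sub>0 'a::comm_ring_1) \<Rightarrow> (nat \<Rightarrow> 'a) \<Rightarrow> 'a" where
  "peval p z = (\<Sum>\<alpha>\<in>keys p. lookup p \<alpha> * mono_eval \<alpha> z)"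

lemma peval_superset:
  assumes "finite A" "keys p \<subseteq> A"
  shows "peval p z = (\<Sum>\<alpha>\<in>A. lookup p \<alpha> * mono_eval \<alpha> z)"
  unfolding peval_def using assms
  by (intro sum.mono_neutral_left) (auto simp: in_keys_iff)

lemma peval_0 [simp]: "peval 0 z = 0"
  by (simp add: peval_def)

lemma peval_single [simp]: "peval (Poly_Mapping.single \<alpha> c) z = c * mono_eval \<alpha> z"
  by (simp add: peval_def)

lemma peval_add: "peval (p + q) z = peval p z + peval q z"
proof -
  let ?A = "keys p \<union> keys q"
  have "keys (p + q) \<subseteq> ?A" by (rule keys_add)
  then show ?thesis
    by (simp add: peval_superset [of ?A] lookup_add sum.distrib algebra_simps)
qed

lemma peval_sum: "peval (\<Sum>i\<in>A. p i) z = (\<Sum>i\<in>A. peval (p i) z)"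
  by (induction A rule: infinite_finite_induct) (simp_all add: peval_add)

lemma poly_mapping_sum_single: "p = (\<Sum>\<alpha>\<in>keys p. Poly_Mapping.single \<alpha> (lookup p \<alpha>))"
  by (rule poly_mapping_eqI)
    (auto simp: lookup_sum lookup_single when_def sum.delta in_keys_iff)

text \<open>The convolution product as a finite sum of monomials, from which both values and single
  coefficients can be read.\<close>

lemma mult_sum_single:
  "p * q = (\<Sum>\<alpha>\<in>keys p. \<Sum>\<beta>\<in>keys q. Poly_Mapping.single (\<alpha> + \<beta>) (lookup p \<alpha> * lookup q \<beta>))"
proof -
  have "p * q = (\<Sum>\<alpha>\<in>keys p. Poly_Mapping.single \<alpha> (lookup p \<alpha>)) *
      (\<Sum>\<beta>\<in>keys q. Poly_Mapping.single \<beta> (lookup q \<beta>))"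
    using poly_mapping_sum_single [of p] poly_mapping_sum_single [of q] by simp
  then show ?thesis by (simp add: sum_product mult_single)
qed

lemma peval_mult: "peval (p * q) z = peval p z * peval q z"
  unfolding mult_sum_single [of p q] peval_sum peval_single mono_eval_add
  by (simp add: peval_def sum_product algebra_simps)

lemma peval_1 [simp]: "peval 1 z = 1"
  unfolding peval_def by (simp add: lookup_one)

lemma peval_power: "peval (p ^ k) z = peval p z ^ k"
  by (induction k) (simp_all add: peval_mult)

lemma peval_prod: "peval (\<Prod>i\<in>A. p i) z = (\<Prod>i\<in>A. peval (p i) z)"
  by (induction A rule: infinite_finite_induct) (simp_all add: peval_mult)

text \<open>Passes from identities between functions of \<open>z\<close> to identities in the
  polynomial ring, where nonzero factors can be cancelled.\<close>

lemma peval_eq_0_iff: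
  fixes p :: "(nat \<Rightarrow>\<^sub>0 nat) \<Rightarrow>\<^sub>0 'a::field_char_0"
  shows "(\<forall>z. peval p z = 0) \<longleftrightarrow> p = 0"
proof
  assume "\<forall>z. peval p z = 0"
  then have "lookup p \<alpha> = 0" if "\<alpha> \<in> keys p" for \<alpha>
    using mono_eval_independent [of "keys p" "lookup p" \<alpha>] that by (simp add: peval_def)
  then show "p = 0" by (metis in_keys_iff poly_mapping_eqI lookup_zero)
qed simp

text \<open>The order on exponents is lexicographic, decided at the first index of difference; it is
  total and compatible with addition. For \<open>p = 0\<close> the value is unspecified.\<close>

definition lead_mono :: "((nat \<Rightarrow>\<^sub>0 nat) \<Rightarrow>\<^sub>0 'a::zero) \<Rightarrow> (nat \<Rightarrow>\<^sub>0 nat)" where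
  "lead_mono p = Max (keys p)"

lemma lead_mono_in_keys: "p \<noteq> 0 \<Longrightarrow> lead_mono p \<in> keys p"
  unfolding lead_mono_def by (intro Max_in) auto

lemma le_lead_mono: "\<alpha> \<in> keys p \<Longrightarrow> \<alpha> \<le> lead_mono p"
  unfolding lead_mono_def by (intro Max_ge) auto

text \<open>The sum of the two maxima arises from one pair of exponents only, so nothing can cancel
  in this coefficient.\<close>

lemma lookup_mult_lead_mono:
  fixes p q :: "(nat \<Rightarrow>\<^sub>0 nat) \<Rightarrow>\<^sub>0 'a::comm_ring_1"
  assumes "p \<noteq> 0" "q \<noteq> 0"
  shows "lookup (p * q) (lead_mono p + lead_mono q) =
    lookup p (lead_mono p) * lookup q (lead_mono q)"
proof -
  have eq: "\<alpha> + \<beta> = lead_mono p + lead_mono q \<longleftrightarrow> \<alpha> = lead_mono p \<and> \<beta> = lead_mono q"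
    if "\<alpha> \<in> keys p" "\<beta> \<in> keys q" for \<alpha> \<beta>
    using le_lead_mono [OF that(1)] le_lead_mono [OF that(2)]
      add_less_le_mono [of \<alpha> "lead_mono p" \<beta> "lead_mono q"]
      add_le_less_mono [of \<alpha> "lead_mono p" \<beta> "lead_mono q"]
    by (metis order_le_less order_less_irrefl)
  have "lookup (p * q) (lead_mono p + lead_mono q) =
    (\<Sum>\<alpha>\<in>keys p. \<Sum>\<beta>\<in>keys q. if \<alpha> = lead_mono p \<and> \<beta> = lead_mono q
        then lookup p \<alpha> * lookup q \<beta> else 0)"
    unfolding mult_sum_single [of p q] lookup_sum lookup_single when_def
    by (intro sum.cong refl if_cong eq)
  also have "\<dots> = (\<Sum>\<alpha>\<in>keys p. if \<alpha> = lead_mono p then (\<Sum>\<beta>\<in>keys q.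
      if \<beta> = lead_mono q then lookup p \<alpha> * lookup q \<beta> else 0) else 0)"
    by (intro sum.cong) auto
  also have "\<dots> = lookup p (lead_mono p) * lookup q (lead_mono q)"
    using assms by (simp add: sum.delta lead_mono_in_keys)
  finally show ?thesis .
qed

lemma lead_mono_mult:
  fixes p q :: "(nat \<Rightarrow>\<^sub>0 nat) \<Rightarrow>\<^sub>0 'a::idom"
  assumes "p \<noteq> 0" "q \<noteq> 0"
  shows "lead_mono (p * q) = lead_mono p + lead_mono q"
  unfolding lead_mono_def [of "p * q"]
proof (rule Max_eqI)
  have "lookup p (lead_mono p) * lookup q (lead_mono q) \<noteq> 0"
    using assms lead_mono_in_keys in_keys_iff by (metis no_zero_divisors)
  then show "lead_mono p + lead_mono q \<in> keys (p * q)"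
    using lookup_mult_lead_mono [OF assms] by (simp add: in_keys_iff)
  fix \<gamma> assume "\<gamma> \<in> keys (p * q)"
  then obtain \<alpha> \<beta> where "\<alpha> \<in> keys p" "\<beta> \<in> keys q" "\<gamma> = \<alpha> + \<beta>"
    using keys_mult [of p q] by auto
  then show "\<gamma> \<le> lead_mono p + lead_mono q"
    by (simp add: add_mono le_lead_mono)
qed simp

lemma lead_mono_power:
  fixes p :: "(nat \<Rightarrow>\<^sub>0 nat) \<Rightarrow>\<^sub>0 'a::idom"
  assumes "p \<noteq> 0"
  shows "lookup (lead_mono (p ^ k)) i = k * lookup (lead_mono p) i"
proof (induction k)
  case 0
  show ?case by (simp add: lead_mono_def)
next
  case (Suc k)
  then show ?case using assms by (simp add: lead_mono_mult lookup_add)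
qed

text \<open>In infinitely many variables the lexicographic order is not well-founded: the single
  variables form a descending chain. With all indices below \<open>N\<close> it is the order on
  words of length \<open>N\<close>.\<close>

lemma wf_mono_less:
  "wf {(\<alpha>, \<beta>). \<alpha> < \<beta> \<and> keys \<alpha> \<subseteq> {..<N} \<and> keys (\<beta> :: nat \<Rightarrow>\<^sub>0 nat) \<subseteq> {..<N}}"
    (is "wf ?R")
proof (rule wf_subset)
  let ?f = "\<lambda>\<alpha> :: nat \<Rightarrow>\<^sub>0 nat. map (lookup \<alpha>) [0..<N]"
  show "wf (inv_image (lexn less_than N) ?f)"
    by (intro wf_inv_image wf_lexn wf_less_than)
  show "?R \<subseteq> inv_image (lexn less_than N) ?f"
  proof (clarify)
    fix \<alpha> \<beta> :: "nat \<Rightarrow>\<^sub>0 nat"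
    assume "\<alpha> < \<beta>" and N: "keys \<alpha> \<subseteq> {..<N}" "keys \<beta> \<subseteq> {..<N}"
    then obtain k where k: "lookup \<alpha> k < lookup \<beta> k" "\<And>k'. k' < k \<Longrightarrow> lookup \<alpha> k' = lookup \<beta> k'"
      by transfer (auto simp: less_fun_def)
    have "k \<in> keys \<beta>" using k(1) by (simp add: in_keys_iff)
    then have "k < N" using N by auto
    then have "[0..<N] = [0..<k] @ k # [Suc k..<N]"
      by (metis le_add_diff_inverse less_imp_le_nat upt_add_eq_append upt_conv_Cons zero_le add_0)
    then have "?f \<gamma> = map (lookup \<gamma>) [0..<k] @ lookup \<gamma> k # map (lookup \<gamma>) [Suc k..<N]" for \<gamma>
      by simp
    moreover have "map (lookup \<alpha>) [0..<k] = map (lookup \<beta>) [0..<k]"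
      using k(2) by simp
    moreover have "length (?f \<gamma>) = N" for \<gamma> by simp
    ultimately show "(\<alpha>, \<beta>) \<in> inv_image (lexn less_than N) ?f"
      using k(1) unfolding lexn_conv inv_image_def mem_Collect_eq case_prod_conv less_than_iff
      by metis
  qed
qed

text \<open>By \<open>cancel_mem\<close> every difference of two elements of \<open>S\<close> that
  has nonnegative entries lies in \<open>S\<close>, so \<open>S\<close> is cut out of the exponents
  by the group that it generates. \<open>finite_support\<close> lets the division below
  terminate.\<close>

locale saturated_monoid =
  fixes S :: "(nat \<Rightarrow>\<^sub>0 nat) set" and N :: nat
  assumes zero_mem: "0 \<in> S"
    and add_mem: "\<alpha> \<in> S \<Longrightarrow> \<beta> \<in> S \<Longrightarrow> \<alpha> + \<beta> \<in> S"
    and cancel_mem: "\<alpha> + \<beta> \<in> S \<Longrightarrow> \<alpha> \<in> S \<Longrightarrow> \<beta> \<in> S"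
    and finite_support: "\<alpha> \<in> S \<Longrightarrow> keys \<alpha> \<subseteq> {..<N}"
begin

text \<open>Membership in the monoid algebra of \<open>S\<close>.\<close>

definition supp_in :: "((nat \<Rightarrow>\<^sub>0 nat) \<Rightarrow>\<^sub>0 'a::zero) \<Rightarrow> bool" where
  "supp_in p \<longleftrightarrow> keys p \<subseteq> S"

lemma supp_in_0: "supp_in 0" by (simp add: supp_in_def)

lemma supp_in_single: "\<alpha> \<in> S \<Longrightarrow> supp_in (Poly_Mapping.single \<alpha> c)"
  by (simp add: supp_in_def)

lemma supp_in_1: "supp_in (1 :: (nat \<Rightarrow>\<^sub>0 nat) \<Rightarrow>\<^sub>0 'a::comm_ring_1)"
  by (simp add: supp_in_def zero_mem)

lemma supp_in_add: "supp_in p \<Longrightarrow> supp_in q \<Longrightarrow> supp_in (p + q)"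
  for p q :: "(nat \<Rightarrow>\<^sub>0 nat) \<Rightarrow>\<^sub>0 'a::comm_ring_1"
  unfolding supp_in_def using keys_add by fastforce

lemma supp_in_uminus: "supp_in p \<Longrightarrow> supp_in (- p)"
  for p :: "(nat \<Rightarrow>\<^sub>0 nat) \<Rightarrow>\<^sub>0 'a::comm_ring_1"
  unfolding supp_in_def by (auto simp: in_keys_iff subset_iff)

lemma supp_in_mult: "supp_in p \<Longrightarrow> supp_in q \<Longrightarrow> supp_in (p * q)"
  for p q :: "(nat \<Rightarrow>\<^sub>0 nat) \<Rightarrow>\<^sub>0 'a::comm_ring_1"
  unfolding supp_in_def using keys_mult [of p q] add_mem by blast

lemma supp_in_power: "supp_in p \<Longrightarrow> supp_in (p ^ k)"
  for p :: "(nat \<Rightarrow>\<^sub>0 nat) \<Rightarrow>\<^sub>0 'a::comm_ring_1"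
  by (induction k) (simp_all add: supp_in_1 supp_in_mult)

lemma supp_in_sum: "(\<And>i. i \<in> A \<Longrightarrow> supp_in (p i)) \<Longrightarrow> supp_in (\<Sum>i\<in>A. p i)"
  for p :: "'b \<Rightarrow> (nat \<Rightarrow>\<^sub>0 nat) \<Rightarrow>\<^sub>0 'a::comm_ring_1"
  by (induction A rule: infinite_finite_induct) (simp_all add: supp_in_0 supp_in_add)

lemma supp_in_prod:
  "(\<And>i. i \<in> A \<Longrightarrow> supp_in (p i)) \<Longrightarrow> supp_in (\<Prod>i\<in>A. p i)"
  for p :: "'b \<Rightarrow> (nat \<Rightarrow>\<^sub>0 nat) \<Rightarrow>\<^sub>0 'a::comm_ring_1"
  by (induction A rule: infinite_finite_induct) (simp_all add: supp_in_1 supp_in_mult)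

lemma supp_in_of_nat: "supp_in (of_nat k :: (nat \<Rightarrow>\<^sub>0 nat) \<Rightarrow>\<^sub>0 'a::comm_ring_1)"
  by (induction k) (simp_all add: supp_in_0 supp_in_1 supp_in_add)

lemmas supp_in_intros = supp_in_0 supp_in_1 supp_in_add supp_in_uminus supp_in_mult
  supp_in_power supp_in_sum supp_in_of_nat supp_in_single

text \<open>If \<open>(f / g) ^ k\<close> has the bounded denominator \<open>D\<close> for all \<open>k\<close>, then the exponent of the
  leading monomial of \<open>f / g\<close> is nonnegative, so that this monomial can be split off.\<close>

lemma lead_mono_quotient:
  fixes f g D :: "(nat \<Rightarrow>\<^sub>0 nat) \<Rightarrow>\<^sub>0 'a::idom"
  assumes "supp_in f" "supp_in g" "f \<noteq> 0" "g \<noteq> 0" "D \<noteq> 0"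
    and quot: "\<And>k. \<exists>h. f ^ k * D = g ^ k * h"
  obtains \<alpha> where "\<alpha> \<in> S" "lead_mono f = lead_mono g + \<alpha>"
proof -
  have le: "lookup (lead_mono g) i \<le> lookup (lead_mono f) i" for i
  proof (rule ccontr)
    assume less: "\<not> ?thesis"
    \<comment> \<open>Comparing exponents of the variable \<open>i\<close> gives k f_i + D_i >= k
      g_i >= k f_i + k, which fails once k exceeds D_i.\<close>
    define k where "k = Suc (lookup (lead_mono D) i)"
    obtain h where h: "f ^ k * D = g ^ k * h" using quot by blast
    have "f ^ k * D \<noteq> 0" using assms by simp
    then have "h \<noteq> 0" using h by auto
    have "lookup (lead_mono (f ^ k * D)) i = lookup (lead_mono (g ^ k * h)) i"
      using h by simp
    then have *: "k * lookup (lead_mono f) i + lookup (lead_mono D) i =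
        k * lookup (lead_mono g) i + lookup (lead_mono h) i"
      using assms \<open>h \<noteq> 0\<close> by (simp add: lead_mono_mult lookup_add lead_mono_power)
    have "k * lookup (lead_mono f) i + k \<le> k * lookup (lead_mono g) i"
      using less mult_le_mono2 [of "Suc (lookup (lead_mono f) i)" "lookup (lead_mono g) i" k]
      by simp
    then show False using * by (simp add: k_def)
  qed
  \<comment> \<open>Subtraction of exponents truncates in general; by \<open>le\<close> it does not
    here.\<close>
  define \<alpha> where "\<alpha> = lead_mono f - lead_mono g"
  have \<alpha>: "lead_mono f = lead_mono g + \<alpha>"
    unfolding \<alpha>_def using le by (intro poly_mapping_eqI) (simp add: lookup_add minus_poly_mapping.rep_eq)
  moreover have "lead_mono f \<in> S" "lead_mono g \<in> S"
    using assms lead_mono_in_keys unfolding supp_in_def by auto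
  ultimately show thesis using that cancel_mem by metis
qed

lemma lead_mono_cancel:
  fixes p q :: "(nat \<Rightarrow>\<^sub>0 nat) \<Rightarrow>\<^sub>0 'a::comm_ring_1"
  assumes "lead_mono p = lead_mono q" "lookup p (lead_mono p) = lookup q (lead_mono q)"
    and "p - q \<noteq> 0" "p \<noteq> 0" "q \<noteq> 0"
  shows "lead_mono (p - q) < lead_mono p"
proof -
  have "lead_mono (p - q) \<in> keys (p - q)" using assms(3) by (rule lead_mono_in_keys)
  moreover have "keys (p - q) \<subseteq> keys p \<union> keys q"
    by (auto simp: in_keys_iff lookup_minus)
  ultimately have "lead_mono (p - q) \<le> lead_mono p"
    using assms(1) le_lead_mono [of _ p] le_lead_mono [of _ q] by auto
  moreover have "lead_mono (p - q) \<noteq> lead_mono p"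
    using \<open>lead_mono (p - q) \<in> keys (p - q)\<close> assms(1,2) by (auto simp: in_keys_iff lookup_minus)
  ultimately show ?thesis by simp
qed

text \<open>Division of \<open>f\<close> by \<open>g\<close> from the top:
  \<open>lead_mono_quotient\<close> puts the exponent of each quotient term into \<open>S\<close>,
  and the leading monomial decreases in a well-founded order. The common denominator of the powers
  has to survive the step from f / g to f / g - t, which is a matter of the binomial
  formula.\<close>

lemma almost_integral_imp_dvd:
  fixes f g D :: "(nat \<Rightarrow>\<^sub>0 nat) \<Rightarrow>\<^sub>0 'a::field"
  assumes "supp_in f" "supp_in g" "g \<noteq> 0" "D \<noteq> 0"
    and "\<And>k. \<exists>h. supp_in h \<and> f ^ k * D = g ^ k * h"
  shows "\<exists>r. supp_in r \<and> f = g * r"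
  using assms(1,5)
proof (induction "lead_mono f" arbitrary: f rule: wf_induct_rule [OF wf_mono_less [of N]])
  case (1 f)
  show ?case
  proof (cases "f = 0")
    case True
    then show ?thesis using supp_in_0 by auto
  next
    case False
    obtain \<alpha> where \<alpha>: "\<alpha> \<in> S" "lead_mono f = lead_mono g + \<alpha>"
      by (rule lead_mono_quotient [of f g D]) (use 1 assms False in blast)+
    define c where "c = lookup f (lead_mono f) / lookup g (lead_mono g)"
    define t where "t = Poly_Mapping.single \<alpha> c"
    have lc: "lookup f (lead_mono f) \<noteq> 0" "lookup g (lead_mono g) \<noteq> 0"
      using False assms(3) lead_mono_in_keys by (auto simp: in_keys_iff)
    then have "c \<noteq> 0" by (simp add: c_def)
    then have "keys t = {\<alpha>}" by (simp add: t_def)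
    then have "t \<noteq> 0" by auto
    have lead_t: "lead_mono t = \<alpha>" using \<open>keys t = {\<alpha>}\<close> by (simp add: lead_mono_def)
    have "supp_in t" using \<alpha> by (simp add: t_def supp_in_single)
    have "g * t \<noteq> 0" using assms(3) \<open>t \<noteq> 0\<close> by simp
    have lead_gt: "lead_mono (g * t) = lead_mono f"
      using assms(3) \<open>t \<noteq> 0\<close> \<alpha> lead_t by (simp add: lead_mono_mult)
    have lookup_gt: "lookup (g * t) (lead_mono f) = lookup f (lead_mono f)"
      using lookup_mult_lead_mono [OF assms(3) \<open>t \<noteq> 0\<close>] lc \<alpha> lead_t
      by (simp add: t_def c_def)
    define f' where "f' = f - g * t"
    have supp: "supp_in f'"
      using supp_in_add [OF 1(2) supp_in_uminus [OF supp_in_mult [OF assms(2) \<open>supp_in t\<close>]]]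
      by (simp add: f'_def)
    have ex: "\<exists>h. supp_in h \<and> f' ^ k * D = g ^ k * h" for k
    proof -
      obtain H where H: "\<And>j. supp_in (H j)" "\<And>j. f ^ j * D = g ^ j * H j"
        using 1(3) by metis
      \<comment> \<open>In the binomial expansion \<open>f ^ j * D\<close> supplies
        \<open>g ^ j\<close>, and the power of \<open>g * t\<close> supplies the missing
        \<open>g ^ (k - j)\<close>; the cofactors add up to \<open>?h\<close>.\<close>
      let ?h = "\<Sum>j\<le>k. of_nat (k choose j) * H j * (- t) ^ (k - j)"
      have "f' ^ k * D = (\<Sum>j\<le>k. of_nat (k choose j) * f ^ j * (- (g * t)) ^ (k - j)) * D"
        unfolding f'_def using binomial_ring [of f "- (g * t)" k] by simp
      also have "\<dots> = (\<Sum>j\<le>k. of_nat (k choose j) * (f ^ j * D) * (- (g * t)) ^ (k - j))"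
        unfolding sum_distrib_right by (intro sum.cong refl) (simp only: ac_simps)
      also have "\<dots> = (\<Sum>j\<le>k. g ^ k * (of_nat (k choose j) * H j * (- t) ^ (k - j)))"
      proof (intro sum.cong refl)
        fix j assume "j \<in> {..k}"
        then have "g ^ k = g ^ j * g ^ (k - j)" by (simp flip: power_add)
        moreover have "(- (g * t)) ^ (k - j) = g ^ (k - j) * (- t) ^ (k - j)"
          by (simp flip: power_mult_distrib)
        ultimately show "of_nat (k choose j) * (f ^ j * D) * (- (g * t)) ^ (k - j) =
            g ^ k * (of_nat (k choose j) * H j * (- t) ^ (k - j))"
          unfolding H(2) by (simp only: ac_simps)
      qed
      also have "\<dots> = g ^ k * ?h" by (simp add: sum_distrib_left)
      finally show ?thesis
        using H(1) \<open>supp_in t\<close> by (intro exI [of _ ?h]) (auto intro!: supp_in_intros)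
    qed
    show ?thesis
    proof (cases "f' = 0")
      case True
      then show ?thesis using \<open>supp_in t\<close> by (auto simp: f'_def)
    next
      case f': False
      have "lead_mono f' < lead_mono f"
        unfolding f'_def
        using lead_mono_cancel [of f "g * t"] lead_gt lookup_gt f' False \<open>g * t \<noteq> 0\<close>
        by (simp add: f'_def)
      moreover have "lead_mono f' \<in> S" "lead_mono f \<in> S"
        using supp 1(2) f' False lead_mono_in_keys unfolding supp_in_def by auto
      ultimately obtain r where r: "supp_in r" "f' = g * r"
        using 1(1) [of f'] supp ex finite_support by auto
      then have "f = g * (r + t)" by (simp add: f'_def algebra_simps)
      then show ?thesis using r \<open>supp_in t\<close> supp_in_add by blast
    qed
  qed
qed

text \<open>The assumption \<open>eq\<close> is a monic equation for f / g multiplied by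
  \<open>g ^ m\<close>. It expresses \<open>f ^ k\<close> with m \<le> k through lower powers, so
  that \<open>g ^ (m - 1)\<close> is a denominator of all powers of f / g.\<close>

lemma integral_imp_dvd:
  fixes f g :: "(nat \<Rightarrow>\<^sub>0 nat) \<Rightarrow>\<^sub>0 'a::field"
  assumes supp: "supp_in f" "supp_in g" "\<And>i. i < m \<Longrightarrow> supp_in (b i)"
    and "g \<noteq> 0" "0 < m"
    and eq: "f ^ m + (\<Sum>i<m. b i * f ^ i * g ^ (m - i)) = 0"
  shows "\<exists>r. supp_in r \<and> f = g * r"
proof (rule almost_integral_imp_dvd [OF supp(1,2) \<open>g \<noteq> 0\<close>])
  show "g ^ (m - 1) \<noteq> 0" using \<open>g \<noteq> 0\<close> by simp
  fix k
  show "\<exists>h. supp_in h \<and> f ^ k * g ^ (m - 1) = g ^ k * h"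
  proof (induction k rule: less_induct)
    case (less k)
    show ?case
    proof (cases "k < m")
      case True
      then have "g ^ (m - 1) = g ^ k * g ^ (m - 1 - k)" by (simp flip: power_add)
      then have "f ^ k * g ^ (m - 1) = g ^ k * (f ^ k * g ^ (m - 1 - k))" by simp
      then show ?thesis
        using supp_in_mult [OF supp_in_power [OF supp(1)] supp_in_power [OF supp(2)]] by blast
    next
      case False
      then have fk: "f ^ k = f ^ (k - m) * f ^ m" by (simp flip: power_add)
      have fm: "f ^ m = - (\<Sum>i<m. b i * f ^ i * g ^ (m - i))"
        using eq by (simp only: eq_neg_iff_add_eq_0)
      obtain H where H: "\<And>j. j < k \<Longrightarrow> supp_in (H j)"
          "\<And>j. j < k \<Longrightarrow> f ^ j * g ^ (m - 1) = g ^ j * H j"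
        using less by metis
      let ?h = "\<Sum>i<m. - b i * H (k - m + i)"
      have "f ^ k * g ^ (m - 1) = f ^ (k - m) * g ^ (m - 1) * - (\<Sum>i<m. b i * f ^ i * g ^ (m - i))"
        unfolding fk fm by (simp only: ac_simps)
      also have "\<dots> = (\<Sum>i<m. f ^ (k - m) * g ^ (m - 1) * - (b i * f ^ i * g ^ (m - i)))"
        unfolding sum_negf [symmetric] sum_distrib_left ..
      also have "\<dots> = (\<Sum>i<m. g ^ k * (- b i * H (k - m + i)))"
      proof (intro sum.cong refl)
        fix i assume "i \<in> {..<m}"
        then have "k - m + i < k" using False by simp
        have gk: "g ^ k = g ^ (k - m + i) * g ^ (m - i)"
          using \<open>i \<in> {..<m}\<close> False by (simp flip: power_add)
        have "f ^ (k - m) * g ^ (m - 1) * - (b i * f ^ i * g ^ (m - i)) =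
            - b i * (f ^ (k - m + i) * g ^ (m - 1)) * g ^ (m - i)"
          by (simp add: power_add ac_simps)
        also have "\<dots> = g ^ k * (- b i * H (k - m + i))"
          unfolding H(2) [OF \<open>k - m + i < k\<close>] gk by (simp add: ac_simps)
        finally show "f ^ (k - m) * g ^ (m - 1) * - (b i * f ^ i * g ^ (m - i)) =
            g ^ k * (- b i * H (k - m + i))" .
      qed
      also have "\<dots> = g ^ k * ?h" by (simp only: sum_distrib_left)
      finally show ?thesis
        using H(1) supp(3) False
        by (intro exI [of _ ?h]) (auto intro!: supp_in_sum supp_in_mult supp_in_uminus)
    qed
  qed
qed

end

section \<open>Cosets of the parabolic subgroup\<close>

lemma carrier_SL: "g \<in> carrier (SL n) \<longleftrightarrow> g \<in> carrier_mat n n \<and> det g = 1"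
  by (simp add: SL_def)

lemma mult_SL [simp]: "g \<otimes>\<^bsub>SL n\<^esub> h = g * h"
  by (simp add: SL_def)

lemma one_SL [simp]: "\<one>\<^bsub>SL n\<^esub> = 1\<^sub>m n"
  by (simp add: SL_def)

lemma SL_dim:
  "g \<in> carrier (SL n) \<Longrightarrow> g \<in> carrier_mat n n"
  "g \<in> carrier (SL n) \<Longrightarrow> dim_row g = n"
  "g \<in> carrier (SL n) \<Longrightarrow> dim_col g = n"
  by (auto simp: carrier_SL)

lemma SL_mult_closed [intro]: "g \<in> carrier (SL n) \<Longrightarrow> h \<in> carrier (SL n) \<Longrightarrow> g * h \<in> carrier (SL n)"
  using det_mult [of g n h] mult_carrier_mat [of g n n h n] by (simp add: carrier_SL)

lemma SL_inverse:
  assumes "g \<in> carrier (SL n)"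
  obtains q where "q \<in> carrier (SL n)" "q * g = 1\<^sub>m n" "g * q = 1\<^sub>m n"
proof -
  have g: "g \<in> carrier_mat n n" "det g = 1" using assms by (auto simp: carrier_SL)
  have q: "adj_mat g \<in> carrier_mat n n" "g * adj_mat g = 1\<^sub>m n" "adj_mat g * g = 1\<^sub>m n"
    using adj_mat [OF g(1)] g(2) by auto
  have "det (adj_mat g) * det g = 1"
    using det_mult [OF q(1) g(1)] q(3) by simp
  then have "adj_mat g \<in> carrier (SL n)" using q(1) g(2) by (simp add: carrier_SL)
  with q show thesis using that by blast
qed

lemma group_SL: "group (SL n)"
proof (rule groupI)
  fix x assume "x \<in> carrier (SL n)"
  then show "\<exists>y\<in>carrier (SL n). y \<otimes>\<^bsub>SL n\<^esub> x = \<one>\<^bsub>SL n\<^esub>"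
    by (metis SL_inverse mult_SL one_SL)
next
  fix x y z assume "x \<in> carrier (SL n)" "y \<in> carrier (SL n)" "z \<in> carrier (SL n)"
  then show "x \<otimes>\<^bsub>SL n\<^esub> y \<otimes>\<^bsub>SL n\<^esub> z = x \<otimes>\<^bsub>SL n\<^esub> (y \<otimes>\<^bsub>SL n\<^esub> z)"
    using assoc_mult_mat [of x n n y n z n] by (simp add: carrier_SL)
next
  fix x assume "x \<in> carrier (SL n)"
  then show "\<one>\<^bsub>SL n\<^esub> \<otimes>\<^bsub>SL n\<^esub> x = x"
    using left_mult_one_mat [of x n n] by (simp add: carrier_SL)
next
  fix x y assume "x \<in> carrier (SL n)" "y \<in> carrier (SL n)"
  then show "x \<otimes>\<^bsub>SL n\<^esub> y \<in> carrier (SL n)" by auto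
qed (auto simp: carrier_SL)

declare index_mult_mat(1) [simp del]

lemma index_mult_sum:
  assumes "A \<in> carrier_mat nr n" "B \<in> carrier_mat n nc" "i < nr" "j < nc"
  shows "(A * B) $$ (i, j) = (\<Sum>k<n. A $$ (i, k) * B $$ (k, j))"
  using assms by (auto simp: index_mult_mat(1) scalar_prod_def atLeast0LessThan intro!: sum.cong)

text \<open>For increasing \<open>r\<close> the determinants of these blocks are the Plucker
  coordinates; \<open>r = id\<close> gives the upper left block.\<close>

definition row_block :: "nat \<Rightarrow> (nat \<Rightarrow> nat) \<Rightarrow> 'a mat \<Rightarrow> 'a mat" where
  "row_block d r g = mat d d (\<lambda>(i, j). g $$ (r i, j))"

lemma row_block_carrier [simp]: "row_block d r g \<in> carrier_mat d d"
  by (simp add: row_block_def)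

lemma row_block_index [simp]: "i < d \<Longrightarrow> j < d \<Longrightarrow> row_block d r g $$ (i, j) = g $$ (r i, j)"
  by (simp add: row_block_def)

lemma row_block_dim [simp]: "dim_row (row_block d r g) = d" "dim_col (row_block d r g) = d"
  by (simp_all add: row_block_def)

text \<open>The lower left block of \<open>p\<close> is zero, so the first \<open>d\<close> columns
  of \<open>g * p\<close> only involve the first \<open>d\<close> columns of
  \<open>g\<close>.\<close>

lemma row_block_mult:
  fixes g p :: "complex mat"
  assumes "g \<in> carrier_mat n n" "p \<in> carrier_mat n n" "d \<le> n" "\<And>i. i < d \<Longrightarrow> r i < n"
    and "\<And>i j. d \<le> i \<Longrightarrow> i < n \<Longrightarrow> j < d \<Longrightarrow> p $$ (i, j) = 0"
  shows "row_block d r (g * p) = row_block d r g * row_block d id p"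
proof (rule eq_matI)
  fix i j assume "i < dim_row (row_block d r g * row_block d id p)"
    "j < dim_col (row_block d r g * row_block d id p)"
  then have ij: "i < d" "j < d" by auto
  have "row_block d r (g * p) $$ (i, j) = (\<Sum>k<n. g $$ (r i, k) * p $$ (k, j))"
    using ij assms index_mult_sum [OF assms(1,2), of "r i" j] by simp
  also have "\<dots> = (\<Sum>k<d. g $$ (r i, k) * p $$ (k, j))"
    using assms ij by (intro sum.mono_neutral_right) auto
  also have "\<dots> = (row_block d r g * row_block d id p) $$ (i, j)"
    using ij by (subst index_mult_sum [of _ d d _ d]) auto
  finally show "row_block d r (g * p) $$ (i, j) = (row_block d r g * row_block d id p) $$ (i, j)" .
qed auto

lemma ParabolicD:
  assumes "p \<in> Parabolic n d"
  shows "p \<in> carrier (SL n)" "d \<le> i \<Longrightarrow> i < n \<Longrightarrow> j < d \<Longrightarrow> p $$ (i, j) = 0"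
  using assms by (auto simp: Parabolic_def)

context
  fixes n d :: nat
  assumes dn: "d \<le> n"
begin

lemma row_block_one: "row_block d id (1\<^sub>m n) = 1\<^sub>m d"
  using dn by (intro eq_matI) auto

text \<open>A row of \<open>q\<close> below the block, restricted to the first \<open>d\<close>
  columns, is annihilated by the upper left block of \<open>p\<close>, which is invertible.\<close>

lemma Parabolic_inverse:
  assumes p: "p \<in> Parabolic n d" and q: "q \<in> carrier (SL n)" "q * p = 1\<^sub>m n"
  shows "q \<in> Parabolic n d" "row_block d id q * row_block d id p = 1\<^sub>m d"
    "det (row_block d id p) \<noteq> 0"
proof -
  note carr = SL_dim(1) [OF q(1)] SL_dim(1) [OF ParabolicD(1) [OF p]]
  have mult: "row_block d r (q * p) = row_block d r q * row_block d id p"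
    if "\<And>i. i < d \<Longrightarrow> r i < n" for r
    by (rule row_block_mult [OF carr dn]) (use that ParabolicD(2) [OF p] in auto)
  show qp: "row_block d id q * row_block d id p = 1\<^sub>m d"
    using mult [of id] dn unfolding q(2) row_block_one by simp
  have pq: "row_block d id p * row_block d id q = 1\<^sub>m d"
    by (rule mat_mult_left_right_inverse [OF _ _ qp]) auto
  show "det (row_block d id p) \<noteq> 0"
    using arg_cong [OF qp, of det] det_mult [of "row_block d id q" d "row_block d id p"] by auto
  have "q $$ (i, j) = 0" if ij: "d \<le> i" "i < n" "j < d" for i j
  proof -
    \<comment> \<open>The row \<open>i\<close> repeated \<open>d\<close> times, so that
      \<open>row_block_mult\<close> applies to a single row.\<close>
    let ?z = "row_block d (\<lambda>_. i) q"
    have "row_block d (\<lambda>_. i) (1\<^sub>m n :: complex mat) = 0\<^sub>m d d"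
      using ij dn by (intro eq_matI) auto
    then have "?z * row_block d id p = 0\<^sub>m d d"
      using mult [of "\<lambda>_. i"] ij unfolding q(2) by simp
    then have "?z * row_block d id p * row_block d id q = 0\<^sub>m d d" by simp
    then have "?z = 0\<^sub>m d d"
      using assoc_mult_mat [of ?z d d "row_block d id p" d "row_block d id q" d] pq by simp
    then have "?z $$ (j, j) = 0" using ij by simp
    then show ?thesis using ij by simp
  qed
  then show "q \<in> Parabolic n d" using q by (simp add: Parabolic_def)
qed

lemma det_Parabolic_block: "p \<in> Parabolic n d \<Longrightarrow> det (row_block d id p) \<noteq> 0"
  using SL_inverse [OF ParabolicD(1)] Parabolic_inverse(3) by metis

lemma subgroup_Parabolic: "subgroup (Parabolic n d) (SL n)"
proof (rule group.subgroupI [OF group_SL])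
  show "Parabolic n d \<subseteq> carrier (SL n)" by (auto simp: Parabolic_def)
  have "1\<^sub>m n \<in> Parabolic n d" by (auto simp: Parabolic_def carrier_SL)
  then show "Parabolic n d \<noteq> {}" by auto
next
  fix a assume a: "a \<in> Parabolic n d"
  interpret group "SL n" by (rule group_SL)
  have "inv\<^bsub>SL n\<^esub> a \<in> carrier (SL n)" "inv\<^bsub>SL n\<^esub> a * a = 1\<^sub>m n"
    using ParabolicD(1) [OF a] l_inv [of a] by auto
  then show "inv\<^bsub>SL n\<^esub> a \<in> Parabolic n d" using Parabolic_inverse(1) [OF a] by blast
next
  fix a b assume a: "a \<in> Parabolic n d" and b: "b \<in> Parabolic n d"
  note carr = SL_dim(1) [OF ParabolicD(1) [OF a]] SL_dim(1) [OF ParabolicD(1) [OF b]]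
  have "(a * b) $$ (i, j) = 0" if "d \<le> i" "i < n" "j < d" for i j
    unfolding index_mult_sum [OF carr that(2) order_less_le_trans [OF that(3) dn]]
    using ParabolicD(2) [OF a that(1,2)] ParabolicD(2) [OF b] that
    by (intro sum.neutral ballI) (metis lessThan_iff mult_zero_left mult_zero_right not_le)
  then show "a \<otimes>\<^bsub>SL n\<^esub> b \<in> Parabolic n d"
    using a b by (auto simp: Parabolic_def)
qed

lemma proj_eq_iff:
  assumes "g \<in> carrier (SL n)" "h \<in> carrier (SL n)"
  shows "proj n d h = proj n d g \<longleftrightarrow> (\<exists>p\<in>Parabolic n d. h = g * p)"
proof -
  interpret group "SL n" by (rule group_SL)
  have "h \<in> h <#\<^bsub>SL n\<^esub> Parabolic n d"
    using lcos_self subgroup_Parabolic assms by blast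
  moreover have "h \<in> g <#\<^bsub>SL n\<^esub> Parabolic n d \<longleftrightarrow> (\<exists>p\<in>Parabolic n d. h = g * p)"
    by (auto simp: l_coset_def)
  ultimately show ?thesis
    unfolding proj_def using l_repr_independence [OF _ assms(1) subgroup_Parabolic] by metis
qed

lemma proj_mult_Parabolic:
  "g \<in> carrier (SL n) \<Longrightarrow> p \<in> Parabolic n d \<Longrightarrow> proj n d (g * p) = proj n d g"
  using proj_eq_iff ParabolicD(1) SL_mult_closed by metis

text \<open>A point of G/P is the span of the first \<open>d\<close> columns. Both spans have
  dimension \<open>d\<close>, so an inclusion, given by the coefficients \<open>A\<close>, is an
  equality.\<close>

lemma proj_eqI:
  assumes g: "g \<in> carrier (SL n)" and h: "h \<in> carrier (SL n)"
    and col: "\<And>i j. i < n \<Longrightarrow> j < d \<Longrightarrow> h $$ (i, j) = (\<Sum>k<d. g $$ (i, k) * A k j)"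
  shows "proj n d h = proj n d g"
proof -
  obtain q where q: "q \<in> carrier (SL n)" "q * g = 1\<^sub>m n" "g * q = 1\<^sub>m n"
    using SL_inverse [OF g] .
  note carr = SL_dim(1) [OF g] SL_dim(1) [OF h] SL_dim(1) [OF q(1)]
  have "(q * h) $$ (i, j) = 0" if "d \<le> i" "i < n" "j < d" for i j
  proof -
    have "(q * h) $$ (i, j) = (\<Sum>l<n. q $$ (i, l) * h $$ (l, j))"
      using index_mult_sum [OF carr(3,2) that(2), of j] that dn by simp
    also have "\<dots> = (\<Sum>l<n. \<Sum>k<d. q $$ (i, l) * g $$ (l, k) * A k j)"
      using that by (simp add: col sum_distrib_left mult.assoc)
    also have "\<dots> = (\<Sum>k<d. (\<Sum>l<n. q $$ (i, l) * g $$ (l, k)) * A k j)"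
      unfolding sum_distrib_right by (rule sum.swap)
    also have "\<dots> = (\<Sum>k<d. (q * g) $$ (i, k) * A k j)"
      using index_mult_sum [OF carr(3,1)] that dn by simp
    also have "\<dots> = 0"
      unfolding q(2) using that dn by (intro sum.neutral) auto
    finally show ?thesis .
  qed
  then have "q * h \<in> Parabolic n d" using q h by (auto simp: Parabolic_def)
  moreover have "h = g * (q * h)"
    using assoc_mult_mat [OF carr(1,3,2)] q(3) left_mult_one_mat [OF carr(2)] by simp
  ultimately show ?thesis using proj_eq_iff [OF g h] by blast
qed

lemma l_coset_proj:
  "t \<in> carrier (SL n) \<Longrightarrow> g \<in> carrier (SL n) \<Longrightarrow> t <#\<^bsub>SL n\<^esub> proj n d g = proj n d (t * g)"
  unfolding proj_def
  using group.lcos_m_assoc [OF group_SL, of "Parabolic n d" n t g] ParabolicD(1) by auto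

end

lemma GP_eq: "GP n d = proj n d ` carrier (SL n)"
  by (auto simp: GP_def LCOSETS_def proj_def)

section \<open>Polynomial functions and the Zariski topology\<close>

lemma poly_funs_uminus: "p \<in> poly_funs n \<Longrightarrow> (\<lambda>g. - p g) \<in> poly_funs n"
  using poly_funs.mult [OF poly_funs.const [of "-1"], of p] by simp

lemma poly_funs_diff:
  "p \<in> poly_funs n \<Longrightarrow> q \<in> poly_funs n \<Longrightarrow> (\<lambda>g. p g - q g) \<in> poly_funs n"
  using poly_funs.add [OF _ poly_funs_uminus, of p n q] by simp

lemma poly_funs_sum:
  "(\<And>i. i \<in> A \<Longrightarrow> p i \<in> poly_funs n) \<Longrightarrow> (\<lambda>g. \<Sum>i\<in>A. p i g) \<in> poly_funs n"
  by (induction A rule: infinite_finite_induct) (auto intro: poly_funs.intros)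

lemma poly_funs_prod:
  "(\<And>i. i \<in> A \<Longrightarrow> p i \<in> poly_funs n) \<Longrightarrow> (\<lambda>g. \<Prod>i\<in>A. p i g) \<in> poly_funs n"
  by (induction A rule: infinite_finite_induct) (auto intro: poly_funs.intros)

lemma poly_funs_power: "p \<in> poly_funs n \<Longrightarrow> (\<lambda>g. p g ^ k) \<in> poly_funs n"
  by (induction k) (auto intro: poly_funs.intros)

lemma poly_funs_det:
  assumes "\<And>i j. i < k \<Longrightarrow> j < k \<Longrightarrow> F i j \<in> poly_funs n"
  shows "(\<lambda>g. det (mat k k (\<lambda>(i, j). F i j g))) \<in> poly_funs n"
proof -
  have "(\<lambda>g. \<Sum>\<pi>\<in>{\<pi>. \<pi> permutes {0..<k}}. signof \<pi> * (\<Prod>i = 0..<k. F i (\<pi> i) g)) \<in> poly_funs n"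
    using assms
    by (intro poly_funs_sum poly_funs.mult poly_funs.const poly_funs_prod)
      (auto dest: permutes_in_image)
  moreover have "det (mat k k (\<lambda>(i, j). F i j g)) =
      (\<Sum>\<pi>\<in>{\<pi>. \<pi> permutes {0..<k}}. signof \<pi> * (\<Prod>i = 0..<k. F i (\<pi> i) g))" for g
  proof -
    have "mat k k (\<lambda>(i, j). F i j g) \<in> carrier_mat k k" by simp
    show ?thesis
      unfolding det_def' [OF \<open>mat k k (\<lambda>(i, j). F i j g) \<in> carrier_mat k k\<close>]
      by (intro sum.cong refl arg_cong2 [of _ _ _ _ "(*)"] prod.cong)
        (auto dest: permutes_in_image)
  qed
  ultimately show ?thesis by simp
qed

lemma poly_funs_minor:
  "d \<le> n \<Longrightarrow> (\<And>i. i < d \<Longrightarrow> r i < n) \<Longrightarrow> (\<lambda>g. det (row_block d r g)) \<in> poly_funs n"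
  unfolding row_block_def by (intro poly_funs_det poly_funs.entry) auto

text \<open>A left translation substitutes linear forms for the matrix entries.\<close>

lemma poly_funs_translate:
  assumes "p \<in> poly_funs n" "b \<in> carrier_mat n n"
  shows "\<exists>p'\<in>poly_funs n. \<forall>g\<in>carrier_mat n n. p' g = p (b * g)"
  using assms(1)
proof induction
  case (const c)
  show ?case by (rule bexI [OF _ poly_funs.const [of c]]) simp
next
  case (entry i j)
  have mem: "(\<lambda>g. \<Sum>k<n. b $$ (i, k) * g $$ (k, j)) \<in> poly_funs n"
    using entry by (auto intro!: poly_funs_sum poly_funs.intros)
  have "(\<Sum>k<n. b $$ (i, k) * g $$ (k, j)) = (b * g) $$ (i, j)"
    if "g \<in> carrier_mat n n" for g
    using index_mult_sum [OF assms(2) that] entry by simp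
  then show ?case by (intro bexI [OF _ mem]) simp
next
  case (add p q)
  then obtain p' q' where p': "p' \<in> poly_funs n" "\<forall>g\<in>carrier_mat n n. p' g = p (b * g)"
    and q': "q' \<in> poly_funs n" "\<forall>g\<in>carrier_mat n n. q' g = q (b * g)" by metis
  show ?case
    by (rule bexI [OF _ poly_funs.add [OF p'(1) q'(1)]]) (simp add: p' q')
next
  case (mult p q)
  then obtain p' q' where p': "p' \<in> poly_funs n" "\<forall>g\<in>carrier_mat n n. p' g = p (b * g)"
    and q': "q' \<in> poly_funs n" "\<forall>g\<in>carrier_mat n n. q' g = q (b * g)" by metis
  show ?case
    by (rule bexI [OF _ poly_funs.mult [OF p'(1) q'(1)]]) (simp add: p' q')
qed

section \<open>Polynomial curves\<close>

definition poly_path :: "nat \<Rightarrow> (complex \<Rightarrow> complex mat) \<Rightarrow> bool" where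
  "poly_path n \<gamma> \<longleftrightarrow> (\<forall>i<n. \<forall>j<n. \<exists>q. \<forall>s. \<gamma> s $$ (i, j) = poly q s)"

lemma poly_path_compose:
  assumes "f \<in> poly_funs n" "poly_path n \<gamma>"
  shows "\<exists>q. \<forall>s. f (\<gamma> s) = poly q s"
  using assms(1)
proof induction
  case (const c)
  show ?case by (rule exI [of _ "[:c:]"]) simp
next
  case (entry i j)
  then show ?case using assms(2) by (simp add: poly_path_def)
next
  case (add p q)
  then show ?case by (metis poly_add)
next
  case (mult p q)
  then show ?case by (metis poly_mult)
qed

lemma poly_path_mult:
  assumes "poly_path n \<gamma>" "poly_path n \<delta>"
    and "\<And>s. \<gamma> s \<in> carrier_mat n n" "\<And>s. \<delta> s \<in> carrier_mat n n"
  shows "poly_path n (\<lambda>s. \<gamma> s * \<delta> s)"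
  unfolding poly_path_def
proof (intro allI impI)
  fix i j assume ij: "i < n" "j < n"
  obtain p q where p: "\<And>i j s. i < n \<Longrightarrow> j < n \<Longrightarrow> \<gamma> s $$ (i, j) = poly (p i j) s"
    and q: "\<And>i j s. i < n \<Longrightarrow> j < n \<Longrightarrow> \<delta> s $$ (i, j) = poly (q i j) s"
    using assms(1,2) unfolding poly_path_def by metis
  have "(\<gamma> s * \<delta> s) $$ (i, j) = poly (\<Sum>k<n. p i k * q k j) s" for s
    using ij by (simp add: index_mult_sum [OF assms(3,4)] p q poly_sum)
  then show "\<exists>q. \<forall>s. (\<gamma> s * \<delta> s) $$ (i, j) = poly q s" by blast
qed

lemma poly_path_const: "poly_path n (\<lambda>_. g)"
  unfolding poly_path_def by (metis poly_pCons poly_0 mult_zero_right add.right_neutral)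

text \<open>A substitute for irreducibility: a product of two nonzero polynomials in
  \<open>s\<close> has finitely many roots, so some parameter avoids them and
  \<open>E\<close>.\<close>

lemma poly_path_generic:
  assumes "poly_path n \<gamma>" "f1 \<in> poly_funs n" "f2 \<in> poly_funs n"
    and "f1 (\<gamma> s1) \<noteq> 0" "f2 (\<gamma> s2) \<noteq> 0" "finite E"
  obtains s where "s \<notin> E" "f1 (\<gamma> s) \<noteq> 0" "f2 (\<gamma> s) \<noteq> 0"
proof -
  obtain q1 q2 where q: "\<And>s. f1 (\<gamma> s) = poly q1 s" "\<And>s. f2 (\<gamma> s) = poly q2 s"
    using poly_path_compose assms(1-3) by metis
  have "q1 * q2 \<noteq> 0" using assms(4,5) q by auto
  then have "finite ({s. poly (q1 * q2) s = 0} \<union> E)"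
    using poly_roots_finite assms(6) by blast
  then obtain s where "s \<notin> {s. poly (q1 * q2) s = 0} \<union> E"
    using ex_new_if_finite infinite_UNIV_char_0 by metis
  then show thesis using that q by auto
qed

section \<open>Open sets and regular functions on G/P\<close>

lemma topspace_GP: "topspace (GP_zariski n d) = GP n d"
proof -
  have "SL_open n (carrier (SL n))"
    unfolding SL_open_def by (intro exI [of _ "{\<lambda>_. 1}"]) (auto intro: poly_funs.intros)
  moreover have "{g \<in> carrier (SL n). proj n d g \<in> GP n d} = carrier (SL n)"
    by (auto simp: GP_eq)
  ultimately have "GP_open n d (GP n d)"
    by (simp add: GP_open_def openin_SL_zariski)
  moreover have "U \<subseteq> GP n d" if "GP_open n d U" for U
    using that by (simp add: GP_open_def)
  ultimately show ?thesis
    unfolding topspace_def openin_GP_zariski by auto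
qed

lemma GP_open_nhd:
  assumes "openin (GP_zariski n d) U" "g \<in> carrier (SL n)" "proj n d g \<in> U"
  obtains f where "f \<in> poly_funs n" "f g \<noteq> 0"
    "\<And>h. h \<in> carrier (SL n) \<Longrightarrow> f h \<noteq> 0 \<Longrightarrow> proj n d h \<in> U"
proof -
  have "SL_open n {g \<in> carrier (SL n). proj n d g \<in> U}"
    using assms(1) by (simp add: openin_GP_zariski GP_open_def openin_SL_zariski)
  then obtain S where S: "S \<subseteq> poly_funs n"
    "{g \<in> carrier (SL n). proj n d g \<in> U} = carrier (SL n) - {g. \<forall>f\<in>S. f g = 0}"
    unfolding SL_open_def by blast
  then obtain f where "f \<in> S" "f g \<noteq> 0" using assms(2,3) by blast
  then show thesis using that S by blast
qed

text \<open>Open sets of G/P are seen through their preimages in G. So \<open>f\<close> ranges over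
  all polynomial functions on G, tested at the one representative \<open>g\<close>, while the point
  of \<open>S\<close> may be represented by any \<open>h\<close>.\<close>

lemma closure_of_GPI:
  assumes "g \<in> carrier (SL n)"
    and "\<And>f. f \<in> poly_funs n \<Longrightarrow> f g \<noteq> 0 \<Longrightarrow> \<exists>h\<in>carrier (SL n). f h \<noteq> 0 \<and> proj n d h \<in> S"
  shows "proj n d g \<in> (GP_zariski n d) closure_of S"
  unfolding in_closure_of topspace_GP
proof (intro conjI allI impI)
  show "proj n d g \<in> GP n d" using assms(1) by (auto simp: GP_eq)
  fix U assume "proj n d g \<in> U \<and> openin (GP_zariski n d) U"
  then obtain f where "f \<in> poly_funs n" "f g \<noteq> 0"
    "\<And>h. h \<in> carrier (SL n) \<Longrightarrow> f h \<noteq> 0 \<Longrightarrow> proj n d h \<in> U"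
    using GP_open_nhd assms(1) by metis
  then show "\<exists>y. y \<in> S \<and> y \<in> U" using assms(2) by blast
qed

text \<open>Meant for \<open>f\<close> whose zero set is stable under P from the right;
  \<open>f\<close> itself may be scaled by P, as minors are.\<close>

definition GP_nonzero :: "nat \<Rightarrow> nat \<Rightarrow> (complex mat \<Rightarrow> complex) \<Rightarrow> complex mat set set" where
  "GP_nonzero n d f = {proj n d g | g. g \<in> carrier (SL n) \<and> f g \<noteq> 0}"

context
  fixes n d :: nat and f
  assumes dn: "d \<le> n"
    and inv: "\<And>g p. g \<in> carrier (SL n) \<Longrightarrow> p \<in> Parabolic n d \<Longrightarrow> f g \<noteq> 0 \<Longrightarrow> f (g * p) \<noteq> (0::complex)"
begin

lemma proj_in_GP_nonzero_iff:
  assumes "g \<in> carrier (SL n)"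
  shows "proj n d g \<in> GP_nonzero n d f \<longleftrightarrow> f g \<noteq> 0"
  using assms inv proj_eq_iff [OF dn] unfolding GP_nonzero_def mem_Collect_eq by metis

lemma openin_GP_nonzero:
  assumes "f \<in> poly_funs n"
  shows "openin (GP_zariski n d) (GP_nonzero n d f)"
proof -
  have "{g \<in> carrier (SL n). proj n d g \<in> GP_nonzero n d f} =
      carrier (SL n) - {g. \<forall>f\<in>{f}. f g = 0}"
    using proj_in_GP_nonzero_iff by auto
  then have "SL_open n {g \<in> carrier (SL n). proj n d g \<in> GP_nonzero n d f}"
    unfolding SL_open_def using assms by (intro exI [of _ "{f}"]) auto
  moreover have "GP_nonzero n d f \<subseteq> GP n d"
    by (auto simp: GP_nonzero_def GP_eq)
  ultimately show ?thesis
    by (simp add: openin_GP_zariski GP_open_def openin_SL_zariski)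
qed

end

text \<open>The single function \<open>e\<close> keeps \<open>h\<close> inside the neighbourhood
  where the fraction represents \<open>f\<close> and keeps \<open>q\<close> away from zero.\<close>

lemma regular_on_fraction:
  assumes "regular_on n d V f" "g \<in> carrier (SL n)" "proj n d g \<in> V"
  obtains p q e where "p \<in> poly_funs n" "q \<in> poly_funs n" "e \<in> poly_funs n" "e g \<noteq> 0"
    "\<And>h. h \<in> carrier (SL n) \<Longrightarrow> proj n d h \<in> V \<Longrightarrow> e h \<noteq> 0 \<Longrightarrow>
      q h \<noteq> 0 \<and> f (proj n d h) = p h / q h"
proof -
  obtain U F where U: "openin (GP_zariski n d) U" "proj n d g \<in> U" "GP_regular n d U F"
    "\<forall>y\<in>U \<inter> V. f y = F y"
    using assms(1,3) unfolding regular_on_def by blast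
  obtain p q where p: "p \<in> poly_funs n" and q: "q \<in> poly_funs n" "q g \<noteq> 0"
    and F: "\<forall>h\<in>carrier (SL n). proj n d h \<in> U \<and> q h \<noteq> 0 \<longrightarrow> F (proj n d h) = p h / q h"
    using U(3) assms(2) U(2) unfolding GP_regular_def by blast
  obtain e where e: "e \<in> poly_funs n" "e g \<noteq> 0"
    "\<And>h. h \<in> carrier (SL n) \<Longrightarrow> e h \<noteq> 0 \<Longrightarrow> proj n d h \<in> U"
    using GP_open_nhd [OF U(1) assms(2) U(2)] by blast
  show thesis
  proof (rule that [OF p q(1) poly_funs.mult [OF e(1) q(1)]])
    show "e g * q g \<noteq> 0" using e(2) q(2) by simp
    fix h assume h: "h \<in> carrier (SL n)" "proj n d h \<in> V" "e h * q h \<noteq> 0"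
    then have "proj n d h \<in> U" "q h \<noteq> 0" using e(3) by auto
    then show "q h \<noteq> 0 \<and> f (proj n d h) = p h / q h" using F U(4) h by auto
  qed
qed

section \<open>Hooks\<close>

text \<open>The case \<open>x = 0\<close> is that of the identity.\<close>

definition is_hook :: "nat \<Rightarrow> nat \<Rightarrow> nat \<Rightarrow> (nat \<Rightarrow> nat) \<Rightarrow> bool" where
  "is_hook d x y w \<longleftrightarrow> y \<le> d - 1 \<and> (x = 0 \<longrightarrow> y = 0) \<and>
     (\<forall>i\<in>{1..d}. w i = (if i < d - y then i else if i < d then i + 1 else d + x))"

context
  fixes n d w
  assumes w: "w \<in> min_coset_reps n d" and d: "1 \<le> d" "d \<le> n - 1"
begin

lemma w_permutes: "w permutes {1..n}"
  using w by (simp add: min_coset_reps_def)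

lemma w_range: "1 \<le> i \<Longrightarrow> i \<le> n \<Longrightarrow> 1 \<le> w i \<and> w i \<le> n"
  using permutes_in_image [OF w_permutes, of i] by simp

lemma w_increasing:
  assumes "1 \<le> i" "i \<le> j" "j \<le> d"
  shows "w i + (j - i) \<le> w j"
  using assms(2,3)
proof (induction j rule: dec_induct)
  case base
  show ?case by simp
next
  case (step j)
  have "w j < w (Suc j)"
    using w step.prems step.hyps assms(1) unfolding min_coset_reps_def
    by (auto elim!: strict_mono_onD)
  then show ?case using step by simp
qed

lemma w_ge:
  assumes "1 \<le> i" "i \<le> d"
  shows "i \<le> w i"
proof -
  have "1 \<le> w 1" using w_range [of 1] d by linarith
  moreover have "w 1 + (i - 1) \<le> w i" using w_increasing [of 1 i] assms by simp
  ultimately show ?thesis by linarith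
qed

text \<open>The second alternative says that the partition contains (2,2), since its second part is
  w(d - 1) - (d - 1). Otherwise w(d - 1) \<le> d, so that the values at 1, ..., d - 1 omit just one
  number of 1, ..., d; this gives the leg of the hook.\<close>

lemma hook_or_big: "(\<exists>x y. is_hook d x y w) \<or> 2 \<le> d \<and> d + 1 \<le> w (d - 1)"
proof (rule disjCI)
  assume small: "\<not> (2 \<le> d \<and> d + 1 \<le> w (d - 1))"
  \<comment> \<open>The first index that \<open>w\<close> moves; the alternative
    \<open>i = d\<close> makes it exist when there is none below \<open>d\<close>. The leg length is
    then \<open>d - L\<close>.\<close>
  define L where "L = (LEAST i. 1 \<le> i \<and> (i = d \<or> w i \<noteq> i))"
  have L: "1 \<le> L" "L = d \<or> w L \<noteq> L"
    using LeastI [of "\<lambda>i. 1 \<le> i \<and> (i = d \<or> w i \<noteq> i)" d] d by (auto simp: L_def)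
  have "L \<le> d" unfolding L_def using d by (intro Least_le) auto
  have below: "w i = i" if "1 \<le> i" "i < L" for i
    using not_less_Least [of i "\<lambda>i. 1 \<le> i \<and> (i = d \<or> w i \<noteq> i)"] that by (auto simp: L_def)
  have above: "i + 1 \<le> w i" if "L < d" "L \<le> i" "i \<le> d" for i
    using w_increasing [OF L(1) that(2,3)] w_ge [OF L(1) \<open>L \<le> d\<close>] L(2) that by auto
  have mid: "w i = i + 1" if "L \<le> i" "i < d" for i
  proof -
    have "i + 1 \<le> w i" using above that by simp
    moreover have "w i + (d - 1 - i) \<le> w (d - 1)" using w_increasing [of i "d - 1"] that L(1) by simp
    moreover have "w (d - 1) < d + 1" using small that L(1) by auto
    ultimately show ?thesis using that by linarith
  qed
  have last: "w d = d + (w d - d)" using w_ge [of d] d by simp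
  have zero: "d - L = 0" if "w d - d = 0"
    using that above [of d] by force
  have "is_hook d (w d - d) (d - L) w"
    unfolding is_hook_def
  proof (intro conjI impI ballI zero)
    show "d - L \<le> d - 1" using L(1) by simp
    fix i assume i: "i \<in> {1..d}"
    have "d - (d - L) = L" using \<open>L \<le> d\<close> by simp
    then show "w i = (if i < d - (d - L) then i else if i < d then i + 1 else d + (w d - d))"
      using below [of i] mid [of i] last i by (cases "i = d") simp_all
  qed
  then show "\<exists>x y. is_hook d x y w" by blast
qed

lemma hook_bound: "is_hook d x y w \<Longrightarrow> x \<le> n - d"
proof -
  assume "is_hook d x y w"
  then have "w d = d + x" using d by (auto simp: is_hook_def)
  then show ?thesis using w_range [of d] d by linarith
qed

lemma partition_of_hook:
  assumes "is_hook d x y w"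
  shows "partition_of d w = (if x = 0 then [] else x # replicate y 1)"
proof -
  let ?f = "\<lambda>i. w (d - i + 1) - (d - i + 1)"
  have y: "y \<le> d - 1" and x: "x = 0 \<longrightarrow> y = 0"
    using assms unfolding is_hook_def by blast+
  have f: "?f i = (if i = 1 then x else if i \<le> y + 1 then 1 else 0)" if "1 \<le> i" "i \<le> d" for i
  proof -
    have "d - i + 1 \<in> {1..d}" using that by auto
    then have "w (d - i + 1) = (if d - i + 1 < d - y then d - i + 1
        else if d - i + 1 < d then d - i + 1 + 1 else d + x)"
      using assms unfolding is_hook_def by blast
    then show ?thesis using that y by auto
  qed
  have "map ?f [1..<d + 1] = x # replicate y 1 @ replicate (d - 1 - y) 0"
  proof (rule nth_equalityI)
    show "length (map ?f [1..<d + 1]) = length (x # replicate y 1 @ replicate (d - 1 - y) 0)"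
      using y d by simp
    fix i assume "i < length (map ?f [1..<d + 1])"
    then have i: "i < d" by (simp del: upt_Suc)
    then have "map ?f [1..<d + 1] ! i = ?f (i + 1)" by (simp del: upt_Suc add: nth_map_upt)
    also have "\<dots> = (x # replicate y 1 @ replicate (d - 1 - y) 0) ! i"
    proof -
      have "?f (i + 1) = (if i + 1 = 1 then x else if i + 1 \<le> y + 1 then 1 else 0)"
        using f [of "i + 1"] i by simp
      then show ?thesis using i y by (cases i) (auto simp: nth_append)
    qed
    finally show "map ?f [1..<d + 1] ! i = (x # replicate y 1 @ replicate (d - 1 - y) 0) ! i" .
  qed
  moreover have "strip_while (\<lambda>k. k = 0) (xs @ replicate m 0) = strip_while (\<lambda>k. k = 0) xs"
    for xs :: "nat list" and m
    by (induction m) (simp_all add: replicate_append_same [symmetric] flip: append_assoc)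
  ultimately have "partition_of d w = strip_while (\<lambda>k. k = 0) (x # replicate y 1)"
    unfolding partition_of_def by (metis append_Cons)
  also have "\<dots> = (if x = 0 then [] else x # replicate y 1)"
    using x by (cases y) (auto simp: replicate_append_same [symmetric] simp flip: append_Cons)
  finally show ?thesis .
qed

text \<open>List index 1 carries the second part of the partition; being at least 2 it is not
  stripped, and a hook could only have 1 there.\<close>

lemma partition_of_big:
  assumes "2 \<le> d" "d + 1 \<le> w (d - 1)"
  shows "partition_of d w \<noteq> []" "\<not> hook_shaped (partition_of d w)"
proof -
  let ?xs = "map (\<lambda>i. w (d - i + 1) - (d - i + 1)) [1..<d + 1]"
  obtain zs where zs: "?xs = partition_of d w @ zs" "\<And>k. k \<in> set zs \<Longrightarrow> k = 0"
    using split_strip_while_append [of "\<lambda>k. k = 0" ?xs] unfolding partition_of_def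
    by (metis (no_types, lifting))
  have "?xs ! 1 = w (d - 1) - (d - 1)" using assms
    by (simp del: upt_Suc add: nth_map_upt Suc_diff_Suc numeral_2_eq_2)
  then have 1: "2 \<le> ?xs ! 1" using assms by simp
  have len: "1 < length ?xs" using assms by simp
  have long: "1 < length (partition_of d w)"
  proof (rule ccontr)
    assume "\<not> ?thesis"
    then have "?xs ! 1 \<in> set zs"
      using len unfolding zs(1) by (simp add: nth_append)
    then show False using zs(2) 1 by fastforce
  qed
  then show "partition_of d w \<noteq> []" by auto
  have "?xs ! 1 = partition_of d w ! 1" unfolding zs(1) using long by (simp add: nth_append)
  then show "\<not> hook_shaped (partition_of d w)"
    using 1 long by (auto simp: hook_shaped_def nth_Cons')
qed

lemma partition_iff_hook:
  "partition_of d w = [] \<or> hook_shaped (partition_of d w) \<and> in_rectangle d (n - d) (partition_of d w)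
    \<longleftrightarrow> (\<exists>x y. is_hook d x y w)" (is "?lhs \<longleftrightarrow> ?rhs")
proof
  assume ?lhs
  then show ?rhs using hook_or_big partition_of_big by blast
next
  assume ?rhs
  then obtain x y where xy: "is_hook d x y w" by blast
  have "y \<le> d - 1" using xy by (simp add: is_hook_def)
  moreover have "1 \<le> n - d" using d by linarith
  ultimately show ?lhs
    using partition_of_hook [OF xy] hook_bound [OF xy] d
    by (cases "x = 0") (auto simp: hook_shaped_def in_rectangle_def)
qed

end

text \<open>The values at the positions after \<open>d\<close> are the remaining ones in increasing
  order.\<close>

lemma min_coset_reps_eqI:
  assumes w: "w \<in> min_coset_reps n d" "w' \<in> min_coset_reps n d"
    and eq: "\<And>i. 1 \<le> i \<Longrightarrow> i \<le> d \<Longrightarrow> w i = w' i"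
  shows "w = w'"
proof
  fix i
  have perm: "w permutes {1..n}" "w' permutes {1..n}"
    using w by (auto simp: min_coset_reps_def)
  have img: "v ` {d+1..n} = {1..n} - v ` ({1..n} \<inter> {1..d})" if "v permutes {1..n}" for v
  proof -
    have "v ` ({1..n} - {1..n} \<inter> {1..d}) = v ` {1..n} - v ` ({1..n} \<inter> {1..d})"
      using permutes_inj [OF that] by (rule image_set_diff)
    moreover have "{1..n} - {1..n} \<inter> {1..d} = {d+1..n}" by auto
    ultimately show ?thesis using permutes_image [OF that] by simp
  qed
  have "map w [d+1..<n+1] = map w' [d+1..<n+1]"
  proof (rule sorted_distinct_set_unique)
    have sm: "sorted (map v [d+1..<n+1]) \<and> distinct (map v [d+1..<n+1])"
      if "v \<in> min_coset_reps n d" for v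
    proof -
      have "sorted_wrt (<) (map v [d+1..<n+1])"
        unfolding sorted_wrt_map
      proof (rule sorted_wrt_mono_rel [OF _ sorted_wrt_upt])
        fix i j assume "i \<in> set [d+1..<n+1]" "j \<in> set [d+1..<n+1]" "i < j"
        then show "v i < v j"
          using that strict_mono_onD [of "{d+1..n}" v i j] by (auto simp: min_coset_reps_def)
      qed
      then show ?thesis by (simp add: strict_sorted_iff del: upt_Suc)
    qed
    show "sorted (map w [d+1..<n+1])" "distinct (map w [d+1..<n+1])"
      "sorted (map w' [d+1..<n+1])" "distinct (map w' [d+1..<n+1])"
      using sm w by auto
    have "w ` {d+1..n} = w' ` {d+1..n}"
      unfolding img [OF perm(1)] img [OF perm(2)]
      by (intro arg_cong2 [of _ _ _ _ "(-)"] image_cong refl) (use eq in auto)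
    moreover have "set [d+1..<n+1] = {d+1..n}" by auto
    ultimately show "set (map w [d+1..<n+1]) = set (map w' [d+1..<n+1])"
      by (simp only: set_map)
  qed
  moreover have "set [d+1..<n+1] = {d+1..n}" by auto
  ultimately have "w i = w' i" if "i \<in> {d+1..n}"
    using that by (metis map_eq_conv)
  moreover have "w i = w' i" if "i \<notin> {1..n}"
    using that perm by (simp add: permutes_not_in)
  ultimately show "w i = w' i" using eq by force
qed

section \<open>Reduced words\<close>

lemma word_perm_Nil [simp]: "word_perm [] = id"
  by (simp add: word_perm_def)

lemma word_perm_Cons [simp]: "word_perm (i # is) = Transposition.transpose i (i + 1) \<circ> word_perm is"
  by (simp add: word_perm_def)

lemma word_perm_append: "word_perm (is @ js) = word_perm is \<circ> word_perm js"
  by (induction "is") (simp_all add: comp_assoc)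

lemma bij_word_perm: "bij (word_perm is)"
proof (induction "is")
  case (Cons i "is")
  then show ?case unfolding word_perm_Cons by (intro bij_comp) simp_all
qed (simp add: bij_id del: id_apply)

lemma word_perm_permutes: "set is \<subseteq> {1..n-1} \<Longrightarrow> word_perm is permutes {1..n}"
proof (induction "is")
  case (Cons i "is")
  then have "Transposition.transpose i (i + 1) permutes {1..n}"
    by (intro permutes_swap_id) auto
  then show ?case using Cons unfolding word_perm_Cons by (intro permutes_compose) simp_all
qed (simp add: permutes_id)

text \<open>A simple reflection applied on the left raises at most one of the first \<open>d\<close>
  values, the one equal to \<open>i\<close>, and only by 1. This bounds the length of any word from
  below without counting inversions.\<close>

lemma word_perm_sum_le: "(\<Sum>k=1..d. word_perm is k) \<le> (\<Sum>k=1..d. k) + length is"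
proof (induction "is")
  case (Cons i "is")
  let ?p = "word_perm is"
  have "(\<Sum>k=1..d. word_perm (i # is) k) \<le> (\<Sum>k=1..d. ?p k + (if ?p k = i then 1 else 0))"
    by (intro sum_mono) (auto simp: Transposition.transpose_def)
  also have "\<dots> = (\<Sum>k=1..d. ?p k) + card {k \<in> {1..d}. ?p k = i}"
    by (simp add: sum.distrib sum.If_cases Int_def conj_commute)
  also have "card {k \<in> {1..d}. ?p k = i} \<le> 1"
    using bij_is_inj [OF bij_word_perm [of "is"]]
    by (auto simp: card_le_Suc0_iff_eq inj_eq)
  finally show ?case using Cons by simp
qed simp

lemma word_perm_upt:
  assumes "a \<le> d + 1"
  shows "word_perm [a..<d+1] j =
    (if a \<le> j \<and> j \<le> d then j + 1 else if j = d + 1 then a else j)"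
  using assms
proof (induction a rule: inc_induct)
  case base
  show ?case by simp
next
  case (step a)
  then have "[a..<d+1] = a # [Suc a..<d+1]" by (simp add: upt_conv_Cons del: upt_Suc)
  then show ?case using step by (auto simp: Transposition.transpose_def simp del: upt_Suc)
qed

lemma word_perm_rev_upt:
  assumes "b \<le> c"
  shows "word_perm (rev [b..<c]) j =
    (if j = b then c else if b < j \<and> j \<le> c then j - 1 else j)"
  using assms
proof (induction c rule: dec_induct)
  case base
  show ?case by simp
next
  case (step c)
  then show ?case by (auto simp: Transposition.transpose_def)
qed

text \<open>Both factors are cycles that share only the point d + 1: the right one sends
  \<open>d\<close> there and the left one carries it on to d + x.\<close>

lemma word_perm_hook:
  assumes "1 \<le> x" "y \<le> d - 1" "1 \<le> d"
  shows "word_perm (rev [d+1..<d+x] @ [d-y..<d+1]) j =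
    (if d - y \<le> j \<and> j < d then j + 1 else if j = d then d + x else if j = d + 1 then d - y
     else if d + 1 < j \<and> j \<le> d + x then j - 1 else j)"
proof -
  have "d - y \<le> d + 1" "d + 1 \<le> d + x" using assms by auto
  then show ?thesis
    unfolding word_perm_append comp_apply word_perm_upt [OF \<open>d - y \<le> d + 1\<close>]
      word_perm_rev_upt [OF \<open>d + 1 \<le> d + x\<close>]
    using assms by auto
qed

lemma reduced_iff_hook:
  assumes w: "w \<in> min_coset_reps n d" and d: "1 \<le> d" "d \<le> n - 1"
  shows "w = id \<or>
       (\<exists>x y. 1 \<le> x \<and> x \<le> n - d \<and> y \<le> d - 1 \<and>
          reduced_decomposition n w (rev [d+1..<d+x] @ [d-y..<d+1]))
    \<longleftrightarrow> (\<exists>x y. is_hook d x y w)" (is "?lhs \<longleftrightarrow> ?rhs")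
proof
  assume ?lhs
  then show ?rhs
  proof
    assume "w = id"
    then have "is_hook d 0 0 w" by (auto simp: is_hook_def)
    then show ?rhs by blast
  next
    assume "\<exists>x y. 1 \<le> x \<and> x \<le> n - d \<and> y \<le> d - 1 \<and>
          reduced_decomposition n w (rev [d+1..<d+x] @ [d-y..<d+1])"
    then obtain x y where xy: "1 \<le> x" "y \<le> d - 1"
      "w = word_perm (rev [d+1..<d+x] @ [d-y..<d+1])"
      unfolding reduced_decomposition_def by blast
    then have "is_hook d x y w"
      unfolding is_hook_def xy(3) word_perm_hook [OF xy(1,2) d(1)] by auto
    then show ?rhs by blast
  qed
next
  assume ?rhs
  then obtain x y where xy: "is_hook d x y w" by blast
  show ?lhs
  proof (cases "x = 0")
    case True
    have "id \<in> min_coset_reps n d"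
      by (auto simp: min_coset_reps_def permutes_id strict_mono_on_def)
    then have "w = id"
      using min_coset_reps_eqI [OF w] xy True d unfolding is_hook_def by auto
    then show ?lhs ..
  next
    case False
    then have x: "1 \<le> x" by simp
    have y: "y \<le> d - 1" using xy by (simp add: is_hook_def)
    have xn: "x \<le> n - d" using hook_bound [OF w d xy] .
    let ?is = "rev [d+1..<d+x] @ [d-y..<d+1]"
    have set: "set ?is \<subseteq> {1..n-1}" using x y xn d by auto
    have "word_perm ?is \<in> min_coset_reps n d"
      unfolding min_coset_reps_def mem_Collect_eq
    proof (intro conjI word_perm_permutes [OF set])
      show "strict_mono_on {1..d} (word_perm ?is)" "strict_mono_on {d+1..n} (word_perm ?is)"
        unfolding strict_mono_on_def word_perm_hook [OF x y d(1)] using x y by auto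
    qed
    moreover have wi: "word_perm ?is i = w i" if "1 \<le> i" "i \<le> d" for i
      using xy that y unfolding is_hook_def word_perm_hook [OF x y d(1)] by auto
    ultimately have eq: "word_perm ?is = w"
      by (rule min_coset_reps_eqI [OF _ w])
    \<comment> \<open>The first \<open>d\<close> values of a hook exceed 1, ..., d by x + y in
      total, which is the length (x - 1) + (y + 1) of the word.\<close>
    have "length ?is \<le> length js" if "word_perm js = w" for js
    proof -
      have "(\<Sum>k=1..d. w k) = (\<Sum>k=1..d. k + (if k = d then x else if d - y \<le> k then 1 else 0))"
        using xy by (intro sum.cong) (auto simp: is_hook_def)
      also have "\<dots> = (\<Sum>k=1..d. k) + (x + y)"
      proof -
        have "(\<Sum>k=1..d. if k = d then x else if d - y \<le> k then 1 else 0) =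
            x + (\<Sum>k\<in>{1..d}-{d}. if d - y \<le> k then 1 else 0)"
          using d by (subst sum.remove [of _ d]) auto
        also have "(\<Sum>k\<in>{1..d}-{d}. if d - y \<le> k then 1 else 0::nat) = card {d-y..<d}"
        proof -
          have "{k \<in> {1..d}-{d}. d - y \<le> k} = {d-y..<d}" using y d by auto
          then show ?thesis by (subst sum.inter_filter [symmetric]) auto
        qed
        finally show ?thesis using y by (simp add: sum.distrib)
      qed
      finally have "x + y \<le> length js"
        using word_perm_sum_le [of js d] that by simp
      then show ?thesis using x y by simp
    qed
    then have "reduced_decomposition n w ?is"
      using set eq by (auto simp: reduced_decomposition_def)
    then show ?lhs using x xn y by blast
  qed
qed

section \<open>Schubert cells\<close>

text \<open>The row, counted from 0, of the nonzero entry in column \<open>j\<close> of a matrix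
  representing \<open>w\<close>.\<close>

definition col_index :: "(nat \<Rightarrow> nat) \<Rightarrow> nat \<Rightarrow> nat" where
  "col_index w j = w (Suc j) - 1"

lemma Suc_col_index:
  assumes "w permutes {1..n}" "j < n"
  shows "Suc (col_index w j) = w (Suc j)" "col_index w j < n"
  using permutes_in_image [OF assms(1), of "Suc j"] assms(2) by (auto simp: col_index_def)

lemma col_index_eq_iff:
  assumes "w permutes {1..n}" "j < n" "k < n"
  shows "col_index w j = col_index w k \<longleftrightarrow> j = k"
  using Suc_col_index [OF assms(1)] assms permutes_inj [OF assms(1)] by (metis Suc_inject injD)

lemma col_index_permutes:
  assumes "w permutes {1..n}"
  shows "(\<lambda>j. if j < n then col_index w j else j) permutes {0..<n}" (is "?\<sigma> permutes _")
proof (rule bij_imp_permutes)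
  have inj: "inj_on ?\<sigma> {0..<n}"
    using col_index_eq_iff [OF assms] by (auto intro!: inj_onI)
  moreover have "?\<sigma> ` {0..<n} \<subseteq> {0..<n}"
    using Suc_col_index(2) [OF assms] by auto
  ultimately show "bij_betw ?\<sigma> {0..<n} {0..<n}"
    using endo_inj_surj [of "{0..<n}" ?\<sigma>] by (simp add: bij_betw_def)
qed auto

lemma weyl_coset_index:
  assumes "m \<in> weyl_coset n w" "w permutes {1..n}" "i < n" "j < n"
  shows "m $$ (i, j) \<noteq> 0 \<longleftrightarrow> i = col_index w j"
  using assms Suc_col_index [OF assms(2,4)] by (auto simp: weyl_coset_def)

lemma weyl_coset_SL: "m \<in> weyl_coset n w \<Longrightarrow> m \<in> carrier (SL n)"
  by (simp add: weyl_coset_def)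

lemma mult_weyl_coset_index:
  assumes "b \<in> carrier_mat n n" "m \<in> weyl_coset n w" "w permutes {1..n}" "i < n" "j < n"
  shows "(b * m) $$ (i, j) = b $$ (i, col_index w j) * m $$ (col_index w j, j)"
proof -
  have "(b * m) $$ (i, j) = (\<Sum>k<n. b $$ (i, k) * m $$ (k, j))"
    using index_mult_sum [OF assms(1) SL_dim(1) [OF weyl_coset_SL [OF assms(2)]] assms(4,5)] .
  also have "\<dots> = (\<Sum>k\<in>{col_index w j}. b $$ (i, k) * m $$ (k, j))"
    using weyl_coset_index [OF assms(2,3) _ assms(5)] Suc_col_index(2) [OF assms(3,5)]
    by (intro sum.mono_neutral_right) auto
  finally show ?thesis by simp
qed

text \<open>The sign of the permutation is absorbed into the last column, which does not matter
  modulo \<open>P\<close>.\<close>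

lemma weyl_coset_rep:
  assumes w: "w permutes {1..n}" and d: "d < n"
  obtains m where "m \<in> weyl_coset n w" "\<And>j. j < d \<Longrightarrow> m $$ (col_index w j, j) = 1"
proof -
  let ?\<sigma> = "\<lambda>j. if j < n then col_index w j else j"
  have perm: "?\<sigma> permutes {0..<n}" using w by (rule col_index_permutes)
  define c :: complex where "c = signof ?\<sigma>"
  have c: "c * c = 1" "c \<noteq> 0" by (auto simp: c_def sign_def)
  \<comment> \<open>The entry \<open>c\<close> sits in the row that carries the nonzero entry of the
    last column of \<open>m\<close>; together with the sign of the permutation it makes the
    determinant \<open>c * c = 1\<close>.\<close>
  let ?D = "mat n n (\<lambda>(k, i). if k = i then if k = col_index w (n - 1) then c else 1 else 0)"
  have "upper_triangular ?D" by auto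
  then have "det ?D = (\<Prod>k = 0..<n. if k = col_index w (n - 1) then c else 1)"
    by (subst det_upper_triangular [of _ n]) (auto simp: diag_mat_def prod.distinct_set_conv_list
        [symmetric] cong: map_cong)
  also have "\<dots> = c" using Suc_col_index(2) [OF w, of "n - 1"] d by simp
  finally have D: "det ?D = c" .
  define m where "m = transpose_mat (mat n n (\<lambda>(j, i). ?D $$ (?\<sigma> j, i)))"
  have "det m = c * det ?D"
    unfolding m_def c_def
    by (subst det_transpose [of _ n], simp, rule det_permute_rows [OF _ perm]) simp
  then have "m \<in> carrier (SL n)" using c D by (simp add: carrier_SL m_def)
  have m: "m $$ (i, j) = (if i = col_index w j then if j = n - 1 then c else 1 else 0)"
    if "i < n" "j < n" for i j
    using that Suc_col_index(2) [OF w] col_index_eq_iff [OF w] d by (auto simp: m_def)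
  have "m $$ (i, j) \<noteq> 0 \<longleftrightarrow> Suc i = w (Suc j)" if "i < n" "j < n" for i j
  proof -
    have "m $$ (i, j) \<noteq> 0 \<longleftrightarrow> i = col_index w j" using m [OF that] c(2) by simp
    then show ?thesis unfolding Suc_col_index(1) [OF w that(2), symmetric] by simp
  qed
  then have "m \<in> weyl_coset n w"
    unfolding weyl_coset_def using \<open>m \<in> carrier (SL n)\<close> by blast
  then show thesis
    by (rule that) (use d Suc_col_index(2) [OF w] in \<open>simp add: m\<close>)
qed

definition unipotent :: "nat \<Rightarrow> (nat \<Rightarrow> nat \<Rightarrow> complex) \<Rightarrow> complex mat" where
  "unipotent n \<beta> = mat n n (\<lambda>(i, j). if i = j then 1 else if i < j then \<beta> i j else 0)"

lemma unipotent_index [simp]: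
  "i < n \<Longrightarrow> j < n \<Longrightarrow> unipotent n \<beta> $$ (i, j) = (if i = j then 1 else if i < j then \<beta> i j else 0)"
  by (simp add: unipotent_def)

lemma unipotent_Borel: "unipotent n \<beta> \<in> Borel n"
proof -
  have ut: "upper_triangular (unipotent n \<beta>)" by (auto simp: unipotent_def)
  have "diag_mat (unipotent n \<beta>) = map (\<lambda>_. 1) [0..<n]"
    by (auto simp: diag_mat_def unipotent_def)
  then have "det (unipotent n \<beta>) = 1"
    using det_upper_triangular [OF ut, of n] by (simp add: unipotent_def prod_list_replicate map_replicate_const)
  then show ?thesis using ut by (simp add: Borel_def carrier_SL unipotent_def)
qed

lemma Borel_SL: "b \<in> Borel n \<Longrightarrow> b \<in> carrier (SL n)"
  by (simp add: Borel_def)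

abbreviation cell :: "nat \<Rightarrow> nat \<Rightarrow> (nat \<Rightarrow> nat) \<Rightarrow> complex mat set set" where
  "cell n d w \<equiv> {proj n d (b * m) | b m. b \<in> Borel n \<and> m \<in> weyl_coset n w}"

lemma cell_subset_Schubert: "cell n d w \<subseteq> Schubert n d w"
  unfolding Schubert_def
proof (rule closure_of_subset)
  show "cell n d w \<subseteq> topspace (GP_zariski n d)"
    unfolding topspace_GP GP_eq using Borel_SL weyl_coset_SL by blast
qed

lemma cell_Schubert:
  "b \<in> Borel n \<Longrightarrow> m \<in> weyl_coset n w \<Longrightarrow> proj n d (b * m) \<in> Schubert n d w"
  using cell_subset_Schubert by blast

lemma Schubert_subset_GP: "Schubert n d w \<subseteq> GP n d"
  unfolding Schubert_def topspace_GP [symmetric] by (rule closure_of_subset_topspace)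

section \<open>Schubert varieties without a dense torus orbit\<close>

lemma Torus_SL: "t \<in> Torus n \<Longrightarrow> t \<in> carrier (SL n)"
  by (simp add: Torus_def)

lemma Torus_mult_index:
  assumes "t \<in> Torus n" "g \<in> carrier_mat n n" "i < n" "j < n"
  shows "(t * g) $$ (i, j) = t $$ (i, i) * g $$ (i, j)"
proof -
  have t: "t \<in> carrier_mat n n" using assms(1) Torus_SL SL_dim(1) by blast
  have "(t * g) $$ (i, j) = (\<Sum>k<n. t $$ (i, k) * g $$ (k, j))"
    using index_mult_sum [OF t assms(2-4)] .
  also have "\<dots> = (\<Sum>k\<in>{i}. t $$ (i, k) * g $$ (k, j))"
    using assms(1,3) t by (intro sum.mono_neutral_right) (auto simp: Torus_def diagonal_mat_def)
  finally show ?thesis by simp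
qed

lemma minor_Torus_mult:
  assumes t: "t \<in> Torus n" and g: "g \<in> carrier_mat n n" and "d \<le> n" and r: "\<And>i. i < d \<Longrightarrow> r i < n"
  shows "det (row_block d r (t * g)) = (\<Prod>i<d. t $$ (r i, r i)) * det (row_block d r g)"
proof -
  let ?D = "mat d d (\<lambda>(i, j). if i = j then t $$ (r i, r i) else 0)"
  have "row_block d r (t * g) = ?D * row_block d r g"
  proof (rule eq_matI)
    fix i j assume "i < dim_row (?D * row_block d r g)" "j < dim_col (?D * row_block d r g)"
    then have ij: "i < d" "j < d" by auto
    have "(?D * row_block d r g) $$ (i, j) = (\<Sum>k<d. ?D $$ (i, k) * row_block d r g $$ (k, j))"
      using ij by (subst index_mult_sum [of _ d d _ d]) auto
    also have "\<dots> = (\<Sum>k<d. if k = i then t $$ (r i, r i) * g $$ (r i, j) else 0)"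
      using ij by (intro sum.cong) auto
    also have "\<dots> = (t * g) $$ (r i, j)"
      using ij Torus_mult_index [OF t g r] \<open>d \<le> n\<close> by simp
    finally show "row_block d r (t * g) $$ (i, j) = (?D * row_block d r g) $$ (i, j)"
      using ij by simp
  qed auto
  moreover have "det ?D = (\<Prod>i<d. t $$ (r i, r i))"
    by (subst det_upper_triangular [of _ d]) (auto simp: diag_mat_def atLeast0LessThan
        prod.distinct_set_conv_list [symmetric] cong: map_cong)
  ultimately show ?thesis
    using det_mult [of ?D d "row_block d r g"] by simp
qed

lemma minor_Parabolic_mult:
  assumes "g \<in> carrier (SL n)" "p \<in> Parabolic n d" "d \<le> n" "\<And>i. i < d \<Longrightarrow> r i < n"
  shows "det (row_block d r (g * p)) = det (row_block d r g) * det (row_block d id p)"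
proof -
  have "row_block d r (g * p) = row_block d r g * row_block d id p"
    using assms ParabolicD [OF assms(2)] SL_dim(1) by (intro row_block_mult [of _ n]) auto
  then show ?thesis using det_mult [of "row_block d r g" d "row_block d id p"] by simp
qed

text \<open>Transposed, this is the identity with one column replaced, to which Cramer's rule for a
  system with solution \<open>v\<close> applies.\<close>

lemma det_replace_row_one:
  assumes "c < d"
  shows "det (mat d d (\<lambda>(a, k). if a = c then v k else if a = k then 1 else 0)) = (v c :: complex)"
    (is "det ?A = _")
proof -
  have "transpose_mat ?A = replace_col (1\<^sub>m d) (1\<^sub>m d *\<^sub>v vec d v) c"
    by (auto simp: replace_col_def)
  then have "det (transpose_mat ?A) = v c"
    using cramer_lemma_mat [of "1\<^sub>m d" d "vec d v" c] assms by simp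
  then show ?thesis by (subst (asm) det_transpose [of _ d]) auto
qed

text \<open>Otherwise the nonvanishing locus of \<open>F\<close>, an open set of G/P, would contain
  the point and hence meet the orbit.\<close>

lemma vanish_on_orbit_closure:
  assumes g: "g \<in> carrier (SL n)" and dn: "d \<le> n" and F: "F \<in> poly_funs n"
    and inv: "\<And>g p. g \<in> carrier (SL n) \<Longrightarrow> p \<in> Parabolic n d \<Longrightarrow> F g \<noteq> 0 \<Longrightarrow> F (g * p) \<noteq> 0"
    and orbit: "\<And>t. t \<in> Torus n \<Longrightarrow> F (t * g) = 0"
    and h: "h \<in> carrier (SL n)" "proj n d h \<in> (GP_zariski n d) closure_of torus_orbit n (proj n d g)"
  shows "F h = 0"
proof (rule ccontr)
  assume "F h \<noteq> 0"
  then have "proj n d h \<in> GP_nonzero n d F"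
    using proj_in_GP_nonzero_iff [where f = F, OF dn inv h(1)] by blast
  then obtain y where y: "y \<in> torus_orbit n (proj n d g)" "y \<in> GP_nonzero n d F"
    using h(2) openin_GP_nonzero [where f = F, OF dn inv F] unfolding in_closure_of by blast
  then obtain t where t: "t \<in> Torus n" "y = proj n d (t * g)"
    using l_coset_proj [OF dn Torus_SL g] by (auto simp: torus_orbit_def)
  have "t * g \<in> carrier (SL n)" using t g Torus_SL by blast
  then have "F (t * g) \<noteq> 0" using proj_in_GP_nonzero_iff [where f = F, OF dn inv] y t(2) by blast
  then show False using orbit t by blast
qed

lemma obtain_two:
  assumes "2 \<le> card A"
  obtains a b where "a \<in> A" "b \<in> A" "a \<noteq> b"
proof -
  have "finite A" using assms card.infinite by fastforce
  then show thesis using assms that card_le_Suc0_iff_eq [of A] by (metis not_less_eq_eq numeral_2_eq_2)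
qed

text \<open>The cross ratio \<open>z\<^sub>1\<^sub>1 z\<^sub>2\<^sub>2 / (z\<^sub>1\<^sub>2 z\<^sub>2\<^sub>1)\<close> of four coordinates of the cell is
  invariant under \<open>T\<close> but not constant.\<close>

lemma big_not_toric:
  assumes w: "w \<in> min_coset_reps n d" and d: "d < n" "2 \<le> d" and big: "d + 1 \<le> w (d - 1)"
  shows "\<not> toric_variety n d (Schubert n d w)"
proof
  assume toric: "toric_variety n d (Schubert n d w)"
  have perm: "w permutes {1..n}" using w by (simp add: min_coset_reps_def)
  have dn: "d \<le> n" using d by simp
  obtain e where e: "d = Suc (Suc e)" using d(2) by (metis add_2_eq_Suc le_Suc_ex)
  let ?c = "col_index w"
  have c_less: "?c k < n" if "k < d" for k using Suc_col_index(2) [OF perm] that dn by simp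
  have c_eq: "?c j = ?c k \<longleftrightarrow> j = k" if "j < d" "k < d" for j k
    using col_index_eq_iff [OF perm] that dn by simp
  have c_mono: "?c j < ?c k" if "j < k" "k < d" for j k
  proof -
    have "w (Suc j) < w (Suc k)"
      using w that strict_mono_onD [of "{1..d}" w "Suc j" "Suc k"] by (auto simp: min_coset_reps_def)
    then show ?thesis using Suc_col_index(1) [OF perm, of j] Suc_col_index(1) [OF perm, of k] that dn
      by simp
  qed
  \<comment> \<open>The rows above the pivot of column \<open>e\<close>, the last but one, that are
    not pivot rows: the free coordinates of the cell in this column. They are free in the last
    column too, and there are at least d - e = 2 of them.\<close>
  let ?M = "{..<?c e} - ?c ` {..<e}"
  have "d \<le> ?c e" using big by (simp add: e col_index_def)
  moreover have "card (?c ` {..<e}) \<le> e" using card_image_le [of "{..<e}" ?c] by simp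
  ultimately have "2 \<le> card ?M"
    using diff_card_le_card_Diff [of "?c ` {..<e}" "{..<?c e}"] by (simp add: e)
  then obtain i1 i2 where i: "i1 \<in> ?M" "i2 \<in> ?M" "i1 \<noteq> i2" by (rule obtain_two)
  have i_less: "i1 < n" "i2 < n" "i1 < ?c e" "i2 < ?c e" using i c_less [of e] by (auto simp: e)
  have i_c: "i1 \<noteq> ?c k" "i2 \<noteq> ?c k" if "k < d" for k
    using i c_mono [of e k] that by (cases "k < e"; cases "k = e"; force)+
  define \<mu> where "\<mu> r g = det (row_block d r g)" for r and g :: "complex mat"
  \<comment> \<open>Replacing one pivot row by \<open>i1\<close> or \<open>i2\<close> gives a minor
    that is a coordinate of the cell. The products \<open>f1\<close> and \<open>f2\<close> are the
    two sides of the cross ratio; they involve the same rows with multiplicity and so have the same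
    weight under T.\<close>
  let ?r1 = "?c(e := i1)" and ?r2 = "?c(Suc e := i2)" and ?r3 = "?c(e := i2)" and ?r4 = "?c(Suc e := i1)"
  define f1 where "f1 g = \<mu> ?r1 g * \<mu> ?r2 g" for g
  define f2 where "f2 g = \<mu> ?r3 g * \<mu> ?r4 g" for g
  have r_less: "?r1 k < n" "?r2 k < n" "?r3 k < n" "?r4 k < n" if "k < d" for k
    using that c_less i_less by auto
  have pf: "f1 \<in> poly_funs n" "f2 \<in> poly_funs n"
    unfolding f1_def f2_def \<mu>_def using r_less
    by (intro poly_funs.mult poly_funs_minor dn; blast)+
  have f_Par: "f1 (g * p) = f1 g * det (row_block d id p) ^ 2"
      "f2 (g * p) = f2 g * det (row_block d id p) ^ 2"
    if "g \<in> carrier (SL n)" "p \<in> Parabolic n d" for g p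
    unfolding f1_def f2_def \<mu>_def
    using minor_Parabolic_mult [OF that dn] r_less by (simp_all add: power2_eq_square)
  have f_Tor: "\<exists>\<chi>. f1 (t * g) = \<chi> * f1 g \<and> f2 (t * g) = \<chi> * f2 g"
    if "t \<in> Torus n" "g \<in> carrier (SL n)" for g t
  proof -
    let ?T = "\<lambda>r. \<Prod>k<d. t $$ (r k, r k)"
    have "?T ?r1 * ?T ?r2 = ?T ?r3 * ?T ?r4"
      by (simp add: e)
    moreover have "\<mu> r (t * g) = ?T r * \<mu> r g" if "\<And>k. k < d \<Longrightarrow> r k < n" for r
      unfolding \<mu>_def
      by (rule minor_Torus_mult [where r = r, OF _ _ dn that])
        (use \<open>t \<in> Torus n\<close> SL_dim(1) [OF \<open>g \<in> carrier (SL n)\<close>] in simp_all)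
    ultimately show ?thesis
      using r_less by (intro exI [of _ "?T ?r1 * ?T ?r2"]) (simp add: f1_def f2_def)
  qed
  obtain m where m: "m \<in> weyl_coset n w" "\<And>j. j < d \<Longrightarrow> m $$ (?c j, j) = 1"
    using weyl_coset_rep [OF perm d(1)] by blast
  \<comment> \<open>A curve in the cell on which three of the four coordinates are 1 and the fourth
    is \<alpha>, so that \<open>f2\<close> takes all values while \<open>f1\<close> stays 1.\<close>
  define b where "b \<alpha> = unipotent n (\<lambda>i j.
      if j = ?c e \<and> (i = i1 \<or> i = i2) then 1
      else if j = ?c (Suc e) \<and> i = i1 then \<alpha> else if j = ?c (Suc e) \<and> i = i2 then 1 else 0)" for \<alpha>
  have bm: "(b \<alpha> * m) $$ (i, k) = b \<alpha> $$ (i, ?c k)" if "i < n" "k < d" for \<alpha> i k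
    using mult_weyl_coset_index [OF _ m(1) perm, of "b \<alpha>" i k] that m(2) dn by (simp add: b_def unipotent_def)
  have c_e: "?c e < ?c (Suc e)" using c_mono by (simp add: e)
  have \<mu>: "\<mu> (?c(l := i)) (b \<alpha> * m) = b \<alpha> $$ (i, ?c l)" if "l < d" "i = i1 \<or> i = i2" for l i \<alpha>
  proof -
    have "row_block d (?c(l := i)) (b \<alpha> * m) =
        mat d d (\<lambda>(a, k). if a = l then b \<alpha> $$ (i, ?c k) else if a = k then 1 else 0)"
    proof (rule eq_matI)
      fix a k
      assume "a < dim_row (mat d d (\<lambda>(a, k). if a = l then b \<alpha> $$ (i, ?c k) else if a = k then 1 else 0))"
        "k < dim_col (mat d d (\<lambda>(a, k). if a = l then b \<alpha> $$ (i, ?c k) else if a = k then 1 else 0))"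
      then have "a < d" "k < d" by auto
      then show "row_block d (?c(l := i)) (b \<alpha> * m) $$ (a, k) =
        mat d d (\<lambda>(a, k). if a = l then b \<alpha> $$ (i, ?c k) else if a = k then 1 else 0) $$ (a, k)"
        using that i_less c_less bm i_c [of a] c_eq [of a k]
        by (auto simp: b_def)
    qed auto
    then show ?thesis unfolding \<mu>_def using det_replace_row_one [OF that(1)] by simp
  qed
  have f1_b: "f1 (b \<alpha> * m) = 1" and f2_b: "f2 (b \<alpha> * m) = \<alpha>" for \<alpha>
  proof -
    have ed: "e < d" "Suc e < d" by (simp_all add: e)
    have "b \<alpha> $$ (i1, ?c e) = 1" "b \<alpha> $$ (i2, ?c e) = 1"
      "b \<alpha> $$ (i1, ?c (Suc e)) = \<alpha>" "b \<alpha> $$ (i2, ?c (Suc e)) = 1"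
      using i_less c_less ed c_e i(3) by (simp_all add: b_def)
    then show "f1 (b \<alpha> * m) = 1" "f2 (b \<alpha> * m) = \<alpha>"
      unfolding f1_def f2_def using \<mu> ed by simp_all
  qed
  have bSL: "b \<alpha> * m \<in> carrier (SL n)" for \<alpha>
    unfolding b_def using unipotent_Borel Borel_SL weyl_coset_SL [OF m(1)] by blast
  have bX: "proj n d (b \<alpha> * m) \<in> Schubert n d w" for \<alpha>
    unfolding b_def using unipotent_Borel m(1) by (rule cell_Schubert)
  obtain x where x: "x \<in> Schubert n d w"
    "Schubert n d w \<subseteq> (GP_zariski n d) closure_of torus_orbit n x"
    using toric unfolding toric_variety_def by blast
  have "x \<in> GP n d" using x(1) Schubert_subset_GP by blast
  then obtain g where g: "g \<in> carrier (SL n)" "x = proj n d g" by (auto simp: GP_eq)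
  \<comment> \<open>T and P scale \<open>f1\<close> and \<open>f2\<close> by equal factors, so a
    linear relation between them at \<open>g\<close> persists on the closure of the orbit.\<close>
  have rel: "c2 * f1 (b \<alpha> * m) = c1 * f2 (b \<alpha> * m)" if "c2 * f1 g = c1 * f2 g" for c1 c2 \<alpha>
  proof -
    let ?F = "\<lambda>g. c2 * f1 g - c1 * f2 g"
    have "?F (b \<alpha> * m) = 0"
    proof (rule vanish_on_orbit_closure [OF g(1) dn _ _ _ bSL])
      show "?F \<in> poly_funs n"
        by (intro poly_funs_diff poly_funs.mult poly_funs.const pf)
      show "?F (g * p) \<noteq> 0" if "g \<in> carrier (SL n)" "p \<in> Parabolic n d" "?F g \<noteq> 0" for g p
      proof -
        have "?F (g * p) = ?F g * det (row_block d id p) ^ 2"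
          using f_Par that by (simp add: algebra_simps)
        then show ?thesis using that det_Parabolic_block [OF dn that(2)] by simp
      qed
      show "?F (t * g) = 0" if t: "t \<in> Torus n" for t
      proof -
        obtain \<chi> where "f1 (t * g) = \<chi> * f1 g" "f2 (t * g) = \<chi> * f2 g"
          using f_Tor [OF t g(1)] by blast
        then have "?F (t * g) = \<chi> * ?F g" by (simp add: algebra_simps)
        then show ?thesis using that \<open>c2 * f1 g = c1 * f2 g\<close> by simp
      qed
      show "proj n d (b \<alpha> * m) \<in> (GP_zariski n d) closure_of torus_orbit n (proj n d g)"
        using bX x(2) g(2) by blast
    qed
    then show ?thesis by simp
  qed
  \<comment> \<open>The relation with coefficients \<open>f2 g\<close> and \<open>f1 g\<close> is
    trivial at \<open>g\<close>. The points with \<alpha> = 0 and \<alpha> = 1 force both to be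
    zero; but then \<open>f1\<close> vanishes on the closure of the orbit.\<close>
  have "f2 g = 0" using rel [of "f2 g" "f1 g" 0] f1_b f2_b by simp
  moreover have "f1 g = 0" using rel [of "f2 g" "f1 g" 1] f1_b f2_b calculation by simp
  ultimately have "f1 (b 0 * m) = 0" using rel [of 1 0 0] by simp
  then show False using f1_b by simp
qed

section \<open>The open cell around the base point\<close>

text \<open>The Plucker coordinate whose nonvanishing defines the chart around the base
  point.\<close>

definition lead_minor :: "nat \<Rightarrow> complex mat \<Rightarrow> complex" where
  "lead_minor d g = det (row_block d id g)"

text \<open>The entries of \<open>c a\<inverse>\<close>, where \<open>a\<close> and \<open>c\<close> are the upper and lower parts of the first
  \<open>d\<close> columns of \<open>g\<close>.\<close>

definition chart_coord_num :: "nat \<Rightarrow> complex mat \<Rightarrow> nat \<Rightarrow> nat \<Rightarrow> complex" where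
  "chart_coord_num d g i j = (\<Sum>k<d. g $$ (i, k) * adj_mat (row_block d id g) $$ (k, j))"

definition chart_coord :: "nat \<Rightarrow> complex mat \<Rightarrow> nat \<Rightarrow> nat \<Rightarrow> complex" where
  "chart_coord d g i j = chart_coord_num d g i j / lead_minor d g"

definition lower_unipotent :: "nat \<Rightarrow> nat \<Rightarrow> (nat \<Rightarrow> nat \<Rightarrow> complex) \<Rightarrow> complex mat" where
  "lower_unipotent n d M =
     mat n n (\<lambda>(i, j). if i = j then 1 else if d \<le> i \<and> j < d then M i j else 0)"

text \<open>The representative of the coset of \<open>g\<close> in the unipotent group opposite to
  P, provided that \<open>lead_minor d g\<close> is nonzero.\<close>

definition normal_form :: "nat \<Rightarrow> nat \<Rightarrow> complex mat \<Rightarrow> complex mat" where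
  "normal_form n d g = lower_unipotent n d (chart_coord d g)"

lemma lower_unipotent_index [simp]:
  "i < n \<Longrightarrow> j < n \<Longrightarrow> lower_unipotent n d M $$ (i, j) =
     (if i = j then 1 else if d \<le> i \<and> j < d then M i j else 0)"
  by (simp add: lower_unipotent_def)

lemma lower_unipotent_SL: "lower_unipotent n d M \<in> carrier (SL n)"
proof -
  have "diag_mat (lower_unipotent n d M) = map (\<lambda>_. 1) [0..<n]"
    by (auto simp: diag_mat_def lower_unipotent_def)
  moreover have "det (lower_unipotent n d M) = prod_list (diag_mat (lower_unipotent n d M))"
    by (rule det_lower_triangular [of n]) (auto simp: lower_unipotent_def)
  ultimately have "det (lower_unipotent n d M) = 1"
    by (simp add: prod_list_replicate map_replicate_const)
  then show ?thesis by (simp add: carrier_SL lower_unipotent_def)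
qed

lemma lower_unipotent_cong:
  "(\<And>i j. d \<le> i \<Longrightarrow> i < n \<Longrightarrow> j < d \<Longrightarrow> M i j = M' i j) \<Longrightarrow>
    lower_unipotent n d M = lower_unipotent n d M'"
  by (auto simp: lower_unipotent_def)

lemma normal_form_SL: "normal_form n d g \<in> carrier (SL n)"
  by (simp add: normal_form_def lower_unipotent_SL)

lemma adj_row_block:
  assumes "j < d" "k < d"
  shows "(\<Sum>i<d. g $$ (j, i) * adj_mat (row_block d id g) $$ (i, k)) =
      (if j = k then lead_minor d g else 0)"
    "(\<Sum>i<d. adj_mat (row_block d id g) $$ (j, i) * g $$ (i, k)) =
      (if j = k then lead_minor d g else 0)"
proof -
  let ?A = "row_block d id g"
  note adj = adj_mat [of ?A d, OF row_block_carrier]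
  have "(\<Sum>i<d. g $$ (j, i) * adj_mat ?A $$ (i, k)) = (?A * adj_mat ?A) $$ (j, k)"
    by (subst index_mult_sum [of _ d d _ d]) (use adj(1) assms in auto)
  then show "(\<Sum>i<d. g $$ (j, i) * adj_mat ?A $$ (i, k)) = (if j = k then lead_minor d g else 0)"
    unfolding adj(2) using assms by (simp add: lead_minor_def)
  have "(\<Sum>i<d. adj_mat ?A $$ (j, i) * g $$ (i, k)) = (adj_mat ?A * ?A) $$ (j, k)"
    by (subst index_mult_sum [of _ d d _ d]) (use adj(1) assms in auto)
  then show "(\<Sum>i<d. adj_mat ?A $$ (j, i) * g $$ (i, k)) = (if j = k then lead_minor d g else 0)"
    unfolding adj(3) using assms by (simp add: lead_minor_def)
qed

lemma chart_coord_mult: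
  assumes "lead_minor d g \<noteq> 0" "k < d"
  shows "(\<Sum>j<d. chart_coord d g i j * g $$ (j, k)) = g $$ (i, k)"
proof -
  let ?adj = "adj_mat (row_block d id g)"
  have "(\<Sum>j<d. chart_coord_num d g i j * g $$ (j, k)) =
      (\<Sum>j<d. \<Sum>l<d. g $$ (i, l) * (?adj $$ (l, j) * g $$ (j, k)))"
    by (simp add: chart_coord_num_def sum_distrib_right mult.assoc)
  also have "\<dots> = (\<Sum>l<d. g $$ (i, l) * (\<Sum>j<d. ?adj $$ (l, j) * g $$ (j, k)))"
    unfolding sum_distrib_left by (rule sum.swap)
  also have "\<dots> = (\<Sum>l<d. if l = k then g $$ (i, k) * lead_minor d g else 0)"
    using assms(2) by (intro sum.cong) (auto simp: adj_row_block)
  also have "\<dots> = g $$ (i, k) * lead_minor d g" using assms(2) by simp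
  finally show ?thesis
    using assms(1) by (simp add: chart_coord_def divide_simps flip: sum_divide_distrib)
qed

text \<open>The system for \<open>M\<close> has an invertible matrix; this identifies coordinates
  without any computation of an adjugate.\<close>

lemma chart_coord_unique:
  assumes "lead_minor d g \<noteq> 0" "j < d" and eq: "\<And>k. k < d \<Longrightarrow> (\<Sum>j<d. M j * g $$ (j, k)) = g $$ (i, k)"
  shows "chart_coord d g i j = M j"
proof -
  let ?adj = "adj_mat (row_block d id g)"
  have "chart_coord_num d g i j = (\<Sum>k<d. \<Sum>l<d. M l * (g $$ (l, k) * ?adj $$ (k, j)))"
    unfolding chart_coord_num_def
    by (intro sum.cong refl) (simp add: eq [symmetric] sum_distrib_right mult.assoc)
  also have "\<dots> = (\<Sum>l<d. M l * (\<Sum>k<d. g $$ (l, k) * ?adj $$ (k, j)))"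
    unfolding sum_distrib_left by (rule sum.swap)
  also have "\<dots> = (\<Sum>l<d. if l = j then M j * lead_minor d g else 0)"
    using assms(2) by (intro sum.cong) (auto simp: adj_row_block)
  also have "\<dots> = M j * lead_minor d g" using assms(2) by simp
  finally show ?thesis using assms(1) by (simp add: chart_coord_def)
qed

context
  fixes n d :: nat
  assumes dn: "d \<le> n"
begin

lemma proj_normal_form:
  assumes "g \<in> carrier (SL n)" "lead_minor d g \<noteq> 0"
  shows "proj n d (normal_form n d g) = proj n d g"
proof (rule proj_eqI [OF dn normal_form_SL assms(1), symmetric])
  fix i j assume ij: "i < n" "j < d"
  show "g $$ (i, j) = (\<Sum>k<d. normal_form n d g $$ (i, k) * g $$ (k, j))"
  proof (cases "i < d")
    case True
    have "(\<Sum>k<d. normal_form n d g $$ (i, k) * g $$ (k, j)) =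
        (\<Sum>k<d. if k = i then g $$ (i, j) else 0)"
      using True ij dn by (intro sum.cong) (auto simp: normal_form_def)
    then show ?thesis using True by simp
  next
    case False
    then show ?thesis
      using ij dn chart_coord_mult [OF assms(2) ij(2), of i] by (auto simp: normal_form_def)
  qed
qed

lemma lead_minor_Parabolic:
  "g \<in> carrier (SL n) \<Longrightarrow> p \<in> Parabolic n d \<Longrightarrow> lead_minor d (g * p) \<noteq> 0 \<longleftrightarrow> lead_minor d g \<noteq> 0"
  using minor_Parabolic_mult [of g n p d id] det_Parabolic_block [OF dn] dn
  by (simp add: lead_minor_def)

lemma normal_form_Parabolic:
  assumes g: "g \<in> carrier (SL n)" and p: "p \<in> Parabolic n d" and "lead_minor d g \<noteq> 0"
  shows "normal_form n d (g * p) = normal_form n d g"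
  unfolding normal_form_def
proof (rule lower_unipotent_cong)
  fix i j assume i: "d \<le> i" "i < n" and j: "j < d"
  have gp: "(g * p) $$ (a, k) = (\<Sum>l<d. g $$ (a, l) * p $$ (l, k))" if "a < n" "k < d" for a k
  proof -
    have "(g * p) $$ (a, k) = (\<Sum>l<n. g $$ (a, l) * p $$ (l, k))"
      using that dn by (intro index_mult_sum [OF SL_dim(1) [OF g] SL_dim(1) [OF ParabolicD(1) [OF p]]]) auto
    also have "\<dots> = (\<Sum>l<d. g $$ (a, l) * p $$ (l, k))"
      using dn ParabolicD(2) [OF p] that by (intro sum.mono_neutral_right) auto
    finally show ?thesis .
  qed
  show "chart_coord d (g * p) i j = chart_coord d g i j"
  proof (rule chart_coord_unique [OF _ j])
    show "lead_minor d (g * p) \<noteq> 0" using lead_minor_Parabolic [OF g p] assms(3) by simp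
    fix k assume k: "k < d"
    have "(\<Sum>j<d. chart_coord d g i j * (g * p) $$ (j, k)) =
        (\<Sum>j<d. \<Sum>l<d. chart_coord d g i j * g $$ (j, l) * p $$ (l, k))"
      using gp k dn by (intro sum.cong) (auto simp: sum_distrib_left mult.assoc)
    also have "\<dots> = (\<Sum>l<d. (\<Sum>j<d. chart_coord d g i j * g $$ (j, l)) * p $$ (l, k))"
      unfolding sum_distrib_right by (rule sum.swap)
    also have "\<dots> = (g * p) $$ (i, k)"
      using gp [OF i(2) k] chart_coord_mult [OF assms(3)] by simp
    finally show "(\<Sum>j<d. chart_coord d g i j * (g * p) $$ (j, k)) = (g * p) $$ (i, k)" .
  qed
qed

lemma lead_minor_lower_unipotent [simp]: "lead_minor d (lower_unipotent n d M) = 1"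
proof -
  have "row_block d id (lower_unipotent n d M) = 1\<^sub>m d"
    using dn by (intro eq_matI) auto
  then show ?thesis by (simp add: lead_minor_def)
qed

lemma lead_minor_poly_funs: "lead_minor d \<in> poly_funs n"
proof -
  have "(\<lambda>g. det (row_block d id g)) \<in> poly_funs n" using dn by (intro poly_funs_minor) auto
  then show ?thesis unfolding lead_minor_def [abs_def] .
qed

lemma chart_coord_num_poly_funs:
  assumes "i < n" "j < d"
  shows "(\<lambda>g. chart_coord_num d g i j) \<in> poly_funs n"
proof -
  let ?ins = "\<lambda>i a. if a < i then a else Suc a"
  let ?F = "\<lambda>k g. (- 1) ^ (j + k) * det (mat (d - 1) (d - 1) (\<lambda>(a, b). g $$ (?ins j a, ?ins k b)))"
  have adj: "adj_mat (row_block d id g) $$ (k, j) = ?F k g" if "k < d" for k and g :: "complex mat"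
  proof -
    have "mat_delete (row_block d id g) j k =
        mat (d - 1) (d - 1) (\<lambda>(a, b). g $$ (?ins j a, ?ins k b))"
      using that assms(2) by (intro eq_matI) (auto simp: mat_delete_def)
    then show ?thesis using that assms(2) by (simp add: adj_mat_def cofactor_def)
  qed
  have "(\<lambda>g. \<Sum>k<d. g $$ (i, k) * ?F k g) \<in> poly_funs n"
    using assms dn
    by (intro poly_funs_sum poly_funs.mult poly_funs.entry poly_funs.const poly_funs_det) auto
  moreover have "chart_coord_num d g i j = (\<Sum>k<d. g $$ (i, k) * ?F k g)" for g
    unfolding chart_coord_num_def by (intro sum.cong refl) (simp add: adj)
  ultimately show ?thesis by simp
qed

text \<open>The entries of the normal form have the denominator \<open>lead_minor d g\<close>, and a
  power of it turns \<open>f\<close> of the normal form into a polynomial in the entries of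
  \<open>g\<close>.\<close>

lemma poly_funs_normal_form:
  assumes "f \<in> poly_funs n"
  shows "\<exists>F\<in>poly_funs n. \<exists>k. \<forall>g. lead_minor d g \<noteq> 0 \<longrightarrow> F g = lead_minor d g ^ k * f (normal_form n d g)"
  using assms
proof induction
  case (const c)
  show ?case by (rule bexI [OF _ poly_funs.const [of c]], rule exI [of _ 0]) simp
next
  case (entry i j)
  consider "i = j \<or> \<not> (d \<le> i \<and> j < d)" | "i \<noteq> j" "d \<le> i" "j < d" by blast
  then show ?case
  proof cases
    case 1
    then have "normal_form n d g $$ (i, j) = (if i = j then 1 else 0)" for g
      using entry by (auto simp: normal_form_def)
    then show ?thesis
      by (intro bexI [OF _ poly_funs.const [of "if i = j then 1 else 0"]] exI [of _ 0]) simp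
  next
    case 2
    then have "normal_form n d g $$ (i, j) = chart_coord_num d g i j / lead_minor d g" for g
      using entry by (simp add: normal_form_def chart_coord_def)
    then show ?thesis
      by (intro bexI [OF _ chart_coord_num_poly_funs [OF entry(1) 2(3)]] exI [of _ 1]) simp
  qed
next
  case (add p q)
  then obtain P k Q l where P: "P \<in> poly_funs n"
      "\<And>g. lead_minor d g \<noteq> 0 \<Longrightarrow> P g = lead_minor d g ^ k * p (normal_form n d g)"
    and Q: "Q \<in> poly_funs n"
      "\<And>g. lead_minor d g \<noteq> 0 \<Longrightarrow> Q g = lead_minor d g ^ l * q (normal_form n d g)"
    by metis
  have "(\<lambda>g. lead_minor d g ^ l * P g + lead_minor d g ^ k * Q g) \<in> poly_funs n"
    using P(1) Q(1) lead_minor_poly_funs by (intro poly_funs.add poly_funs.mult poly_funs_power)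
  then show ?case
    by (rule bexI [rotated]) (rule exI [of _ "k + l"], simp add: P(2) Q(2) power_add algebra_simps)
next
  case (mult p q)
  then obtain P k Q l where P: "P \<in> poly_funs n"
      "\<And>g. lead_minor d g \<noteq> 0 \<Longrightarrow> P g = lead_minor d g ^ k * p (normal_form n d g)"
    and Q: "Q \<in> poly_funs n"
      "\<And>g. lead_minor d g \<noteq> 0 \<Longrightarrow> Q g = lead_minor d g ^ l * q (normal_form n d g)"
    by metis
  show ?case
    by (rule bexI [OF _ poly_funs.mult [OF P(1) Q(1)]])
      (rule exI [of _ "k + l"], simp add: P(2) Q(2) power_add algebra_simps)
qed

text \<open>The chart translated by \<open>b\<close> and, inside it, a principal open set; a
  suitable \<open>b\<close> brings any given point of G/P into view.\<close>

lemma chart_nonzero_open: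
  assumes f: "f \<in> poly_funs n" and b: "b \<in> carrier (SL n)"
  obtains U where "openin (GP_zariski n d) U"
    "\<And>g. g \<in> carrier (SL n) \<Longrightarrow>
      proj n d g \<in> U \<longleftrightarrow> lead_minor d (b * g) \<noteq> 0 \<and> f (normal_form n d (b * g)) \<noteq> 0"
proof -
  obtain F k where F: "F \<in> poly_funs n"
    "\<And>g. lead_minor d g \<noteq> 0 \<Longrightarrow> F g = lead_minor d g ^ k * f (normal_form n d g)"
    using poly_funs_normal_form [OF f] by metis
  \<comment> \<open>The extra factor removes the points outside the chart, where \<open>F\<close> is
    not controlled.\<close>
  have "(\<lambda>g. lead_minor d g * F g) \<in> poly_funs n"
    using F(1) lead_minor_poly_funs by (intro poly_funs.mult)
  then obtain H where H: "H \<in> poly_funs n"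
    "\<forall>g\<in>carrier_mat n n. H g = lead_minor d (b * g) * F (b * g)"
    using poly_funs_translate SL_dim(1) [OF b] by blast
  have H_iff: "H g \<noteq> 0 \<longleftrightarrow> lead_minor d (b * g) \<noteq> 0 \<and> f (normal_form n d (b * g)) \<noteq> 0"
    if "g \<in> carrier (SL n)" for g
    using H(2) SL_dim(1) [OF that] F(2) [of "b * g"] by auto
  have inv: "H (g * p) \<noteq> 0" if g: "g \<in> carrier (SL n)" and p: "p \<in> Parabolic n d" and "H g \<noteq> 0" for g p
  proof -
    have bg: "b * g \<in> carrier (SL n)" using b g by blast
    have gp: "g * p \<in> carrier (SL n)" using g ParabolicD(1) [OF p] by blast
    have "b * (g * p) = b * g * p"
      using assoc_mult_mat [of b n n g n p n] SL_dim(1) b g ParabolicD(1) [OF p] by simp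
    then show ?thesis
      using that(3) normal_form_Parabolic [OF bg p] lead_minor_Parabolic [OF bg p]
      unfolding H_iff [OF g] H_iff [OF gp] by simp
  qed
  show thesis
  proof (rule that)
    show "openin (GP_zariski n d) (GP_nonzero n d H)"
      using openin_GP_nonzero [where f = H, OF dn inv H(1)] .
    show "proj n d g \<in> GP_nonzero n d H \<longleftrightarrow>
        lead_minor d (b * g) \<noteq> 0 \<and> f (normal_form n d (b * g)) \<noteq> 0"
      if "g \<in> carrier (SL n)" for g
      using proj_in_GP_nonzero_iff [where f = H, OF dn inv that] H_iff [OF that] by simp
  qed
qed

text \<open>The powers of \<open>lead_minor\<close> that clear the denominators of \<open>r\<close>
  and of \<open>s\<close> are exchanged crosswise, so that they cancel in the quotient.\<close>

lemma chart_quotient_regular: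
  assumes r: "r \<in> poly_funs n" and s: "s \<in> poly_funs n" and b: "b \<in> carrier (SL n)"
    and U: "\<And>g. g \<in> carrier (SL n) \<Longrightarrow> proj n d g \<in> U \<Longrightarrow>
      lead_minor d (b * g) \<noteq> 0 \<and> s (normal_form n d (b * g)) \<noteq> 0"
    and h: "\<And>g. g \<in> carrier (SL n) \<Longrightarrow> proj n d g \<in> U \<Longrightarrow>
      h (proj n d g) = r (normal_form n d (b * g)) / s (normal_form n d (b * g))"
  shows "GP_regular n d U h"
proof -
  obtain R k where R: "R \<in> poly_funs n"
    "\<And>g. lead_minor d g \<noteq> 0 \<Longrightarrow> R g = lead_minor d g ^ k * r (normal_form n d g)"
    using poly_funs_normal_form [OF r] by metis
  obtain S l where S: "S \<in> poly_funs n"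
    "\<And>g. lead_minor d g \<noteq> 0 \<Longrightarrow> S g = lead_minor d g ^ l * s (normal_form n d g)"
    using poly_funs_normal_form [OF s] by metis
  have "(\<lambda>g. lead_minor d g ^ l * R g) \<in> poly_funs n" "(\<lambda>g. lead_minor d g ^ k * S g) \<in> poly_funs n"
    using R(1) S(1) lead_minor_poly_funs by (auto intro: poly_funs.mult poly_funs_power)
  then obtain p q where p: "p \<in> poly_funs n" "\<forall>g\<in>carrier_mat n n. p g = lead_minor d (b * g) ^ l * R (b * g)"
    and q: "q \<in> poly_funs n" "\<forall>g\<in>carrier_mat n n. q g = lead_minor d (b * g) ^ k * S (b * g)"
    using poly_funs_translate [OF _ SL_dim(1) [OF b]] by (metis (no_types, lifting))
  have "q g \<noteq> 0 \<and> h (proj n d g) = p g / q g"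
    if "g \<in> carrier (SL n)" "proj n d g \<in> U" for g
    using U [OF that] h [OF that] p(2) q(2) SL_dim(1) [OF that(1)] R(2) [of "b * g"] S(2) [of "b * g"]
    by simp
  then show ?thesis
    unfolding GP_regular_def using p(1) q(1) by (intro ballI impI bexI [of _ p] bexI [of _ q]) auto
qed

end

section \<open>Translates of the open cell\<close>

lemma SL_open_translate:
  assumes "SL_open n V" "b \<in> carrier (SL n)"
  shows "SL_open n {g \<in> carrier (SL n). b * g \<in> V}"
proof -
  obtain S where S: "S \<subseteq> poly_funs n" "V = carrier (SL n) - {g. \<forall>f\<in>S. f g = 0}"
    using assms(1) unfolding SL_open_def by blast
  have "\<forall>f\<in>S. \<exists>f'\<in>poly_funs n. \<forall>g\<in>carrier_mat n n. f' g = f (b * g)"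
    using S(1) poly_funs_translate [OF _ SL_dim(1) [OF assms(2)]] by blast
  then obtain T where T: "\<And>f. f \<in> S \<Longrightarrow> T f \<in> poly_funs n"
    "\<And>f g. f \<in> S \<Longrightarrow> g \<in> carrier_mat n n \<Longrightarrow> T f g = f (b * g)"
    by metis
  have "{g \<in> carrier (SL n). b * g \<in> V} = carrier (SL n) - {g. \<forall>f\<in>T ` S. f g = 0}"
    unfolding S(2) using T(2) SL_dim(1) SL_mult_closed [OF assms(2)] by auto
  then show ?thesis
    unfolding SL_open_def using T(1) by (intro exI [of _ "T ` S"]) auto
qed

lemma closure_of_GP_translate:
  assumes dn: "d \<le> n" and b: "b \<in> carrier (SL n)" and h: "h \<in> carrier (SL n)"
    and S: "\<And>g. g \<in> carrier (SL n) \<Longrightarrow> proj n d g \<in> S \<Longrightarrow> proj n d (b * g) \<in> S"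
    and cl: "proj n d h \<in> (GP_zariski n d) closure_of S"
  shows "proj n d (b * h) \<in> (GP_zariski n d) closure_of S"
  unfolding in_closure_of
proof (intro conjI allI impI)
  have bh: "b * h \<in> carrier (SL n)" using b h by blast
  then show "proj n d (b * h) \<in> topspace (GP_zariski n d)" by (auto simp: topspace_GP GP_eq)
  fix U assume U: "proj n d (b * h) \<in> U \<and> openin (GP_zariski n d) U"
  \<comment> \<open>The preimage of \<open>U\<close> under left translation by \<open>b\<close>; by
    \<open>coset\<close> membership does not depend on the representative.\<close>
  define U' where "U' = {proj n d g | g. g \<in> carrier (SL n) \<and> proj n d (b * g) \<in> U}"
  have coset: "proj n d (b * g) = b <#\<^bsub>SL n\<^esub> proj n d g" if "g \<in> carrier (SL n)" for g
    using l_coset_proj [OF dn b that] by simp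
  have U'_iff: "proj n d g \<in> U' \<longleftrightarrow> proj n d (b * g) \<in> U" if "g \<in> carrier (SL n)" for g
    unfolding U'_def mem_Collect_eq using that coset by metis
  have "SL_open n {g \<in> carrier (SL n). proj n d g \<in> U}"
    using U by (simp add: openin_GP_zariski GP_open_def openin_SL_zariski)
  then have "SL_open n {g \<in> carrier (SL n). b * g \<in> {g \<in> carrier (SL n). proj n d g \<in> U}}"
    using b by (rule SL_open_translate)
  moreover have "{g \<in> carrier (SL n). b * g \<in> {g \<in> carrier (SL n). proj n d g \<in> U}} =
      {g \<in> carrier (SL n). proj n d g \<in> U'}"
    using U'_iff SL_mult_closed [OF b] by auto
  moreover have "U' \<subseteq> GP n d" by (auto simp: U'_def GP_eq)
  ultimately have "openin (GP_zariski n d) U'"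
    by (simp add: openin_GP_zariski GP_open_def openin_SL_zariski)
  moreover have "proj n d h \<in> U'" using U'_iff [OF h] U by simp
  ultimately obtain x where x: "x \<in> S" "x \<in> U'" using cl unfolding in_closure_of by blast
  then obtain g where "g \<in> carrier (SL n)" "x = proj n d g" "proj n d (b * g) \<in> U"
    unfolding U'_def by blast
  then show "\<exists>y. y \<in> S \<and> y \<in> U" using S x(1) by blast
qed

lemma Borel_mult:
  assumes "b \<in> Borel n" "c \<in> Borel n"
  shows "b * c \<in> Borel n"
proof -
  note carr = SL_dim [OF Borel_SL [OF assms(1)]] SL_dim [OF Borel_SL [OF assms(2)]]
  have tri: "a $$ (i, j) = 0" if "a \<in> Borel n" "j < i" "i < n" for a i j
    using that SL_dim [OF Borel_SL [OF that(1)]] by (auto simp: Borel_def upper_triangular_def)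
  have "(b * c) $$ (i, j) = 0" if "j < i" "i < n" for i j
  proof -
    have "b $$ (i, k) * c $$ (k, j) = 0" if "k < n" for k
      using tri [OF assms(1), of k i] tri [OF assms(2), of j k] that \<open>j < i\<close> \<open>i < n\<close>
      by (cases "k < i") auto
    then have "(\<Sum>k<n. b $$ (i, k) * c $$ (k, j)) = 0" by (intro sum.neutral) simp
    then show ?thesis
      using index_mult_sum [OF carr(1,4), of i j] that by simp
  qed
  moreover have "b * c \<in> carrier (SL n)" using assms Borel_SL by blast
  ultimately show ?thesis using carr by (simp add: Borel_def upper_triangular_def)
qed

lemma Schubert_translate:
  assumes "d \<le> n" "b \<in> Borel n" "h \<in> carrier (SL n)" "proj n d h \<in> Schubert n d w"
  shows "proj n d (b * h) \<in> Schubert n d w"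
  unfolding Schubert_def
proof (rule closure_of_GP_translate [OF assms(1) Borel_SL [OF assms(2)] assms(3)])
  show "proj n d h \<in> (GP_zariski n d) closure_of cell n d w"
    using assms(4) by (simp add: Schubert_def)
  fix g assume g: "g \<in> carrier (SL n)" "proj n d g \<in> cell n d w"
  then obtain c m where c: "c \<in> Borel n" "m \<in> weyl_coset n w" "proj n d g = proj n d (c * m)"
    by blast
  note carr = Borel_SL [OF assms(2)] Borel_SL [OF c(1)] weyl_coset_SL [OF c(2)]
  have "proj n d (b * g) = proj n d (b * (c * m))"
    using l_coset_proj [OF assms(1) carr(1)] g(1) c(3) SL_mult_closed [OF carr(2,3)] by metis
  also have "b * (c * m) = b * c * m"
    using assoc_mult_mat [of b n n c n m n] SL_dim(1) carr by simp
  finally show "proj n d (b * g) \<in> cell n d w" using Borel_mult [OF assms(2) c(1)] c(2) by blast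
qed

text \<open>The determinant is a polynomial in \<open>s\<close> with the value 1 at 0.\<close>

lemma det_one_add_smult_roots:
  fixes A :: "complex mat"
  assumes "A \<in> carrier_mat d d"
  shows "finite {s. det (1\<^sub>m d + s \<cdot>\<^sub>m A) = 0}"
proof -
  have "\<exists>q. \<forall>s. (1\<^sub>m d + s \<cdot>\<^sub>m A) $$ (i, j) = poly q s" if "i < d" "j < d" for i j
    using that assms by (intro exI [of _ "[:if i = j then 1 else 0, A $$ (i, j):]"]) auto
  then have "poly_path d (\<lambda>s. 1\<^sub>m d + s \<cdot>\<^sub>m A)" by (simp add: poly_path_def)
  \<comment> \<open>For \<open>d\<close> by \<open>d\<close> matrices \<open>lead_minor d\<close> is
    the determinant itself.\<close>
  then obtain q where q: "\<And>s. lead_minor d (1\<^sub>m d + s \<cdot>\<^sub>m A) = poly q s"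
    using poly_path_compose [OF lead_minor_poly_funs] by blast
  have "row_block d id (1\<^sub>m d + s \<cdot>\<^sub>m A) = 1\<^sub>m d + s \<cdot>\<^sub>m A" for s
    using assms by (intro eq_matI) auto
  then have q': "det (1\<^sub>m d + s \<cdot>\<^sub>m A) = poly q s" for s
    using q by (simp add: lead_minor_def)
  have "1\<^sub>m d + 0 \<cdot>\<^sub>m A = 1\<^sub>m d" using assms by (intro eq_matI) auto
  then have "poly q 0 = 1" using q' [of 0] by simp
  then have "q \<noteq> 0" by auto
  then show ?thesis unfolding q' by (rule poly_roots_finite)
qed

text \<open>The unipotent radical of P, whose elements are identity matrices with a block
  \<open>N\<close> added in the upper right corner; it lies in B.\<close>

definition shear :: "nat \<Rightarrow> nat \<Rightarrow> (nat \<Rightarrow> nat \<Rightarrow> complex) \<Rightarrow> complex mat" where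
  "shear n d N = unipotent n (\<lambda>i j. if i < d \<and> d \<le> j then N i j else 0)"

text \<open>Let \<open>(X N\<^sub>0)\<close> be the first \<open>d\<close> rows of \<open>g\<inverse>\<close>, so that \<open>X a + N\<^sub>0 c = 1\<close> for the parts
  \<open>a\<close> and \<open>c\<close> of \<open>g\<close>. Then \<open>(1 + r X) (a + N c) = a + r\<close> for \<open>N = (1 + r X)\<inverse> r N\<^sub>0\<close>, and
  both \<open>1 + r X\<close> and \<open>a + r\<close> are invertible for almost all \<open>r\<close>.\<close>

lemma shear_into_chart:
  assumes dn: "d \<le> n" and g: "g \<in> carrier (SL n)"
  obtains N where "lead_minor d (shear n d N * g) \<noteq> 0"
proof -
  obtain q where q: "q \<in> carrier (SL n)" "q * g = 1\<^sub>m n" using SL_inverse [OF g] by metis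
  note carr = SL_dim(1) [OF g] SL_dim(1) [OF q(1)]
  let ?a = "row_block d id g" and ?X = "row_block d id q"
  \<comment> \<open>Thus \<open>r\<close> is nonzero and avoids the roots of det(1 + r X) and,
    through its inverse, those of det(a + r) = r^d det(1 + a / r).\<close>
  let ?E = "{s. det (1\<^sub>m d + s \<cdot>\<^sub>m ?X) = 0} \<union> {0} \<union> inverse ` {s. det (1\<^sub>m d + s \<cdot>\<^sub>m ?a) = 0}"
  have "finite ?E" using det_one_add_smult_roots by simp
  then obtain r where r: "r \<notin> ?E" using ex_new_if_finite infinite_UNIV_char_0 by metis
  let ?Xr = "1\<^sub>m d + r \<cdot>\<^sub>m ?X"
  have Xr: "?Xr \<in> carrier_mat d d" "det ?Xr \<noteq> 0" using r by auto
  define Y where "Y = inverse (det ?Xr) \<cdot>\<^sub>m adj_mat ?Xr"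
  have "?Xr * Y = inverse (det ?Xr) \<cdot>\<^sub>m (det ?Xr \<cdot>\<^sub>m 1\<^sub>m d)"
    using adj_mat [OF Xr(1)] by (simp add: Y_def mult_smult_distrib [OF Xr(1)])
  also have "\<dots> = 1\<^sub>m d" using Xr(2) by (intro eq_matI) auto
  finally have Y: "?Xr * Y = 1\<^sub>m d" "Y \<in> carrier_mat d d"
    using adj_mat [OF Xr(1)] by (simp_all add: Y_def)
  define N where "N i k = r * (\<Sum>l<d. Y $$ (i, l) * q $$ (l, k))" for i k
  have XN: "(\<Sum>l<d. ?Xr $$ (i, l) * N l k) = r * q $$ (i, k)" if "i < d" for i k
  proof -
    have "(\<Sum>l<d. ?Xr $$ (i, l) * N l k) =
        (\<Sum>l<d. \<Sum>m<d. r * (?Xr $$ (i, l) * Y $$ (l, m) * q $$ (m, k)))"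
      by (simp add: N_def sum_distrib_left algebra_simps)
    also have "\<dots> = (\<Sum>m<d. r * ((\<Sum>l<d. ?Xr $$ (i, l) * Y $$ (l, m)) * q $$ (m, k)))"
      unfolding sum_distrib_right sum_distrib_left by (rule sum.swap)
    also have "\<dots> = (\<Sum>m<d. r * ((?Xr * Y) $$ (i, m) * q $$ (m, k)))"
      using that by (intro sum.cong refl) (simp add: index_mult_sum [OF Xr(1) Y(2)])
    also have "\<dots> = (\<Sum>m<d. if m = i then r * q $$ (i, k) else 0)"
      unfolding Y(1) using that by (intro sum.cong) auto
    finally show ?thesis using that by simp
  qed
  have sg: "(shear n d N * g) $$ (i, j) = g $$ (i, j) + (\<Sum>k\<in>{d..<n}. N i k * g $$ (k, j))"
    if "i < d" "j < d" for i j
  proof -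
    have "(shear n d N * g) $$ (i, j) = (\<Sum>k<n. shear n d N $$ (i, k) * g $$ (k, j))"
      using that dn by (intro index_mult_sum [where nr = n, OF _ carr(1)]) (auto simp: shear_def unipotent_def)
    also have "\<dots> = (\<Sum>k<n. (if k = i then g $$ (i, j) else 0) + (if d \<le> k then N i k * g $$ (k, j) else 0))"
      using that dn by (intro sum.cong) (auto simp: shear_def)
    also have "\<dots> = g $$ (i, j) + (\<Sum>k<n. if d \<le> k then N i k * g $$ (k, j) else 0)"
      using that dn by (simp add: sum.distrib)
    also have "(\<Sum>k<n. if d \<le> k then N i k * g $$ (k, j) else 0) = (\<Sum>k\<in>{d..<n}. N i k * g $$ (k, j))"
      by (subst sum.inter_filter [symmetric]) (auto intro!: sum.cong)
    finally show ?thesis .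
  qed
  have eq: "?Xr * row_block d id (shear n d N * g) = ?a + r \<cdot>\<^sub>m 1\<^sub>m d" (is "?L = ?R")
  proof (rule eq_matI)
    fix i j assume "i < dim_row ?R" "j < dim_col ?R"
    then have ij: "i < d" "j < d" by auto
    have "?L $$ (i, j) = (\<Sum>l<d. ?Xr $$ (i, l) * (shear n d N * g) $$ (l, j))"
      using ij by (subst index_mult_sum [OF Xr(1), of _ d]) auto
    also have "\<dots> = (\<Sum>l<d. ?Xr $$ (i, l) * g $$ (l, j)) +
        (\<Sum>l<d. \<Sum>k\<in>{d..<n}. ?Xr $$ (i, l) * N l k * g $$ (k, j))"
      using ij by (simp add: sg distrib_left sum.distrib sum_distrib_left mult.assoc)
    also have "(\<Sum>l<d. \<Sum>k\<in>{d..<n}. ?Xr $$ (i, l) * N l k * g $$ (k, j)) =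
        (\<Sum>k\<in>{d..<n}. (\<Sum>l<d. ?Xr $$ (i, l) * N l k) * g $$ (k, j))"
      unfolding sum_distrib_right by (rule sum.swap)
    also have "\<dots> = r * (\<Sum>k\<in>{d..<n}. q $$ (i, k) * g $$ (k, j))"
      using ij by (simp add: XN sum_distrib_left mult.assoc del: index_add_mat)
    also have "(\<Sum>l<d. ?Xr $$ (i, l) * g $$ (l, j)) =
        (\<Sum>l<d. (if l = i then g $$ (i, j) else 0) + r * (q $$ (i, l) * g $$ (l, j)))"
      using ij by (intro sum.cong) (auto simp: algebra_simps)
    also have "\<dots> = g $$ (i, j) + r * (\<Sum>l<d. q $$ (i, l) * g $$ (l, j))"
      using ij by (simp add: sum.distrib sum_distrib_left)
    finally have "?L $$ (i, j) = g $$ (i, j) +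
        r * ((\<Sum>l<d. q $$ (i, l) * g $$ (l, j)) + (\<Sum>k\<in>{d..<n}. q $$ (i, k) * g $$ (k, j)))"
      by (simp only: distrib_left add.assoc)
    also have "(\<Sum>l<d. q $$ (i, l) * g $$ (l, j)) + (\<Sum>k\<in>{d..<n}. q $$ (i, k) * g $$ (k, j)) =
        (\<Sum>k<n. q $$ (i, k) * g $$ (k, j))"
      using dn by (subst sum.union_disjoint [symmetric]) (auto intro!: sum.cong)
    also have "\<dots> = (q * g) $$ (i, j)"
      using ij dn by (subst index_mult_sum [OF carr(2,1)]) auto
    also have "g $$ (i, j) + r * (q * g) $$ (i, j) = ?R $$ (i, j)"
      unfolding q(2) using ij dn by simp
    finally show "?L $$ (i, j) = ?R $$ (i, j)" .
  qed (auto simp: shear_def unipotent_def)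
  have "?a + r \<cdot>\<^sub>m 1\<^sub>m d = r \<cdot>\<^sub>m (1\<^sub>m d + inverse r \<cdot>\<^sub>m ?a)"
    using r by (intro eq_matI) (auto simp: algebra_simps)
  moreover have "det (1\<^sub>m d + inverse r \<cdot>\<^sub>m ?a) \<noteq> 0"
    using r by (auto simp: image_iff)
  ultimately have "det (?a + r \<cdot>\<^sub>m 1\<^sub>m d) \<noteq> 0" using r by simp
  then have "lead_minor d (shear n d N * g) \<noteq> 0"
    using det_mult [OF Xr(1), of "row_block d id (shear n d N * g)"] unfolding lead_minor_def eq by auto
  then show thesis by (rule that)
qed

lemma shear_Borel: "shear n d N \<in> Borel n"
  unfolding shear_def by (rule unipotent_Borel)

lemma poly_path_shear: "poly_path n (\<lambda>s. shear n d (\<lambda>i j. s * N i j))"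
  unfolding poly_path_def
proof (intro allI impI)
  fix i j assume ij: "i < n" "j < n"
  show "\<exists>q. \<forall>s. shear n d (\<lambda>i j. s * N i j) $$ (i, j) = poly q s"
    using ij by (intro exI [of _ "if i = j then 1 else if i < j \<and> i < d \<and> d \<le> j then [:0, N i j:] else 0"])
      (auto simp: shear_def)
qed

lemma shear_0 [simp]: "shear n d (\<lambda>i j. 0) = 1\<^sub>m n"
  by (intro eq_matI) (auto simp: shear_def unipotent_def)

lemma shear_add: "shear n d N * shear n d M = shear n d (\<lambda>i j. N i j + M i j)"
proof (rule eq_matI)
  have carr: "shear n d K \<in> carrier_mat n n" for K by (simp add: shear_def unipotent_def)
  fix i j assume "i < dim_row (shear n d (\<lambda>i j. N i j + M i j))"
    "j < dim_col (shear n d (\<lambda>i j. N i j + M i j))"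
  then have ij: "i < n" "j < n" by (auto simp: shear_def unipotent_def)
  have "(shear n d N * shear n d M) $$ (i, j) = (\<Sum>k<n. shear n d N $$ (i, k) * shear n d M $$ (k, j))"
    by (rule index_mult_sum [OF carr carr ij])
  also have "\<dots> = (\<Sum>k<n. (if k = i then shear n d M $$ (i, j) else 0) +
      (if k = j then if i < d \<and> d \<le> j then N i j else 0 else 0))"
    using ij by (intro sum.cong) (auto simp: shear_def)
  also have "\<dots> = shear n d (\<lambda>i j. N i j + M i j) $$ (i, j)"
    using ij by (simp add: sum.distrib) (auto simp: shear_def)
  finally show "(shear n d N * shear n d M) $$ (i, j) = shear n d (\<lambda>i j. N i j + M i j) $$ (i, j)" .
qed (auto simp: shear_def unipotent_def)

lemma shear_inverse: "shear n d N * shear n d (\<lambda>i j. - N i j) = 1\<^sub>m n"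
    "shear n d (\<lambda>i j. - N i j) * shear n d N = 1\<^sub>m n"
  by (simp_all add: shear_add)

section \<open>Schubert varieties of hooks\<close>

locale hook_schubert =
  fixes n d x y :: nat and w :: "nat \<Rightarrow> nat"
  assumes d: "1 \<le> d" "d < n" and w: "w \<in> min_coset_reps n d" and hook: "is_hook d x y w"
begin

abbreviation (input) X where "X \<equiv> Schubert n d w"

text \<open>Columns \<open>l\<close> to d - 1 and rows \<open>d\<close> to t - 1, counted from 0,
  form the block of y + 1 columns and x rows outside which the coordinates of X in the chart
  vanish.\<close>

definition l where "l = d - 1 - y"
definition t where "t = d + x"

text \<open>The coordinates \<open>z\<^sub>i\<close> with \<open>d \<le> i < t\<close> and those with \<open>l \<le> i < d\<close> are the two factors of
  a matrix of rank at most one.\<close>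

definition \<sigma> :: "(nat \<Rightarrow> complex) \<Rightarrow> complex mat" where
  "\<sigma> z = lower_unipotent n d (\<lambda>i j. if i < t \<and> l \<le> j then z i * z j else 0)"

lemma dn: "d \<le> n" using d by simp

lemma perm: "w permutes {1..n}"
  using w by (simp add: min_coset_reps_def)

lemma bounds: "l < d" "t \<le> n" "d \<le> t" "t = d \<Longrightarrow> l = d - 1"
proof -
  have "x \<le> n - d" using hook_bound [OF w d(1) _ hook] d by simp
  moreover have "x = 0 \<longrightarrow> y = 0" using hook unfolding is_hook_def by blast
  ultimately show "l < d" "t \<le> n" "d \<le> t" "t = d \<Longrightarrow> l = d - 1"
    unfolding l_def t_def using d by auto
qed

lemma hook_col_index:
  assumes "k < d"
  shows "col_index w k = (if k < l then k else if k < d - 1 then Suc k else t - 1)"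
proof -
  have "Suc k \<in> {1..d}" using assms by auto
  then have "w (Suc k) = (if Suc k < d - y then Suc k else if Suc k < d then Suc k + 1 else d + x)"
    using hook unfolding is_hook_def by blast
  then show ?thesis using assms d by (auto simp: col_index_def l_def t_def)
qed

lemma \<sigma>_SL: "\<sigma> z \<in> carrier (SL n)"
  by (simp add: \<sigma>_def lower_unipotent_SL)

lemma \<sigma>_index: "i < n \<Longrightarrow> j < n \<Longrightarrow> \<sigma> z $$ (i, j) =
    (if i = j then 1 else if d \<le> i \<and> i < t \<and> l \<le> j \<and> j < d then z i * z j else 0)"
  by (auto simp: \<sigma>_def)

lemma lead_minor_\<sigma>: "lead_minor d (\<sigma> z) = 1"
  using dn by (simp add: \<sigma>_def)

text \<open>All but the last of the first \<open>d\<close> columns of \<open>b m\<close> lie in the span of the first \<open>d\<close> basis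
  vectors, so \<open>c\<close> has a single nonzero column and \<open>c a\<inverse>\<close> has rank at most one.\<close>

lemma normal_form_cell:
  assumes b: "b \<in> Borel n" and m: "m \<in> weyl_coset n w" and lead: "lead_minor d (b * m) \<noteq> 0"
  shows "\<exists>z. normal_form n d (b * m) = \<sigma> z"
proof -
  let ?g = "b * m" and ?adj = "adj_mat (row_block d id (b * m))"
  have bc: "b \<in> carrier_mat n n" using b Borel_SL SL_dim(1) by blast
  have tri: "b $$ (i, j) = 0" if "j < i" "i < n" for i j
    using b bc that by (auto simp: Borel_def upper_triangular_def)
  have g: "?g $$ (i, k) = b $$ (i, col_index w k) * m $$ (col_index w k, k)" if "i < n" "k < d" for i k
    using mult_weyl_coset_index [OF bc m perm] that dn by simp
  have g_low: "?g $$ (i, k) = 0" if "d \<le> i" "i < n" "k < d - 1" for i k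
    using g [of i k] tri [of "col_index w k" i] hook_col_index [of k] that by auto
  have g_last: "?g $$ (i, d - 1) = 0" if "t \<le> i" "i < n" for i
    using g [of i "d - 1"] tri [of "t - 1" i] hook_col_index [of "d - 1"] that bounds d by auto
  have diag: "b $$ (k, k) \<noteq> 0" if "k < n" for k
  proof -
    have "prod_list (diag_mat b) = 1"
      using b bc det_upper_triangular [of b n] by (simp add: Borel_def carrier_SL)
    then have "0 \<notin> set (diag_mat b)" using prod_list_zero_iff [of "diag_mat b"] by auto
    then show ?thesis using that bc by (auto simp: diag_mat_def)
  qed
  have g_diag: "?g $$ (k, k) \<noteq> 0" if "k < l" for k
    using g [of k k] diag [of k] weyl_coset_index [OF m perm, of k k] hook_col_index [of k] that bounds dn
    by auto
  have g_tri: "?g $$ (j, k) = 0" if "k < j" "j < n" "k < l" for j k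
    using g [of j k] tri [of k j] hook_col_index [of k] that bounds by auto
  \<comment> \<open>Only the last column of the lower part survives, so the coordinate matrix is
    that column times the last row of the inverse of the upper part, which is \<open>v\<close> up to
    the determinant. This row is orthogonal to the columns k < l, which are triangular with nonzero
    diagonal; hence its first \<open>l\<close> entries vanish one after the other.\<close>
  define v where "v j = ?adj $$ (d - 1, j)" for j
  have v: "v k = 0" if "k < l" for k
    using that
  proof (induction k rule: less_induct)
    case (less k)
    have "(\<Sum>j<d. v j * ?g $$ (j, k)) = 0"
      unfolding v_def using less.prems bounds d by (subst adj_row_block(2)) auto
    moreover have "(\<Sum>j<d. v j * ?g $$ (j, k)) = (\<Sum>j\<in>{k}. v j * ?g $$ (j, k))"
    proof (intro sum.mono_neutral_right ballI)
      fix j assume "j \<in> {..<d} - {k}"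
      then show "v j * ?g $$ (j, k) = 0"
        using less g_tri [of k j] bounds dn by (cases "j < k") auto
    qed (use less.prems bounds in auto)
    ultimately show ?case using g_diag less.prems by simp
  qed
  define z where "z i = (if i < d then v i / lead_minor d ?g else ?g $$ (i, d - 1))" for i
  have "normal_form n d ?g = \<sigma> z"
    unfolding normal_form_def \<sigma>_def
  proof (rule lower_unipotent_cong)
    fix i j assume ij: "d \<le> i" "i < n" "j < d"
    have "chart_coord_num d ?g i j = (\<Sum>k\<in>{d - 1}. ?g $$ (i, k) * ?adj $$ (k, j))"
      unfolding chart_coord_num_def using ij d g_low by (intro sum.mono_neutral_right) auto
    then have "chart_coord d ?g i j = z i * z j"
      using ij by (simp add: chart_coord_def z_def v_def)
    moreover have "z i = 0" if "\<not> i < t" using that ij g_last by (simp add: z_def)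
    moreover have "z j = 0" if "\<not> l \<le> j" using that ij v by (simp add: z_def)
    ultimately show "chart_coord d ?g i j = (if i < t \<and> l \<le> j then z i * z j else 0)" by auto
  qed
  then show ?thesis by blast
qed

text \<open>By \<open>normal_form_cell\<close> the chart points of the cell have the form
  \<open>\<sigma> z\<close>, and X is the closure of the cell, so an equation satisfied by all
  \<open>\<sigma> z\<close> extends to X.\<close>

lemma vanish_on_chart:
  assumes f: "f \<in> poly_funs n" "\<And>z. f (\<sigma> z) = 0"
    and g: "g \<in> carrier (SL n)" "proj n d g \<in> X" "lead_minor d g \<noteq> 0"
  shows "f (normal_form n d g) = 0"
proof (rule ccontr)
  assume "f (normal_form n d g) \<noteq> 0"
  have one: "1\<^sub>m n \<in> carrier (SL n)" by (simp add: carrier_SL)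
  have one_mult: "1\<^sub>m n * h = h" if "h \<in> carrier (SL n)" for h
    using SL_dim(1) [OF that] by simp
  obtain U where U: "openin (GP_zariski n d) U"
    "\<And>g. g \<in> carrier (SL n) \<Longrightarrow> proj n d g \<in> U \<longleftrightarrow>
      lead_minor d (1\<^sub>m n * g) \<noteq> 0 \<and> f (normal_form n d (1\<^sub>m n * g)) \<noteq> 0"
    using chart_nonzero_open [OF dn f(1) one] by blast
  have "proj n d g \<in> U"
    using U(2) [OF g(1)] g \<open>f (normal_form n d g) \<noteq> 0\<close> one_mult by simp
  then obtain c where "c \<in> cell n d w" "c \<in> U"
    using g(2) U(1) unfolding Schubert_def in_closure_of by blast
  then obtain b m where bm: "b \<in> Borel n" "m \<in> weyl_coset n w" "proj n d (b * m) \<in> U"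
    by blast
  have "b * m \<in> carrier (SL n)" using Borel_SL [OF bm(1)] weyl_coset_SL [OF bm(2)] by blast
  then have "lead_minor d (b * m) \<noteq> 0" "f (normal_form n d (b * m)) \<noteq> 0"
    using U(2) bm(3) one_mult by auto
  then show False using normal_form_cell [OF bm(1,2)] f(2) by metis
qed

text \<open>Zeros outside the block and vanishing 2 by 2 minors are closed conditions, which
  \<open>vanish_on_chart\<close> provides. A nonzero entry then splits the matrix into the column
  and the row through it, up to scaling.\<close>

lemma normal_form_Schubert:
  assumes g: "g \<in> carrier (SL n)" "proj n d g \<in> X" "lead_minor d g \<noteq> 0"
  shows "\<exists>z. normal_form n d g = \<sigma> z"
proof -
  let ?M = "chart_coord d g"
  have nf: "normal_form n d g $$ (i, j) = ?M i j" if "d \<le> i" "i < n" "j < d" for i j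
    using that dn by (simp add: normal_form_def)
  have supp: "?M i j = 0" if "d \<le> i" "i < n" "j < d" "\<not> (i < t \<and> l \<le> j)" for i j
  proof -
    have "(\<lambda>g. g $$ (i, j)) (normal_form n d g) = 0"
      by (rule vanish_on_chart [OF _ _ g])
        (use that dn in \<open>auto intro!: poly_funs.entry simp: \<sigma>_index\<close>)
    then show ?thesis using nf that by simp
  qed
  have rank: "?M i j * ?M i' j' = ?M i j' * ?M i' j"
    if "d \<le> i" "i < n" "j < d" "d \<le> i'" "i' < n" "j' < d" for i j i' j'
  proof -
    have "(\<lambda>g. g $$ (i, j) * g $$ (i', j') - g $$ (i, j') * g $$ (i', j)) (normal_form n d g) = 0"
      by (rule vanish_on_chart [OF _ _ g])
        (use that dn in \<open>auto intro!: poly_funs_diff poly_funs.mult poly_funs.entry simp: \<sigma>_index\<close>)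
    then show ?thesis using nf that by simp
  qed
  show ?thesis
  proof (cases "\<exists>i j. d \<le> i \<and> i < n \<and> j < d \<and> ?M i j \<noteq> 0")
    case False
    have "normal_form n d g = \<sigma> (\<lambda>_. 0)"
      unfolding normal_form_def \<sigma>_def using False by (intro lower_unipotent_cong) auto
    then show ?thesis by blast
  next
    case True
    then obtain i0 j0 where ij0: "d \<le> i0" "i0 < n" "j0 < d" "?M i0 j0 \<noteq> 0" by blast
    define z where "z i = (if i < d then ?M i0 i / ?M i0 j0 else ?M i j0)" for i
    have "normal_form n d g = \<sigma> z"
      unfolding normal_form_def \<sigma>_def
    proof (rule lower_unipotent_cong)
      fix i j assume ij: "d \<le> i" "i < n" "j < d"
      then have "?M i j * ?M i0 j0 = ?M i j0 * ?M i0 j" using rank ij0 by blast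
      then have "?M i j = z i * z j" using ij ij0 by (simp add: z_def field_simps)
      then show "?M i j = (if i < t \<and> l \<le> j then z i * z j else 0)" using supp ij by auto
    qed
    then show ?thesis by blast
  qed
qed

text \<open>The span of the first \<open>d\<close> columns of \<open>\<sigma> z\<close> contains
  \<open>e\<^sub>j - (z\<^sub>j / z\<^sub>l) e\<^sub>l\<close> for \<open>l < j < d\<close> and \<open>e\<^sub>l / (z\<^sub>l z\<^bsub>t-1\<^esub>) + \<Sum>\<^sub>i (z\<^sub>i / z\<^bsub>t-1\<^esub>) e\<^sub>i\<close>;
  these vectors are the columns of \<open>b\<close> below.\<close>

lemma \<sigma>_cell:
  assumes z: "\<And>i. z i \<noteq> 0"
  shows "proj n d (\<sigma> z) \<in> cell n d w"
proof -
  obtain m where m: "m \<in> weyl_coset n w" "\<And>j. j < d \<Longrightarrow> m $$ (col_index w j, j) = 1"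
    using weyl_coset_rep [OF perm d(2)] by blast
  define b where "b = unipotent n (\<lambda>i j.
      if j < d then if i = l \<and> l < j then - z j / z l else 0
      else if j = t - 1 then if i = l then 1 / (z l * z j) else if d \<le> i then z i / z j else 0
      else 0)"
  \<comment> \<open>For t = d the block is empty and the last pivot column is a basis vector.
    Otherwise this factor turns the entries z_i / z_{t-1} of the last column into z_i z_j.\<close>
  define \<kappa> where "\<kappa> j = (if t = d then 1 else z j * z (t - 1))" for j
  have b: "b \<in> Borel n" unfolding b_def by (rule unipotent_Borel)
  have g: "(b * m) $$ (i, k) = b $$ (i, col_index w k)" if "i < n" "k < d" for i k
    using mult_weyl_coset_index [OF SL_dim(1) [OF Borel_SL [OF b]] m(1) perm, of i k] that m(2) dn by simp
  \<comment> \<open>The pivots skip row \<open>l\<close>, so for l < j < d column \<open>j\<close>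
    of \<open>b\<close> is column j - 1 of \<open>b * m\<close>. If t > d, the last column adds the
    lower entries and cancels the entry in row \<open>l\<close>; for j = l it gives the column
    alone.\<close>
  define A where "A k j = (if j < l then if k = j then 1 else 0
      else (if l < j \<and> k = j - 1 then 1 else 0) + (if k = d - 1 then \<kappa> j else 0))" for k j
  have "proj n d (\<sigma> z) = proj n d (b * m)"
  proof (rule proj_eqI [OF dn _ \<sigma>_SL])
    show "b * m \<in> carrier (SL n)" using Borel_SL [OF b] weyl_coset_SL [OF m(1)] by blast
    fix i j assume ij: "i < n" "j < d"
    show "\<sigma> z $$ (i, j) = (\<Sum>k<d. (b * m) $$ (i, k) * A k j)"
    proof (cases "j < l")
      case True
      have "(\<Sum>k<d. (b * m) $$ (i, k) * A k j) = (\<Sum>k<d. if k = j then (b * m) $$ (i, j) else 0)"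
        using True by (intro sum.cong) (auto simp: A_def)
      also have "\<dots> = b $$ (i, j)" using ij g hook_col_index [of j] True by simp
      also have "\<dots> = \<sigma> z $$ (i, j)" using ij dn True by (auto simp: b_def \<sigma>_index)
      finally show ?thesis by simp
    next
      case False
      have "(\<Sum>k<d. (b * m) $$ (i, k) * A k j) =
          (\<Sum>k<d. (if l < j \<and> k = j - 1 then (b * m) $$ (i, j - 1) else 0) +
            (if k = d - 1 then (b * m) $$ (i, d - 1) * \<kappa> j else 0))"
        using False by (intro sum.cong) (auto simp: A_def distrib_left)
      also have "\<dots> = (if l < j then (b * m) $$ (i, j - 1) else 0) + (b * m) $$ (i, d - 1) * \<kappa> j"
        using ij d by (auto simp: sum.distrib)
      also have "\<dots> = (if l < j then b $$ (i, j) else 0) + b $$ (i, t - 1) * \<kappa> j"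
        using ij d False hook_col_index [of "j - 1"] hook_col_index [of "d - 1"] g bounds by auto
      also have "\<dots> = \<sigma> z $$ (i, j)"
      proof (cases "t = d")
        case True
        then have "j = d - 1" "l = d - 1" using bounds ij False by auto
        then show ?thesis using True ij d by (auto simp: b_def \<sigma>_index \<kappa>_def)
      next
        case t: False
        have t1: "t - 1 < n" "d \<le> t - 1" "l < t - 1" using bounds t by auto
        have bt: "b $$ (i, t - 1) * \<kappa> j = (if i = l then z j / z l
            else if d \<le> i \<and> i < t then z i * z j else 0)"
          using t t1 ij z by (auto simp: b_def \<kappa>_def)
        have bj: "b $$ (i, j) = (if i = j then 1 else if i = l then - z j / z l else 0)" if "l < j"
          using that ij dn by (auto simp: b_def)
        show ?thesis
          unfolding bt using bj ij dn False z bounds by (auto simp: \<sigma>_index)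
      qed
      finally show ?thesis by simp
    qed
  qed
  then show ?thesis using b m(1) by blast
qed

section \<open>Density of the torus orbit\<close>

lemma poly_path_\<sigma>: "poly_path n (\<lambda>s. \<sigma> (\<lambda>i. a i + s * c i))"
  unfolding poly_path_def
proof (intro allI impI)
  fix i j assume ij: "i < n" "j < n"
  show "\<exists>q. \<forall>s. \<sigma> (\<lambda>i. a i + s * c i) $$ (i, j) = poly q s"
    using ij by (intro exI [of _ "if i = j then 1 else if d \<le> i \<and> i < t \<and> l \<le> j \<and> j < d
      then [:a i, c i:] * [:a j, c j:] else 0"]) (auto simp: \<sigma>_index algebra_simps)
qed

lemma \<sigma>_cong:
  "(\<And>i. l \<le> i \<Longrightarrow> i < t \<Longrightarrow> z i = z' i) \<Longrightarrow> \<sigma> z = \<sigma> z'"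
  unfolding \<sigma>_def using bounds by (intro lower_unipotent_cong) auto

text \<open>All coordinates below \<open>t\<close> are shifted by a common \<open>s\<close>; those
  from \<open>t\<close> on do not enter \<open>\<sigma>\<close> and are set to 1. The factor
  \<open>p\<close> allows \<open>f\<close> to be tested at a prescribed representative.\<close>

lemma \<sigma>_perturb:
  assumes f: "f \<in> poly_funs n" "f (\<sigma> z * p) \<noteq> 0" and p: "p \<in> carrier_mat n n"
  obtains z' where "\<And>i. z' i \<noteq> 0" "f (\<sigma> z' * p) \<noteq> 0"
proof -
  have path: "poly_path n (\<lambda>s. \<sigma> (\<lambda>i. z i + s * 1) * p)"
    using SL_dim(1) [OF \<sigma>_SL] p by (intro poly_path_mult poly_path_\<sigma> poly_path_const)
  have "finite ((\<lambda>i. - z i) ` {..<t})" by simp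
  then obtain s where s: "s \<notin> (\<lambda>i. - z i) ` {..<t}" "f (\<sigma> (\<lambda>i. z i + s * 1) * p) \<noteq> 0"
    using poly_path_generic [OF path f(1) f(1), of 0 0 "(\<lambda>i. - z i) ` {..<t}"] f(2) by auto
  define z' where "z' i = (if i < t then z i + s else 1)" for i
  have "z i + s \<noteq> 0" if "i < t" for i
  proof
    assume "z i + s = 0"
    then have "s = - z i" by (simp add: eq_neg_iff_add_eq_0 add.commute)
    then show False using s(1) that by blast
  qed
  then have "z' i \<noteq> 0" for i by (simp add: z'_def)
  moreover have "\<sigma> z' = \<sigma> (\<lambda>i. z i + s * 1)" by (rule \<sigma>_cong) (simp add: z'_def)
  ultimately show thesis using that s(2) by metis
qed

lemma \<sigma>_mult_one: "\<sigma> z * 1\<^sub>m n = \<sigma> z"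
  by (rule right_mult_one_mat [OF SL_dim(1) [OF \<sigma>_SL]])

lemma \<sigma>_Schubert: "proj n d (\<sigma> z) \<in> X"
  unfolding Schubert_def
proof (rule closure_of_GPI [OF \<sigma>_SL])
  fix f assume f: "f \<in> poly_funs n" "f (\<sigma> z) \<noteq> 0"
  then obtain z' where "\<And>i. z' i \<noteq> 0" "f (\<sigma> z') \<noteq> 0"
    using \<sigma>_perturb [of f z "1\<^sub>m n"] unfolding \<sigma>_mult_one by auto
  then show "\<exists>h\<in>carrier (SL n). f h \<noteq> 0 \<and> proj n d h \<in> cell n d w"
    using \<sigma>_SL \<sigma>_cell by blast
qed

lemma nth_root_complex:
  assumes "c \<noteq> 0" "0 < n"
  obtains \<kappa> :: complex where "\<kappa> ^ n = c"
proof
  show "rcis (root n (cmod c)) (Arg c / n) ^ n = c"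
    using assms by (simp add: DeMoivre2 rcis_cmod_Arg)
qed

text \<open>Conjugation by a diagonal matrix multiplies the entry (i, j) by e_i / e_j; with e_i =
  z_i in the rows of the block and e_j = 1 / z_j in its columns this is z_i z_j. The scalar \<kappa>
  restores determinant 1, and the diagonal factor left on the right lies in P.\<close>

lemma torus_\<sigma>:
  assumes z: "\<And>i. z i \<noteq> 0"
  obtains a where "a \<in> Torus n" "proj n d (a * \<sigma> (\<lambda>_. 1)) = proj n d (\<sigma> z)"
proof -
  define e where "e i = (if i < l then 1 else if i < d then 1 / z i else z i)" for i
  have e: "e i \<noteq> 0" for i using z by (simp add: e_def)
  then have "(\<Prod>i<n. e i) \<noteq> 0" by simp
  then obtain \<kappa> where \<kappa>: "\<kappa> ^ n = 1 / (\<Prod>i<n. e i)"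
    using nth_root_complex [of "1 / (\<Prod>i<n. e i)"] d by auto
  define a where "a = mat n n (\<lambda>(i, j). if i = j then \<kappa> * e i else 0)"
  have "det a = (\<Prod>i<n. \<kappa> * e i)"
    unfolding a_def by (subst det_upper_triangular [of _ n])
      (auto simp: diag_mat_def atLeast0LessThan prod.distinct_set_conv_list [symmetric] cong: map_cong)
  also have "\<dots> = 1" using \<kappa> \<open>(\<Prod>i<n. e i) \<noteq> 0\<close> by (simp add: prod.distrib)
  finally have a: "a \<in> Torus n"
    by (auto simp: Torus_def carrier_SL a_def diagonal_mat_def)
  have aP: "a \<in> Parabolic n d"
    using Torus_SL [OF a] dn by (auto simp: Parabolic_def a_def)
  have carr: "a \<in> carrier_mat n n" "\<And>z. \<sigma> z \<in> carrier_mat n n"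
    using SL_dim(1) Torus_SL [OF a] \<sigma>_SL by auto
  have "a * \<sigma> (\<lambda>_. 1) = \<sigma> z * a"
  proof (rule eq_matI)
    fix i j assume "i < dim_row (\<sigma> z * a)" "j < dim_col (\<sigma> z * a)"
    then have ij: "i < n" "j < n" using carr(1) carr(2) [of z] by auto
    have "(\<sigma> z * a) $$ (i, j) = (\<Sum>k<n. \<sigma> z $$ (i, k) * a $$ (k, j))"
      using index_mult_sum [OF carr(2,1) ij] .
    also have "\<dots> = (\<Sum>k<n. if k = j then \<sigma> z $$ (i, j) * (\<kappa> * e j) else 0)"
      using ij by (intro sum.cong) (auto simp: a_def)
    also have "\<dots> = \<sigma> z $$ (i, j) * (\<kappa> * e j)" using ij by simp
    also have "\<dots> = (\<kappa> * e i) * \<sigma> (\<lambda>_. 1) $$ (i, j)"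
      using ij z by (auto simp: \<sigma>_index e_def)
    also have "\<dots> = (a * \<sigma> (\<lambda>_. 1)) $$ (i, j)"
      using Torus_mult_index [OF a carr(2) ij] ij by (simp add: a_def)
    finally show "(a * \<sigma> (\<lambda>_. 1)) $$ (i, j) = (\<sigma> z * a) $$ (i, j)" by simp
  qed (use carr(1) carr(2) [of z] carr(2) [of "\<lambda>_. 1"] in auto)
  then have "proj n d (a * \<sigma> (\<lambda>_. 1)) = proj n d (\<sigma> z)"
    using proj_mult_Parabolic [OF dn \<sigma>_SL aP] by simp
  with a show thesis by (rule that)
qed

abbreviation "x0 \<equiv> proj n d (\<sigma> (\<lambda>_. 1))"

text \<open>A point of \<open>X\<close> is moved into the chart by a curve of shears, and then, within the chart,
  to a point with nonzero coordinates.\<close>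

lemma Schubert_subset_closure_orbit: "X \<subseteq> (GP_zariski n d) closure_of torus_orbit n x0"
proof
  fix x assume x: "x \<in> X"
  then have "x \<in> GP n d" using Schubert_subset_GP by blast
  then obtain g where g: "g \<in> carrier (SL n)" "x = proj n d g"
    unfolding GP_eq by blast
  show "x \<in> (GP_zariski n d) closure_of torus_orbit n x0"
    unfolding g(2)
  proof (rule closure_of_GPI [OF g(1)])
    fix f assume f: "f \<in> poly_funs n" "f g \<noteq> 0"
    obtain N where N: "lead_minor d (shear n d N * g) \<noteq> 0"
      using shear_into_chart [OF dn g(1)] .
    let ?\<gamma> = "\<lambda>s. shear n d (\<lambda>i j. s * N i j) * g"
    have path: "poly_path n ?\<gamma>"
      using SL_dim(1) [OF Borel_SL [OF shear_Borel]] SL_dim(1) [OF g(1)]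
      by (intro poly_path_mult poly_path_shear poly_path_const)
    have "f (?\<gamma> 0) \<noteq> 0" "lead_minor d (?\<gamma> 1) \<noteq> 0"
      using f(2) N SL_dim(1) [OF g(1)] by simp_all
    then obtain s where s: "f (?\<gamma> s) \<noteq> 0" "lead_minor d (?\<gamma> s) \<noteq> 0"
      using poly_path_generic [OF path f(1) lead_minor_poly_funs [OF dn], of 0 1 "{}"] by auto
    have \<gamma>: "?\<gamma> s \<in> carrier (SL n)" using Borel_SL [OF shear_Borel] g(1) by blast
    have "proj n d (?\<gamma> s) \<in> X"
      using Schubert_translate [OF dn shear_Borel g(1)] x g(2) by simp
    then obtain z where z: "normal_form n d (?\<gamma> s) = \<sigma> z"
      using normal_form_Schubert [OF \<gamma>] s(2) by blast
    then have "proj n d (?\<gamma> s) = proj n d (\<sigma> z)"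
      using proj_normal_form [OF dn \<gamma> s(2)] by simp
    \<comment> \<open>The function \<open>f\<close> is not assumed invariant under P, so the
      representative is recorded: it is \<open>\<sigma> z * p\<close> that is perturbed.\<close>
    then obtain p where p: "p \<in> Parabolic n d" "?\<gamma> s = \<sigma> z * p"
      using proj_eq_iff [OF dn \<sigma>_SL \<gamma>] by blast
    obtain z' where z': "\<And>i. z' i \<noteq> 0" "f (\<sigma> z' * p) \<noteq> 0"
      using \<sigma>_perturb [OF f(1), of z p] s(1) p SL_dim(1) [OF ParabolicD(1) [OF p(1)]] by metis
    obtain a where a: "a \<in> Torus n" "proj n d (a * \<sigma> (\<lambda>_. 1)) = proj n d (\<sigma> z')"
      using z'(1) by (rule torus_\<sigma> [where z = z'])
    have "proj n d (\<sigma> z' * p) = a <#\<^bsub>SL n\<^esub> x0"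
      using a(2) proj_mult_Parabolic [OF dn \<sigma>_SL p(1)] l_coset_proj [OF dn Torus_SL [OF a(1)] \<sigma>_SL]
      by simp
    then have "proj n d (\<sigma> z' * p) \<in> torus_orbit n x0"
      unfolding torus_orbit_def using a(1) by (rule image_eqI)
    then show "\<exists>h\<in>carrier (SL n). f h \<noteq> 0 \<and> proj n d h \<in> torus_orbit n x0"
      using z'(2) SL_mult_closed [OF \<sigma>_SL ParabolicD(1) [OF p(1)]] by blast
  qed
qed

text \<open>T lies in B and scales \<open>lead_minor\<close> by a nonzero factor, so it preserves
  both X and the chart.\<close>

lemma torus_orbit_\<sigma>:
  assumes "a \<in> Torus n"
  shows "\<exists>z. proj n d (a * \<sigma> (\<lambda>_. 1)) = proj n d (\<sigma> z)"
proof -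
  have "proj n d (a * \<sigma> (\<lambda>_. 1)) \<in> X"
  proof (rule Schubert_translate [OF dn _ \<sigma>_SL \<sigma>_Schubert])
    show "a \<in> Borel n"
      using assms SL_dim [OF Torus_SL [OF assms]]
      by (auto simp: Borel_def Torus_def diagonal_mat_def upper_triangular_def)
  qed
  moreover have aS: "a * \<sigma> (\<lambda>_. 1) \<in> carrier (SL n)" using Torus_SL [OF assms] \<sigma>_SL by blast
  moreover have "lead_minor d (a * \<sigma> (\<lambda>_. 1)) \<noteq> 0"
  proof -
    have "a $$ (i, i) \<noteq> 0" if "i < n" for i
    proof -
      have "prod_list (diag_mat a) = 1"
        using assms SL_dim [OF Torus_SL [OF assms]] det_upper_triangular [of a n]
        by (auto simp: Torus_def carrier_SL diagonal_mat_def upper_triangular_def)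
      then have "0 \<notin> set (diag_mat a)" using prod_list_zero_iff [of "diag_mat a"] by auto
      then show ?thesis using that SL_dim [OF Torus_SL [OF assms]] by (auto simp: diag_mat_def)
    qed
    then show ?thesis
      using minor_Torus_mult [OF assms SL_dim(1) [OF \<sigma>_SL] dn, of id "\<lambda>_. 1"] lead_minor_\<sigma> dn
      by (simp add: lead_minor_def)
  qed
  ultimately show ?thesis
    using normal_form_Schubert proj_normal_form [OF dn aS] by metis
qed

text \<open>The torus orbit of \<open>x0\<close> is dense in X and consists of points given by some
  \<open>\<sigma> z\<close>.\<close>

lemma open_meets_\<sigma>:
  assumes "openin (GP_zariski n d) U" "U \<inter> X \<noteq> {}"
  shows "\<exists>z. proj n d (\<sigma> z) \<in> U"
proof -
  obtain u where u: "u \<in> U" "u \<in> X" using assms(2) by blast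
  then have "u \<in> (GP_zariski n d) closure_of torus_orbit n x0"
    using Schubert_subset_closure_orbit by blast
  then obtain v where "v \<in> torus_orbit n x0" "v \<in> U"
    using assms(1) u(1) unfolding in_closure_of by blast
  then obtain a where "a \<in> Torus n" "v = proj n d (a * \<sigma> (\<lambda>_. 1))"
    using l_coset_proj [OF dn Torus_SL \<sigma>_SL] by (auto simp: torus_orbit_def)
  then show ?thesis using torus_orbit_\<sigma> \<open>v \<in> U\<close> by metis
qed

text \<open>The line from \<open>z1\<close> to \<open>z2\<close> is mapped by
  \<open>\<sigma>\<close> to a polynomial curve. This yields irreducibility of X.\<close>

lemma poly_funs_\<sigma>_nonzero:
  assumes "f1 \<in> poly_funs n" "f2 \<in> poly_funs n" "f1 (\<sigma> z1) \<noteq> 0" "f2 (\<sigma> z2) \<noteq> 0"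
  shows "\<exists>z. f1 (\<sigma> z) \<noteq> 0 \<and> f2 (\<sigma> z) \<noteq> 0"
proof -
  let ?\<gamma> = "\<lambda>s. \<sigma> (\<lambda>i. z1 i + s * (z2 i - z1 i))"
  have path: "poly_path n ?\<gamma>" by (rule poly_path_\<sigma>)
  have "f1 (?\<gamma> 0) \<noteq> 0" "f2 (?\<gamma> 1) \<noteq> 0" using assms by simp_all
  then obtain s where "f1 (?\<gamma> s) \<noteq> 0" "f2 (?\<gamma> s) \<noteq> 0"
    using poly_path_generic [OF path assms(1,2), of 0 1 "{}"] by blast
  then show ?thesis by blast
qed

lemma opens_meet:
  assumes "openin (GP_zariski n d) U" "U \<inter> X \<noteq> {}" "openin (GP_zariski n d) V" "V \<inter> X \<noteq> {}"
  shows "U \<inter> V \<inter> X \<noteq> {}"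
proof -
  obtain z1 z2 where z: "proj n d (\<sigma> z1) \<in> U" "proj n d (\<sigma> z2) \<in> V"
    using open_meets_\<sigma> assms by metis
  obtain f1 where f1: "f1 \<in> poly_funs n" "f1 (\<sigma> z1) \<noteq> 0"
    "\<And>h. h \<in> carrier (SL n) \<Longrightarrow> f1 h \<noteq> 0 \<Longrightarrow> proj n d h \<in> U"
    using GP_open_nhd [OF assms(1) \<sigma>_SL z(1)] by blast
  obtain f2 where f2: "f2 \<in> poly_funs n" "f2 (\<sigma> z2) \<noteq> 0"
    "\<And>h. h \<in> carrier (SL n) \<Longrightarrow> f2 h \<noteq> 0 \<Longrightarrow> proj n d h \<in> V"
    using GP_open_nhd [OF assms(3) \<sigma>_SL z(2)] by blast
  obtain z where "f1 (\<sigma> z) \<noteq> 0" "f2 (\<sigma> z) \<noteq> 0"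
    using poly_funs_\<sigma>_nonzero f1(1,2) f2(1,2) by blast
  then show ?thesis using f1(3) f2(3) \<sigma>_SL \<sigma>_Schubert by blast
qed

lemma topspace_Schubert: "topspace (subtopology (GP_zariski n d) X) = X"
  using Schubert_subset_GP [of n d w] by (auto simp: topspace_subtopology topspace_GP)

lemma irreducible_Schubert: "irreducible_space (subtopology (GP_zariski n d) X)"
  unfolding irreducible_space_def topspace_Schubert
proof (intro conjI allI impI)
  show "X \<noteq> {}" using \<sigma>_Schubert by blast
  fix C D
  assume *: "closedin (subtopology (GP_zariski n d) X) C \<and>
    closedin (subtopology (GP_zariski n d) X) D \<and> X = C \<union> D"
  have "\<exists>U. openin (GP_zariski n d) U \<and> X - E = U \<inter> X"
    if "closedin (subtopology (GP_zariski n d) X) E" for E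
    using that unfolding closedin_def topspace_Schubert openin_subtopology by auto
  then obtain U V where U: "openin (GP_zariski n d) U" "X - C = U \<inter> X"
    and V: "openin (GP_zariski n d) V" "X - D = V \<inter> X"
    using * by metis
  have "U \<inter> V \<inter> X = {}" using * U(2) V(2) by blast
  then have "U \<inter> X = {} \<or> V \<inter> X = {}" using opens_meet [OF U(1) _ V(1)] by blast
  then show "C = X \<or> D = X" using * U(2) V(2) by blast
qed

lemma dense_torus_orbit:
  "\<exists>x\<in>X. torus_orbit n x \<subseteq> X \<and> X \<subseteq> (GP_zariski n d) closure_of torus_orbit n x"
proof (intro bexI conjI)
  show "X \<subseteq> (GP_zariski n d) closure_of torus_orbit n x0" by (rule Schubert_subset_closure_orbit)
  show "x0 \<in> X" by (rule \<sigma>_Schubert)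
  show "torus_orbit n x0 \<subseteq> X"
  proof
    fix v assume "v \<in> torus_orbit n x0"
    then obtain a where "a \<in> Torus n" "v = proj n d (a * \<sigma> (\<lambda>_. 1))"
      using l_coset_proj [OF dn Torus_SL \<sigma>_SL] by (auto simp: torus_orbit_def)
    then show "v \<in> X" using torus_orbit_\<sigma> \<sigma>_Schubert by metis
  qed
qed

end

section \<open>Normality\<close>

context hook_schubert
begin

text \<open>The exponents of the monomials invariant under the one-dimensional torus that scales the
  z_i with d \<le> i by a number and those with i < d by its inverse; these monomials span the
  coordinate ring of the matrices of rank at most one.\<close>

definition balanced :: "(nat \<Rightarrow>\<^sub>0 nat) set" where
  "balanced = {\<alpha>. keys \<alpha> \<subseteq> {l..<t} \<and>
     (\<Sum>i\<in>{d..<t}. lookup \<alpha> i) = (\<Sum>i\<in>{l..<d}. lookup \<alpha> i)}"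

sublocale saturated_monoid balanced t
proof
  show "0 \<in> balanced" by (simp add: balanced_def)
  show "\<alpha> + \<beta> \<in> balanced" if "\<alpha> \<in> balanced" "\<beta> \<in> balanced" for \<alpha> \<beta>
    using that keys_add [of \<alpha> \<beta>] by (auto simp: balanced_def lookup_add sum.distrib)
  show "\<beta> \<in> balanced" if "\<alpha> + \<beta> \<in> balanced" "\<alpha> \<in> balanced" for \<alpha> \<beta>
  proof -
    have "keys \<beta> \<subseteq> keys (\<alpha> + \<beta>)" by (auto simp: in_keys_iff lookup_add)
    then show ?thesis using that by (auto simp: balanced_def lookup_add sum.distrib)
  qed
  show "keys \<alpha> \<subseteq> {..<t}" if "\<alpha> \<in> balanced" for \<alpha>
    using that by (auto simp: balanced_def)
qed

lemma poly_funs_imp_peval: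
  assumes "f \<in> poly_funs n"
  shows "\<exists>P. supp_in P \<and> (\<forall>z. peval P z = f (\<sigma> z))"
  using assms
proof induction
  case (const c)
  show ?case by (intro exI [of _ "Poly_Mapping.single 0 c"]) (simp add: supp_in_single zero_mem)
next
  case (entry i j)
  consider "i = j \<or> \<not> (d \<le> i \<and> i < t \<and> l \<le> j \<and> j < d)" | "i \<noteq> j" "d \<le> i" "i < t" "l \<le> j" "j < d"
    by blast
  then show ?case
  proof cases
    case 1
    show ?thesis
      using 1 entry
      by (intro exI [of _ "Poly_Mapping.single 0 (if i = j then 1 else 0)"])
        (auto simp: supp_in_0 supp_in_1 \<sigma>_index)
  next
    case 2
    let ?\<alpha> = "Poly_Mapping.single i 1 + Poly_Mapping.single j 1 :: nat \<Rightarrow>\<^sub>0 nat"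
    have lk: "lookup ?\<alpha> k = (if k = i then 1 else 0) + (if k = j then 1 else 0)" for k
      by (auto simp: lookup_add lookup_single when_def)
    have "keys ?\<alpha> \<subseteq> {i, j}"
      using keys_add [of "Poly_Mapping.single i (1::nat)" "Poly_Mapping.single j 1"] by auto
    then have "keys ?\<alpha> \<subseteq> {l..<t}" using 2 bounds by auto
    moreover have "(\<Sum>k\<in>{d..<t}. lookup ?\<alpha> k) = 1" "(\<Sum>k\<in>{l..<d}. lookup ?\<alpha> k) = 1"
      unfolding lk sum.distrib using 2 by simp_all
    ultimately have "?\<alpha> \<in> balanced" by (simp add: balanced_def)
    then show ?thesis
      using 2 entry
      by (intro exI [of _ "Poly_Mapping.single ?\<alpha> 1"]) (simp add: supp_in_single mono_eval_add \<sigma>_index)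
  qed
next
  case (add p q)
  then show ?case by (metis supp_in_add peval_add)
next
  case (mult p q)
  then show ?case by (metis supp_in_mult peval_mult)
qed

text \<open>A balanced monomial is a product of monomials z_i z_j with \<open>i\<close> a row and
  \<open>j\<close> a column of the block, which are entries of \<open>\<sigma> z\<close>; one such
  factor is split off at a time.\<close>

lemma mono_eval_poly_funs:
  assumes "\<alpha> \<in> balanced"
  shows "\<exists>f\<in>poly_funs n. \<forall>z. f (\<sigma> z) = mono_eval \<alpha> z"
  using assms
proof (induction "\<Sum>i\<in>{d..<t}. lookup \<alpha> i" arbitrary: \<alpha>)
  case 0
  then have "\<forall>i\<in>{d..<t}. lookup \<alpha> i = 0" "\<forall>i\<in>{l..<d}. lookup \<alpha> i = 0"
    by (simp_all add: balanced_def)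
  moreover have "lookup \<alpha> i = 0" if "i \<notin> {l..<t}" for i
    using 0(2) that by (auto simp: balanced_def in_keys_iff subset_iff)
  ultimately have "\<alpha> = 0"
    by (intro poly_mapping_eqI) (metis atLeastLessThan_iff linorder_not_less lookup_zero)
  then show ?case by (intro bexI [OF _ poly_funs.const [of 1]]) simp
next
  case (Suc k)
  have "(\<Sum>i\<in>{l..<d}. lookup \<alpha> i) = Suc k" using Suc(2,3) by (simp add: balanced_def)
  then obtain j where j: "j \<in> {l..<d}" "lookup \<alpha> j \<noteq> 0"
    by (metis nat.distinct(1) sum.neutral)
  obtain i where i: "i \<in> {d..<t}" "lookup \<alpha> i \<noteq> 0"
    using Suc(2) by (metis nat.distinct(1) sum.neutral)
  let ?u = "Poly_Mapping.single i 1 + Poly_Mapping.single j 1 :: nat \<Rightarrow>\<^sub>0 nat"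
  define \<beta> where "\<beta> = \<alpha> - ?u"
  have lk: "lookup ?u k = (if k = i then 1 else 0) + (if k = j then 1 else 0)" for k
    by (auto simp: lookup_add lookup_single when_def)
  have le: "lookup ?u k \<le> lookup \<alpha> k" for k
    unfolding lk using i j by auto
  have \<alpha>: "\<alpha> = ?u + \<beta>"
  proof (rule poly_mapping_eqI)
    fix k
    have "lookup \<beta> k = lookup \<alpha> k - lookup ?u k" by (simp add: \<beta>_def minus_poly_mapping.rep_eq)
    then show "lookup \<alpha> k = lookup (?u + \<beta>) k"
      using le [of k] by (simp only: lookup_add [of ?u \<beta>])
  qed
  have usum: "(\<Sum>k\<in>{d..<t}. lookup ?u k) = 1" "(\<Sum>k\<in>{l..<d}. lookup ?u k) = 1"
    unfolding lk sum.distrib using i j by simp_all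
  have "keys ?u \<subseteq> {i, j}"
    using keys_add [of "Poly_Mapping.single i (1::nat)" "Poly_Mapping.single j 1"] by auto
  then have "keys ?u \<subseteq> {l..<t}" using i j bounds by auto
  then have "?u \<in> balanced" using usum by (simp add: balanced_def)
  then have \<beta>: "\<beta> \<in> balanced" using Suc(3) cancel_mem unfolding \<alpha> by blast
  have "(\<Sum>i\<in>{d..<t}. lookup \<alpha> i) = 1 + (\<Sum>i\<in>{d..<t}. lookup \<beta> i)"
    unfolding \<alpha> lookup_add [of ?u \<beta>] sum.distrib usum ..
  then obtain f where f: "f \<in> poly_funs n" "\<forall>z. f (\<sigma> z) = mono_eval \<beta> z"
    using Suc(1) [of \<beta>] Suc(2) \<beta> by auto
  have ijn: "i < n" "j < n" using i j bounds by auto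
  show ?case
  proof (rule bexI [OF _ poly_funs.mult [OF poly_funs.entry [OF ijn] f(1)]])
    show "\<forall>z. \<sigma> z $$ (i, j) * f (\<sigma> z) = mono_eval \<alpha> z"
      unfolding \<alpha> using i j ijn f(2) by (simp add: mono_eval_add \<sigma>_index)
  qed
qed

lemma peval_imp_poly_funs:
  assumes "supp_in P"
  shows "\<exists>f\<in>poly_funs n. \<forall>z. f (\<sigma> z) = peval P z"
proof -
  have "\<forall>\<alpha>\<in>keys P. \<exists>f\<in>poly_funs n. \<forall>z. f (\<sigma> z) = mono_eval \<alpha> z"
    using assms mono_eval_poly_funs unfolding supp_in_def by blast
  then obtain f where f: "\<And>\<alpha>. \<alpha> \<in> keys P \<Longrightarrow> f \<alpha> \<in> poly_funs n"
    "\<And>\<alpha> z. \<alpha> \<in> keys P \<Longrightarrow> f \<alpha> (\<sigma> z) = mono_eval \<alpha> z"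
    by metis
  have "(\<lambda>g. \<Sum>\<alpha>\<in>keys P. lookup P \<alpha> * f \<alpha> g) \<in> poly_funs n"
    by (intro poly_funs_sum poly_funs.mult poly_funs.const f(1))
  then show ?thesis
    by (rule bexI [rotated]) (simp add: peval_def f(2))
qed

context
  fixes c :: "complex mat"
  assumes c: "c \<in> Borel n"
begin

lemma translate_\<sigma>: "c * \<sigma> z \<in> carrier (SL n)" "proj n d (c * \<sigma> z) \<in> X"
  using Borel_SL [OF c] \<sigma>_SL Schubert_translate [OF dn c \<sigma>_SL \<sigma>_Schubert] by blast+

lemma poly_funs_translate_imp_peval:
  assumes "f \<in> poly_funs n"
  obtains P where "supp_in P" "\<And>z. peval P z = f (c * \<sigma> z)"
proof -
  obtain f' where f': "f' \<in> poly_funs n" "\<forall>g\<in>carrier_mat n n. f' g = f (c * g)"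
    using poly_funs_translate [OF assms SL_dim(1) [OF Borel_SL [OF c]]] by blast
  obtain P where "supp_in P" "\<forall>z. peval P z = f' (\<sigma> z)"
    using poly_funs_imp_peval [OF f'(1)] by blast
  then show thesis using that f'(2) SL_dim(1) [OF \<sigma>_SL] by metis
qed

text \<open>A regular function near a translated chart point becomes a fraction of the monomial
  algebra; the nonvanishing of \<open>G\<close> marks a neighbourhood where the fraction is
  valid.\<close>

lemma local_fraction:
  assumes V: "openin (subtopology (GP_zariski n d) X) V" and f: "regular_on n d V f"
    and z: "proj n d (c * \<sigma> z) \<in> V"
  shows "\<exists>P Q G. supp_in P \<and> supp_in Q \<and> supp_in G \<and> peval G z \<noteq> 0 \<and>
    (\<forall>z. peval G z \<noteq> 0 \<longrightarrow> proj n d (c * \<sigma> z) \<in> V \<and> peval Q z \<noteq> 0 \<and>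
      f (proj n d (c * \<sigma> z)) = peval P z / peval Q z)"
proof -
  obtain U where U: "openin (GP_zariski n d) U" "V = U \<inter> X"
    using V unfolding openin_subtopology by blast
  obtain u where u: "u \<in> poly_funs n" "u (c * \<sigma> z) \<noteq> 0"
    "\<And>h. h \<in> carrier (SL n) \<Longrightarrow> u h \<noteq> 0 \<Longrightarrow> proj n d h \<in> U"
    using GP_open_nhd [OF U(1) translate_\<sigma>(1)] z U(2) by blast
  obtain p q e where pq: "p \<in> poly_funs n" "q \<in> poly_funs n" "e \<in> poly_funs n" "e (c * \<sigma> z) \<noteq> 0"
    "\<And>h. h \<in> carrier (SL n) \<Longrightarrow> proj n d h \<in> V \<Longrightarrow> e h \<noteq> 0 \<Longrightarrow>
      q h \<noteq> 0 \<and> f (proj n d h) = p h / q h"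
    using regular_on_fraction [OF f translate_\<sigma>(1) z] by blast
  obtain P where P: "supp_in P" "\<And>z. peval P z = p (c * \<sigma> z)"
    using poly_funs_translate_imp_peval [OF pq(1)] by blast
  obtain Q where Q: "supp_in Q" "\<And>z. peval Q z = q (c * \<sigma> z)"
    using poly_funs_translate_imp_peval [OF pq(2)] by blast
  obtain G where G: "supp_in G" "\<And>z. peval G z = e (c * \<sigma> z) * u (c * \<sigma> z)"
    using poly_funs_translate_imp_peval [OF poly_funs.mult [OF pq(3) u(1)]] by blast
  have "proj n d (c * \<sigma> z) \<in> V \<and> peval Q z \<noteq> 0 \<and> f (proj n d (c * \<sigma> z)) = peval P z / peval Q z"
    if "peval G z \<noteq> 0" for z
  proof -
    have "u (c * \<sigma> z) \<noteq> 0" "e (c * \<sigma> z) \<noteq> 0" using that G(2) by auto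
    then have "proj n d (c * \<sigma> z) \<in> V" using u(3) translate_\<sigma> U(2) by blast
    then show ?thesis using pq(5) [OF translate_\<sigma>(1)] \<open>e (c * \<sigma> z) \<noteq> 0\<close> P(2) Q(2) by simp
  qed
  then show ?thesis using P(1) Q(1) G u(2) pq(4)
    by (intro exI [of _ P] exI [of _ Q] exI [of _ G]) simp
qed

end

text \<open>If P / Q satisfies a monic equation with coefficients A_i / S_i, and s is the product of
  all S_i, then s P / Q satisfies one with coefficients in the algebra. Where \<open>D\<close> is
  nonzero, the given equation is known to hold.\<close>

lemma clear_denominators:
  fixes P Q D :: "(nat \<Rightarrow>\<^sub>0 nat) \<Rightarrow>\<^sub>0 complex" and A S :: "nat \<Rightarrow> (nat \<Rightarrow>\<^sub>0 nat) \<Rightarrow>\<^sub>0 complex"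
  assumes supp: "supp_in P" "supp_in Q" "\<And>i. i < m \<Longrightarrow> supp_in (A i)" "\<And>i. i < m \<Longrightarrow> supp_in (S i)"
    and nz: "Q \<noteq> 0" "D \<noteq> 0" "0 < m"
    and SQ: "\<And>z. peval D z \<noteq> 0 \<Longrightarrow> peval Q z \<noteq> 0"
      "\<And>z i. peval D z \<noteq> 0 \<Longrightarrow> i < m \<Longrightarrow> peval (S i) z \<noteq> 0"
    and eq: "\<And>z. peval D z \<noteq> 0 \<Longrightarrow> (peval P z / peval Q z) ^ m +
      (\<Sum>i<m. peval (A i) z / peval (S i) z * (peval P z / peval Q z) ^ i) = 0"
  shows "\<exists>r. supp_in r \<and> (\<Prod>i<m. S i) * P = Q * r"
proof -
  define s where "s = (\<Prod>i<m. S i)"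
  define T where "T i = (\<Prod>j\<in>{..<m} - {i}. S j)" for i
  \<comment> \<open>The coefficient s^(m - i) A_i / S_i in the equation for s P / Q, with T_i = s /
    S_i.\<close>
  define b where "b i = A i * T i * s ^ (m - 1 - i)" for i
  have s_T: "s = S i * T i" if "i < m" for i
    unfolding s_def T_def using that by (subst prod.remove [of _ i]) auto
  have "supp_in s" unfolding s_def using supp(4) by (intro supp_in_prod) auto
  let ?E = "(s * P) ^ m + (\<Sum>i<m. b i * (s * P) ^ i * Q ^ (m - i))"
  \<comment> \<open>Multiplied by \<open>D\<close>, the equation holds for all \<open>z\<close> and
    so as an identity of polynomials.\<close>
  have "peval (D * ?E) z = 0" for z
  proof (cases "peval D z = 0")
    case False
    let ?s = "peval s z" and ?P = "peval P z" and ?Q = "peval Q z"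
    have summand: "peval (b i * (s * P) ^ i * Q ^ (m - i)) z =
        ?s ^ m * ?Q ^ m * (peval (A i) z / peval (S i) z * (?P / ?Q) ^ i)" if i: "i < m" for i
    proof -
      have "?Q ^ m = ?Q ^ i * ?Q ^ (m - i)" using i by (simp flip: power_add)
      moreover have "m = Suc (m - 1 - i + i)" using i by simp
      then have "?s ^ m = ?s * ?s ^ (m - 1 - i) * ?s ^ i" by (metis power_Suc power_add mult.assoc)
      moreover have "?s = peval (S i) z * peval (T i) z" using s_T [OF i] peval_mult by metis
      ultimately show ?thesis
        using SQ(1) [OF False] SQ(2) [OF False i]
        by (simp add: b_def peval_mult peval_power power_mult_distrib power_divide)
    qed
    have "peval ?E z = ?s ^ m * ?P ^ m +
        (\<Sum>i<m. ?s ^ m * ?Q ^ m * (peval (A i) z / peval (S i) z * (?P / ?Q) ^ i))"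
      unfolding peval_add peval_sum
      by (intro arg_cong2 [of _ _ _ _ "(+)"] sum.cong refl summand)
        (simp_all add: peval_power peval_mult power_mult_distrib)
    also have "?s ^ m * ?P ^ m = ?s ^ m * ?Q ^ m * (?P / ?Q) ^ m"
      using SQ(1) [OF False] by (simp add: power_divide)
    finally have "peval ?E z = ?s ^ m * ?Q ^ m * ((?P / ?Q) ^ m +
        (\<Sum>i<m. peval (A i) z / peval (S i) z * (?P / ?Q) ^ i))"
      by (simp only: distrib_left sum_distrib_left)
    then show ?thesis using eq [OF False] by (simp add: peval_mult)
  qed (simp add: peval_mult)
  then have "D * ?E = 0" using peval_eq_0_iff by blast
  then have "?E = 0" using nz(2) by simp
  moreover have "supp_in (b i)" if "i < m" for i
    unfolding b_def T_def using supp \<open>supp_in s\<close> that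
    by (intro supp_in_mult supp_in_power supp_in_prod) auto
  ultimately show ?thesis
    using integral_imp_dvd [of "s * P" Q m b] supp(1,2) \<open>supp_in s\<close> nz
    by (simp add: supp_in_mult s_def)
qed

text \<open>Around \<open>pt\<close> the variety is parametrized by a translate of
  \<open>\<sigma>\<close>, and the coefficients have there a common denominator \<open>s\<close>
  that does not vanish at \<open>pt\<close>. As \<phi> is generically a fraction of the algebra, s
  \<phi> equals some \<open>r\<close> of the algebra, and r / s is the extension.\<close>

lemma normal_at:
  assumes pt: "pt \<in> X" and V: "openin (subtopology (GP_zariski n d) X) V" "V \<noteq> {}"
    and \<phi>: "regular_on n d V \<phi>"
    and W: "openin (subtopology (GP_zariski n d) X) W" "pt \<in> W" and m: "0 < m"
    and coef: "\<And>i. i < m \<Longrightarrow> regular_on n d W (coef i)"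
    and eq: "\<And>y. y \<in> V \<inter> W \<Longrightarrow> \<phi> y ^ m + (\<Sum>i<m. coef i y * \<phi> y ^ i) = 0"
  shows "\<exists>W f. openin (subtopology (GP_zariski n d) X) W \<and> pt \<in> W \<and> regular_on n d W f \<and>
    (\<forall>y\<in>V \<inter> W. f y = \<phi> y)"
proof -
  have "pt \<in> GP n d" using pt Schubert_subset_GP by blast
  then obtain g where g: "g \<in> carrier (SL n)" "pt = proj n d g" unfolding GP_eq by blast
  obtain N where N: "lead_minor d (shear n d N * g) \<noteq> 0" using shear_into_chart [OF dn g(1)] .
  \<comment> \<open>The shear \<open>b\<close> moves \<open>pt\<close> into the chart and
    \<open>c\<close> is its inverse, so that \<open>\<tau>\<close> below parametrizes the part of X
    in the translated chart.\<close>
  define b where "b = shear n d N"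
  define c where "c = shear n d (\<lambda>i j. - N i j)"
  have b: "b \<in> Borel n" "b \<in> carrier (SL n)" and c: "c \<in> Borel n" "c \<in> carrier (SL n)"
    using shear_Borel Borel_SL by (auto simp: b_def c_def)
  have cb: "c * (b * h) = h" and bc: "b * (c * h) = h" if "h \<in> carrier (SL n)" for h
    using assoc_mult_mat [of c n n b n h n] assoc_mult_mat [of b n n c n h n]
      SL_dim(1) [OF b(2)] SL_dim(1) [OF c(2)] SL_dim(1) [OF that]
    by (simp_all add: b_def c_def shear_inverse)
  define \<tau> where "\<tau> z = c * \<sigma> z" for z
  have \<tau>: "\<tau> z \<in> carrier (SL n)" "proj n d (\<tau> z) \<in> X" "b * \<tau> z = \<sigma> z" for z
    using translate_\<sigma> [OF c(1)] bc [OF \<sigma>_SL] by (auto simp: \<tau>_def)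
  have chart: "\<exists>z. normal_form n d (b * h) = \<sigma> z \<and> proj n d h = proj n d (\<tau> z)"
    if h: "h \<in> carrier (SL n)" "proj n d h \<in> X" "lead_minor d (b * h) \<noteq> 0" for h
  proof -
    have bh: "b * h \<in> carrier (SL n)" using b h(1) by blast
    obtain z where z: "normal_form n d (b * h) = \<sigma> z"
      using normal_form_Schubert [OF bh Schubert_translate [OF dn b(1) h(1,2)] h(3)] by blast
    then have "proj n d (\<sigma> z) = proj n d (b * h)" using proj_normal_form [OF dn bh h(3)] by simp
    then have "c <#\<^bsub>SL n\<^esub> proj n d (\<sigma> z) = c <#\<^bsub>SL n\<^esub> proj n d (b * h)" by simp
    then have "proj n d (\<tau> z) = proj n d h"
      unfolding l_coset_proj [OF dn c(2) \<sigma>_SL] l_coset_proj [OF dn c(2) bh] cb [OF h(1)] \<tau>_def .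
    then show ?thesis using z by metis
  qed
  have frac: "\<exists>P Q G. supp_in P \<and> supp_in Q \<and> supp_in G \<and> peval G z \<noteq> 0 \<and>
      (\<forall>z. peval G z \<noteq> 0 \<longrightarrow> proj n d (\<tau> z) \<in> V \<and> peval Q z \<noteq> 0 \<and>
        f (proj n d (\<tau> z)) = peval P z / peval Q z)"
    if "openin (subtopology (GP_zariski n d) X) V" "regular_on n d V f" "proj n d (\<tau> z) \<in> V" for V f z
    using local_fraction [OF c(1) that(1,2)] that(3) unfolding \<tau>_def by blast
  have lead_g: "lead_minor d (b * g) \<noteq> 0" using N by (simp add: b_def)
  obtain z0 where z0: "normal_form n d (b * g) = \<sigma> z0" "pt = proj n d (\<tau> z0)"
    using chart [OF g(1) _ lead_g] pt g(2) by metis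

  have "\<forall>i<m. \<exists>P Q G. supp_in P \<and> supp_in Q \<and> supp_in G \<and> peval G z0 \<noteq> 0 \<and>
      (\<forall>z. peval G z \<noteq> 0 \<longrightarrow> proj n d (\<tau> z) \<in> W \<and> peval Q z \<noteq> 0 \<and>
        coef i (proj n d (\<tau> z)) = peval P z / peval Q z)"
    using frac [OF W(1) coef] W(2) z0(2) by blast
  then obtain A S G where ASG:
    "\<And>i. i < m \<Longrightarrow> supp_in (A i)" "\<And>i. i < m \<Longrightarrow> supp_in (S i)" "\<And>i. i < m \<Longrightarrow> supp_in (G i)"
    "\<And>i. i < m \<Longrightarrow> peval (G i) z0 \<noteq> 0"
    "\<And>i z. i < m \<Longrightarrow> peval (G i) z \<noteq> 0 \<Longrightarrow> proj n d (\<tau> z) \<in> W \<and> peval (S i) z \<noteq> 0 \<and>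
        coef i (proj n d (\<tau> z)) = peval (A i) z / peval (S i) z"
    by metis
  define s where "s = (\<Prod>i<m. S i)"
  have s: "supp_in s" "peval s z0 \<noteq> 0"
    using ASG(2,4,5) by (auto simp: s_def peval_prod intro!: supp_in_prod)

  \<comment> \<open>The point \<open>pt\<close> may lie outside \<open>V\<close>; by irreducibility
    \<open>V\<close> meets the translated chart, which is \<open>\<Omega>\<close>.\<close>
  obtain z1 where z1: "proj n d (\<tau> z1) \<in> V"
  proof -
    obtain V' where V': "openin (GP_zariski n d) V'" "V = V' \<inter> X"
      using V(1) unfolding openin_subtopology by blast
    obtain \<Omega> where \<Omega>: "openin (GP_zariski n d) \<Omega>"
      "\<And>g. g \<in> carrier (SL n) \<Longrightarrow> proj n d g \<in> \<Omega> \<longleftrightarrow>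
        lead_minor d (b * g) \<noteq> 0 \<and> (1::complex) \<noteq> 0"
      using chart_nonzero_open [OF dn poly_funs.const [of 1] b(2)] by blast
    have "pt \<in> \<Omega> \<inter> X" using \<Omega>(2) [OF g(1)] lead_g pt g(2) by simp
    then obtain v where v: "v \<in> V'" "v \<in> \<Omega>" "v \<in> X"
      using opens_meet [OF V'(1) _ \<Omega>(1)] V(2) V'(2) by blast
    then have "v \<in> GP n d" using Schubert_subset_GP by blast
    then obtain h where h: "h \<in> carrier (SL n)" "v = proj n d h" unfolding GP_eq by blast
    then have "lead_minor d (b * h) \<noteq> 0" using \<Omega>(2) v(2) by blast
    then obtain z where "proj n d h = proj n d (\<tau> z)" using chart [OF h(1)] v(3) h(2) by blast
    then show thesis using that v V'(2) h(2) by auto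
  qed
  obtain P Q G1 where PQ: "supp_in P" "supp_in Q" "supp_in G1" "peval G1 z1 \<noteq> 0"
    "\<And>z. peval G1 z \<noteq> 0 \<Longrightarrow> proj n d (\<tau> z) \<in> V \<and> peval Q z \<noteq> 0 \<and>
        \<phi> (proj n d (\<tau> z)) = peval P z / peval Q z"
    using frac [OF V(1) \<phi> z1] by blast
  have nz: "G1 \<noteq> 0" "Q \<noteq> 0" using PQ(4) PQ(5) [OF PQ(4)] by auto

  obtain r where r: "supp_in r" "s * P = Q * r"
  proof -
    define D where "D = G1 * (\<Prod>i<m. G i)"
    have "(\<Prod>i<m. G i) \<noteq> 0" using ASG(4) peval_0 [of z0] by (metis finite_lessThan lessThan_iff prod_zero_iff)
    then have "D \<noteq> 0" using nz by (simp add: D_def)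
    have D: "peval G1 z \<noteq> 0 \<and> (\<forall>i<m. peval (G i) z \<noteq> 0)" if "peval D z \<noteq> 0" for z
      using that by (auto simp: D_def peval_mult peval_prod)
    have "\<exists>r. supp_in r \<and> (\<Prod>i<m. S i) * P = Q * r"
    proof (rule clear_denominators [OF PQ(1,2) ASG(1,2) nz(2) \<open>D \<noteq> 0\<close> m])
      fix z assume z: "peval D z \<noteq> 0"
      show "peval Q z \<noteq> 0" using D [OF z] PQ(5) by blast
      show "peval (S i) z \<noteq> 0" if "i < m" for i using D [OF z] ASG(5) that by blast
      have "proj n d (\<tau> z) \<in> V \<inter> W" using D [OF z] PQ(5) ASG(5) m by blast
      from eq [OF this] show "(peval P z / peval Q z) ^ m +
          (\<Sum>i<m. peval (A i) z / peval (S i) z * (peval P z / peval Q z) ^ i) = 0"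
        using D [OF z] PQ(5) [of z] ASG(5) [of _ z] by simp
    qed
    then show thesis using that by (auto simp: s_def)
  qed

  obtain r' s' where r': "r' \<in> poly_funs n" "\<forall>z. r' (\<sigma> z) = peval r z"
    and s': "s' \<in> poly_funs n" "\<forall>z. s' (\<sigma> z) = peval s z"
    using peval_imp_poly_funs r(1) s(1) by meson
  obtain U where U: "openin (GP_zariski n d) U"
    "\<And>g. g \<in> carrier (SL n) \<Longrightarrow> proj n d g \<in> U \<longleftrightarrow>
      lead_minor d (b * g) \<noteq> 0 \<and> s' (normal_form n d (b * g)) \<noteq> 0"
    using chart_nonzero_open [OF dn s'(1) b(2)] by blast
  \<comment> \<open>A function on cosets is written through a chosen representative; the normal form
    removes the dependence on the choice.\<close>
  define rep where "rep y = (SOME h. h \<in> carrier (SL n) \<and> proj n d h = y)" for y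
  define F where "F y = r' (normal_form n d (b * rep y)) / s' (normal_form n d (b * rep y))" for y
  have F: "F (proj n d h) = r' (normal_form n d (b * h)) / s' (normal_form n d (b * h))"
    if h: "h \<in> carrier (SL n)" "proj n d h \<in> U" for h
  proof -
    have rep: "rep (proj n d h) \<in> carrier (SL n) \<and> proj n d (rep (proj n d h)) = proj n d h"
      unfolding rep_def
      by (rule someI [of "\<lambda>h'. h' \<in> carrier (SL n) \<and> proj n d h' = proj n d h" h]) (simp add: h(1))
    then obtain p where p: "p \<in> Parabolic n d" "rep (proj n d h) = h * p"
      using proj_eq_iff [OF dn h(1), of "rep (proj n d h)"] by metis
    have bh: "b * h \<in> carrier (SL n)" using b h(1) by blast
    have "b * (h * p) = b * h * p"
      using assoc_mult_mat [of b n n h n p n] SL_dim(1) b h ParabolicD(1) [OF p(1)] by simp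
    then have "normal_form n d (b * rep (proj n d h)) = normal_form n d (b * h)"
      using normal_form_Parabolic [OF dn bh p(1)] U(2) [OF h(1)] h(2) p(2) by simp
    then show ?thesis by (simp add: F_def)
  qed
  have regF: "GP_regular n d U F"
    by (rule chart_quotient_regular [OF dn r'(1) s'(1) b(2)]) (use U(2) F in blast)+
  show ?thesis
  proof (intro exI conjI ballI)
    show "openin (subtopology (GP_zariski n d) X) (U \<inter> X)"
      using U(1) by (auto simp: openin_subtopology)
    show "pt \<in> U \<inter> X" using U(2) [OF g(1)] lead_g z0(1) s' s(2) pt g(2) by simp
    show "regular_on n d (U \<inter> X) F" unfolding regular_on_def using U(1) regF by blast
    fix y assume y: "y \<in> V \<inter> (U \<inter> X)"
    then have "y \<in> GP n d" using Schubert_subset_GP by blast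
    then obtain h where h: "h \<in> carrier (SL n)" "y = proj n d h" unfolding GP_eq by blast
    have hU: "lead_minor d (b * h) \<noteq> 0" "s' (normal_form n d (b * h)) \<noteq> 0"
      using U(2) [OF h(1)] y h(2) by auto
    obtain z2 where z2: "normal_form n d (b * h) = \<sigma> z2" "y = proj n d (\<tau> z2)"
      using chart [OF h(1) _ hU(1)] y h(2) by blast
    have Fy: "F y = peval r z2 / peval s z2" "peval s z2 \<noteq> 0"
      using F [OF h(1)] y h(2) z2(1) r'(2) s'(2) hU(2) by auto
    \<comment> \<open>P / Q is known to represent \<phi> only where \<open>G1\<close> is nonzero, so
      at \<open>y\<close> a second fraction is taken. The two agree where \<open>G1\<close> and
      \<open>G2\<close> are nonzero, hence P Q2 = P2 Q as polynomials.\<close>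
    obtain P2 Q2 G2 where PQ2: "peval G2 z2 \<noteq> 0"
      "\<And>z. peval G2 z \<noteq> 0 \<Longrightarrow> peval Q2 z \<noteq> 0 \<and> \<phi> (proj n d (\<tau> z)) = peval P2 z / peval Q2 z"
      using frac [OF V(1) \<phi>, of z2] y z2(2) by blast
    have "G2 \<noteq> 0" using PQ2(1) by auto
    have "peval (G1 * G2 * (P * Q2 - P2 * Q)) z = 0" for z
    proof (cases "peval G1 z = 0 \<or> peval G2 z = 0")
      case False
      then have "peval P z / peval Q z = peval P2 z / peval Q2 z" "peval Q z \<noteq> 0" "peval Q2 z \<noteq> 0"
        using PQ(5) [of z] PQ2(2) [of z] by auto
      then have "peval P z * peval Q2 z = peval P2 z * peval Q z" by (simp add: frac_eq_eq)
      moreover have "peval (P * Q2 - P2 * Q) z + peval (P2 * Q) z = peval (P * Q2) z"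
        using peval_add [of "P * Q2 - P2 * Q" "P2 * Q" z] by simp
      ultimately show ?thesis by (simp add: peval_mult)
    qed (auto simp: peval_mult)
    then have "G1 * G2 * (P * Q2 - P2 * Q) = 0" using peval_eq_0_iff by blast
    then have "P * Q2 = P2 * Q" using nz(1) \<open>G2 \<noteq> 0\<close> by simp
    then have "Q * (s * P2) = s * P * Q2" by (simp add: algebra_simps)
    also have "\<dots> = Q * (r * Q2)" unfolding r(2) by (simp add: algebra_simps)
    finally have "s * P2 = r * Q2" using nz(2) by simp
    then have "peval s z2 * peval P2 z2 = peval r z2 * peval Q2 z2" by (metis peval_mult)
    moreover have "peval Q2 z2 \<noteq> 0" "\<phi> y = peval P2 z2 / peval Q2 z2"
      using PQ2(2) [OF PQ2(1)] z2(2) by auto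
    ultimately show "F y = \<phi> y"
      using Fy by (simp add: frac_eq_eq mult.commute)
  qed
qed

lemma toric_Schubert: "toric_variety n d X"
  unfolding toric_variety_def normal_variety_def Let_def
proof (intro conjI irreducible_Schubert dense_torus_orbit ballI allI impI)
  fix x V \<phi>
  assume "x \<in> X" and *: "openin (subtopology (GP_zariski n d) X) V \<and> V \<noteq> {} \<and> regular_on n d V \<phi> \<and>
    (\<exists>W m c. openin (subtopology (GP_zariski n d) X) W \<and> x \<in> W \<and> 0 < m \<and>
      (\<forall>i<m. regular_on n d W (c i)) \<and>
      (\<forall>y\<in>V \<inter> W. \<phi> y ^ m + (\<Sum>i<m. c i y * \<phi> y ^ i) = 0))"
  then obtain W m c where W: "openin (subtopology (GP_zariski n d) X) W" "x \<in> W" "0 < m"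
    "\<And>i. i < m \<Longrightarrow> regular_on n d W (c i)"
    "\<And>y. y \<in> V \<inter> W \<Longrightarrow> \<phi> y ^ m + (\<Sum>i<m. c i y * \<phi> y ^ i) = 0"
    by blast
  show "\<exists>W f. openin (subtopology (GP_zariski n d) X) W \<and> x \<in> W \<and> regular_on n d W f \<and>
    (\<forall>y\<in>V \<inter> W. f y = \<phi> y)"
    by (rule normal_at [where coef = c, OF \<open>x \<in> X\<close> _ _ _ W]) (use * in blast)+
qed

end

lemma toric_iff_hook:
  assumes d: "1 \<le> d" "d \<le> n - 1" and w: "w \<in> min_coset_reps n d"
  shows "toric_variety n d (Schubert n d w) \<longleftrightarrow> (\<exists>x y. is_hook d x y w)"
proof
  assume "toric_variety n d (Schubert n d w)"
  then show "\<exists>x y. is_hook d x y w"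
    using hook_or_big [OF w d] big_not_toric [OF w] d by fastforce
next
  assume "\<exists>x y. is_hook d x y w"
  then obtain x y where "is_hook d x y w" by blast
  then interpret hook_schubert n d x y w
    using d w by unfold_locales auto
  show "toric_variety n d (Schubert n d w)" by (rule toric_Schubert)
qed

theorem proposition3p1:
  fixes n d :: nat and w :: "nat \<Rightarrow> nat"
  assumes "1 \<le> d" and "d \<le> n - 1" and "w \<in> min_coset_reps n d"
  shows
    "(toric_variety n d (Schubert n d w) \<longleftrightarrow>
       w = id \<or>
       (\<exists>x y. 1 \<le> x \<and> x \<le> n - d \<and> y \<le> d - 1 \<and>
          reduced_decomposition n w (rev [d+1..<d+x] @ [d-y..<d+1])))
     \<and>
     (toric_variety n d (Schubert n d w) \<longleftrightarrow>
       partition_of d w = [] \<or>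
       hook_shaped (partition_of d w) \<and> in_rectangle d (n - d) (partition_of d w))"
  unfolding toric_iff_hook [OF assms] reduced_iff_hook [OF assms(3,1,2)]
    partition_iff_hook [OF assms(3,1,2)]
  by simp

end
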